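(* Let $M \subseteq \mathrm{Inj}(\Omega)$ be a normal submonoid. Then $M = M_{\mathrm{gp}} \cup M_{\mathrm{fin}} \cup M_{\infty}$ (where $M_{\mathrm{gp}} = M\cap \mathrm{Sym}(\Omega)$, $M_{\mathrm{fin}} = M\cap \mathrm{Inj}_{\mathrm{fin}}(\Omega)$, $M_\infty = M \cap \mathrm{Inj}_\infty(\Omega)$), and: (1) $M_{\mathrm{gp}} \in \{\{1\}, \mathrm{Alt}(\Omega), \mathrm{Fin}(\Omega), \mathrm{Sym}(\Omega)\}$; (2) $M_{\mathrm{fin}} = B \cup \{f \in \mathrm{Inj}(\Omega) : |\Omega \setminus (\Omega)f| \in N \setminus (\mathrm{Gn}(N) \cup \{0\})\}$ for some additive submonoid $N \subseteq \mathbb{N}$ and some normal subset $B \subseteq \mathrm{Inj}(\Omega)$ satisfying $\{|\Omega \setminus (\Omega)f| : f \in B\} = \mathrm{Gn}(N)$; (3) $M_{\infty} \in \{\emptyset, \mathrm{Inj}_{\infty}(\Omega)\}$. Moreover: if $M_{\mathrm{gp}} = \mathrm{Alt}(\Omega)$, then (i) the subset of $B$ consisting of maps $f$ with $(f)\mathrm{C}_{\mathrm{open}}+(f)\mathrm{C}_{\mathrm{fwd}}\ge 2$ or with $(f)\mathrm{C}_n=\aleph_0$ for some $n\in\mathbb{Z}_+$ is $\approx_{\mathrm{fin}}$-closed, and (ii) the subset of $B$ consisting of maps $f$ with $(f)\mathrm{C}_{\mathrm{open}}+(f)\mathrm{C}_{\mathrm{fwd}}=1$ and $(f)\mathrm{C}_n<\aleph_0$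 for all $n \in \mathbb{Z}_+$ is $\approx_{\mathrm{even}}$-closed; if $M_{\mathrm{gp}} = \mathrm{Fin}(\Omega)$, then $B$ is $\approx_{\mathrm{fin}}$-closed; if $M_{\mathrm{gp}} = \mathrm{Sym}(\Omega)$, then $B = \{f \in \mathrm{Inj}(\Omega) : |\Omega \setminus (\Omega)f| \in \mathrm{Gn}(N)\}$. Conversely, if $M = M_{\mathrm{gp}} \cup M_{\mathrm{fin}} \cup M_{\infty}$ where $M_{\mathrm{gp}}$ satisfies (1), $M_{\mathrm{fin}}$ is as in (2), $M_\infty$ satisfies (3), and $B$ satisfies the additional condition above corresponding to $M_{\mathrm{gp}}$ (none if $M_{\mathrm{gp}}=\{1\}$), then $M$ is a normal submonoid of $\mathrm{Inj}(\Omega)$.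
   Context: $\Omega$ is a countably infinite set. Maps are written on the right of their arguments and composed left to right: $(\alpha)fg = ((\alpha)f)g$. $\mathrm{Inj}(\Omega)$ is the monoid of all injective maps $\Omega\to\Omega$ under composition, with identity $1$; $\mathrm{Sym}(\Omega)$ is the group of all permutations of $\Omega$. $\mathrm{Fin}(\Omega)$ is the subgroup of permutations moving only finitely many points, and $\mathrm{Alt}(\Omega)$ the subgroup of even finitary permutations. $\mathrm{Inj}_{\mathrm{fin}}(\Omega)=\{f\in\mathrm{Inj}(\Omega): 1\le |\Omega\setminus(\Omega)f|<\aleph_0\}$ and $\mathrm{Inj}_\infty(\Omega)=\{f\in\mathrm{Inj}(\Omega): |\Omega\setminus(\Omega)f|=\aleph_0\}$. A subset of $\mathrm{Inj}(\Omega)$ is normal if it is closed under $f\mapsto afa^{-1}$ for all $a\in\mathrm{Sym}(\Omega)$. $\mathbb{N}$ denotes the nonnegative integers, $\mathbb{Z}_+$ the positive integers. For an additive submonoid $N\subseteq\mathbb{N}$, $\mathrm{Gn}(N)$ denotes its unique minimal generating set as a monoid (the intersection of all its generating sets). Cycles: for $f\in\mathrm{Inj}(\Omega)$, a cycle of $f$ is a nonempty $\Sigma\subseteq\Omega$ such that (a) for all $\alpha\in\Omega$, $(\alpha)f\in\Sigma$ iff $\alpha\in\Sigma$, and (b) no proper nonempty subset of $\Sigma$ satisfies (a); the cycles of $f$ partition $\Omega$. A forward cycle is an infinite cycle $\Sigma$ with $\Sigma\setminus(\Omega)f\neq\emptyset$; an open cycle is an infinite cycle that is not forward. For $n\in\mathbb{Z}_+$,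 $(f)\mathrm{C}_n$ is the (cardinal) number of cycles of $f$ of cardinality $n$; $(f)\mathrm{C}_{\mathrm{open}}$ and $(f)\mathrm{C}_{\mathrm{fwd}}$ are the numbers of open and of forward cycles of $f$. $f\approx_{\mathrm{fin}} g$ means: $(f)\mathrm{C}_{\mathrm{open}}=(g)\mathrm{C}_{\mathrm{open}}$; $(f)\mathrm{C}_{\mathrm{fwd}}=(g)\mathrm{C}_{\mathrm{fwd}}$; $(f)\mathrm{C}_n\ne(g)\mathrm{C}_n$ for only finitely many $n\in\mathbb{Z}_+$; and whenever $(f)\mathrm{C}_n\ne(g)\mathrm{C}_n$, both are finite. $f\approx_{\mathrm{even}} g$ means $f\approx_{\mathrm{fin}}g$ and $\sum_{n\in\mathbb{Z}_+}((f)\mathrm{C}_n-(g)\mathrm{C}_n)$ is even, where a term is taken to be $0$ whenever $(f)\mathrm{C}_n=(g)\mathrm{C}_n$ (even if infinite). For an equivalence relation $\approx$, a subset $B\subseteq\mathrm{Inj}(\Omega)$ is $\approx$-closed if for all $f\approx g$ in $\mathrm{Inj}(\Omega)$, $f\in B$ iff $g\in B$. *)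

theory Defs
  imports "HOL-Combinatorics.Permutations" "HOL-Library.Extended_Nat" "HOL-Library.Countable_Set"
begin

text \<open>Maps are written on the right and composed left to right in the paper:
  the paper's product f g (first f, then g) is the HOL function g \<circ> f.
  The ambient set Omega is the universe of the type 'a (assumed countably infinite
  in the theorem).\<close>

definition Inj :: "('a \<Rightarrow> 'a) set" where
  "Inj = {f. inj f}"

definition Sym :: "('a \<Rightarrow> 'a) set" where
  "Sym = {f. bij f}"

definition Fin :: "('a \<Rightarrow> 'a) set" where
  "Fin = {f. bij f \<and> finite {x. f x \<noteq> x}}"

definition Alt :: "('a \<Rightarrow> 'a) set" where
  "Alt = {f. bij f \<and> finite {x. f x \<noteq> x} \<and> evenperm f}"

text \<open>The cardinal |Omega \ (Omega)f|; since Omega is countable, infinity stands for aleph_0.\<close>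
definition defect :: "('a \<Rightarrow> 'a) \<Rightarrow> enat" where
  "defect f = (if finite (UNIV - range f) then enat (card (UNIV - range f)) else \<infinity>)"

definition Inj_fin :: "('a \<Rightarrow> 'a) set" where
  "Inj_fin = {f. inj f \<and> 1 \<le> defect f \<and> defect f < \<infinity>}"

definition Inj_inf :: "('a \<Rightarrow> 'a) set" where
  "Inj_inf = {f. inj f \<and> defect f = \<infinity>}"

text \<open>Conjugate a f a^{-1} in right-action notation: alpha maps to ((alpha)a)f)a^{-1}.\<close>
definition normal_set :: "('a \<Rightarrow> 'a) set \<Rightarrow> bool" where
  "normal_set S \<longleftrightarrow> (\<forall>f\<in>S. \<forall>a. bij a \<longrightarrow> inv a \<circ> f \<circ> a \<in> S)"

definition submonoid :: "('a \<Rightarrow> 'a) set \<Rightarrow> bool" where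
  "submonoid M \<longleftrightarrow> M \<subseteq> Inj \<and> id \<in> M \<and> (\<forall>f\<in>M. \<forall>g\<in>M. g \<circ> f \<in> M)"

definition normal_submonoid :: "('a \<Rightarrow> 'a) set \<Rightarrow> bool" where
  "normal_submonoid M \<longleftrightarrow> submonoid M \<and> normal_set M"

text \<open>Additive submonoids of nat and their unique minimal generating set.\<close>
definition add_submonoid :: "nat set \<Rightarrow> bool" where
  "add_submonoid N \<longleftrightarrow> 0 \<in> N \<and> (\<forall>x\<in>N. \<forall>y\<in>N. x + y \<in> N)"

definition generated_submonoid :: "nat set \<Rightarrow> nat set" where
  "generated_submonoid S = \<Inter>{T. S \<subseteq> T \<and> add_submonoid T}"

definition Gn :: "nat set \<Rightarrow> nat set" where
  "Gn N = \<Inter>{S. S \<subseteq> N \<and> generated_submonoid S = N}"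

definition is_cycle :: "('a \<Rightarrow> 'a) \<Rightarrow> 'a set \<Rightarrow> bool" where
  "is_cycle f S \<longleftrightarrow> S \<noteq> {} \<and> (\<forall>x. f x \<in> S \<longleftrightarrow> x \<in> S) \<and>
     (\<forall>T. T \<subset> S \<and> T \<noteq> {} \<longrightarrow> \<not> (\<forall>x. f x \<in> T \<longleftrightarrow> x \<in> T))"

definition fwd_cycle :: "('a \<Rightarrow> 'a) \<Rightarrow> 'a set \<Rightarrow> bool" where
  "fwd_cycle f S \<longleftrightarrow> is_cycle f S \<and> infinite S \<and> S - range f \<noteq> {}"

definition open_cycle :: "('a \<Rightarrow> 'a) \<Rightarrow> 'a set \<Rightarrow> bool" where
  "open_cycle f S \<longleftrightarrow> is_cycle f S \<and> infinite S \<and> \<not> (S - range f \<noteq> {})"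

text \<open>Number of sets with property P, as a cardinal; infinity stands for aleph_0
  (there are at most countably many cycles since they partition countable Omega).\<close>
definition count_sets :: "('a set \<Rightarrow> bool) \<Rightarrow> enat" where
  "count_sets P = (if finite {S. P S} then enat (card {S. P S}) else \<infinity>)"

definition C :: "nat \<Rightarrow> ('a \<Rightarrow> 'a) \<Rightarrow> enat" where
  "C n f = count_sets (\<lambda>S. is_cycle f S \<and> finite S \<and> card S = n)"

definition C_open :: "('a \<Rightarrow> 'a) \<Rightarrow> enat" where
  "C_open f = count_sets (open_cycle f)"

definition C_fwd :: "('a \<Rightarrow> 'a) \<Rightarrow> enat" where
  "C_fwd f = count_sets (fwd_cycle f)"

definition approx_fin :: "('a \<Rightarrow> 'a) \<Rightarrow> ('a \<Rightarrow> 'a) \<Rightarrow> bool" where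
  "approx_fin f g \<longleftrightarrow> C_open f = C_open g \<and> C_fwd f = C_fwd g \<and>
     finite {n. 0 < n \<and> C n f \<noteq> C n g} \<and>
     (\<forall>n>0. C n f \<noteq> C n g \<longrightarrow> C n f \<noteq> \<infinity> \<and> C n g \<noteq> \<infinity>)"

definition approx_even :: "('a \<Rightarrow> 'a) \<Rightarrow> ('a \<Rightarrow> 'a) \<Rightarrow> bool" where
  "approx_even f g \<longleftrightarrow> approx_fin f g \<and>
     even (\<Sum>n\<in>{n. 0 < n \<and> C n f \<noteq> C n g}.
             int (the_enat (C n f)) - int (the_enat (C n g)))"

definition rel_closed :: "(('a \<Rightarrow> 'a) \<Rightarrow> ('a \<Rightarrow> 'a) \<Rightarrow> bool) \<Rightarrow> ('a \<Rightarrow> 'a) set \<Rightarrow> bool" where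
  "rel_closed R B \<longleftrightarrow> (\<forall>f g. inj f \<longrightarrow> inj g \<longrightarrow> R f g \<longrightarrow> (f \<in> B \<longleftrightarrow> g \<in> B))"

end

theory Submission
  imports Defs
begin

text \<open>
  Permutations in \<open>M\<close> form a normal subgroup of the symmetric group, because every permutation is
  conjugate to its inverse, so the Schreier-Ulam theorem gives (1). The engine for (2) and (3) is
  that, for non-surjective injections \<open>f\<close> and \<open>g\<close>, every injection whose defect is the sum of
  the defects of \<open>f\<close> and \<open>g\<close> is a product of a conjugate of \<open>f\<close> and a conjugate of \<open>g\<close>;
  the conjugating permutations are built from finite approximations, and non-surjectivity provides
  forward cycles on which to place new points without creating unwanted relations. Hence a
  decomposable defect forces all injections of that defect into \<open>M\<close>.

  The closure conditions on \<open>B\<close> come from the effect of a transposition on the cycles of an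
  injection: it splits a cycle, merges two cycles of which at least one is finite, or exchanges the
  tails of two infinite cycles. In the first two cases the number of finite cycles changes by one if
  it is finite, which makes parity an invariant exactly when there is a single infinite cycle and
  all cycle counts are finite. Conversely all finite cycles in which two injections differ can
  be merged into forward cycles by finitary permutations.
\<close>

section \<open>Anchored chains\<close>

text \<open>The two conjugates cannot be chosen independently. If \<open>h = G \<circ> F\<close>
  with \<open>F\<close> a copy of \<open>f\<close>, then knowing that \<open>F\<close> sends x to y
  forces \<open>G\<close> to send y to \<open>h x\<close>, so careless choices for \<open>F\<close>
  could give \<open>G\<close> a cycle that \<open>g\<close> does not have. Points are therefore
  labelled by two growing partial isomorphisms: (x, a) in \<open>u\<close> says that x plays in
  \<open>F\<close> the role of a in \<open>f\<close>, and likewise \<open>v\<close> for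
  \<open>G\<close> and \<open>g\<close>. A point outside the range of a map is called missed. Each
  map supplies a ray: a far label on a ray of \<open>f\<close> forces no edge of \<open>G\<close>, a
  ray of \<open>h\<close> gives fresh points, and a ray of \<open>g\<close> takes up chains of
  \<open>G\<close> not yet labelled. For permutations of infinite support, the commutator with a
  sparse involution is an involution with infinitely many moved and infinitely many fixed points;
  such involutions form one conjugacy class and generate all permutations. Finitary factors are
  studied on one side only, as \<open>a \<circ> f\<close> is conjugate to \<open>f \<circ> a\<close>
  by \<open>a\<close>. When the counts of \<open>f\<close> leave room, a further transposition that
  changes no count corrects a wrong parity.\<close>

definition partial_inj :: "('a \<times> 'b) set \<Rightarrow> bool" where
  "partial_inj r \<longleftrightarrow> single_valued r \<and> single_valued (r\<inverse>)"

lemma partial_injD: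
  assumes "partial_inj r"
  shows "(x, y) \<in> r \<Longrightarrow> (x, z) \<in> r \<Longrightarrow> y = z" and "(a, c) \<in> r \<Longrightarrow> (b, c) \<in> r \<Longrightarrow> a = b"
  using assms by (auto simp: partial_inj_def single_valued_def)

lemma partial_injI:
  assumes "\<And>x y z. (x, y) \<in> r \<Longrightarrow> (x, z) \<in> r \<Longrightarrow> y = z"
    and "\<And>x y z. (y, x) \<in> r \<Longrightarrow> (z, x) \<in> r \<Longrightarrow> y = z"
  shows "partial_inj r"
  using assms by (auto simp: partial_inj_def single_valued_def)

lemma finite_partial_inj:
  assumes "partial_inj r" "finite (Domain r)"
  shows "finite r"
proof -
  have "(SOME z. (x, z) \<in> r) = y" if "(x, y) \<in> r" for x y
    using that partial_injD(1)[OF assms(1)] by (metis someI)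
  then have "r \<subseteq> (\<lambda>x. (x, SOME y. (x, y) \<in> r)) ` Domain r"
    by (force simp: image_iff)
  then show ?thesis using assms(2) finite_surj by blast
qed

lemma relpow_partial_inj:
  fixes r :: "('a \<times> 'a) set"
  assumes "partial_inj r"
  shows "(x, y) \<in> r ^^ n \<Longrightarrow> (x, z) \<in> r ^^ n \<Longrightarrow> y = z"
proof (induction n arbitrary: y z)
  case (Suc n)
  obtain a b where "(x, a) \<in> r ^^ n" "(a, y) \<in> r" "(x, b) \<in> r ^^ n" "(b, z) \<in> r"
    using Suc.prems by auto
  then show ?case using Suc.IH partial_injD(1)[OF assms] by blast
qed simp

lemma relpow_start_unique:
  fixes r :: "('a \<times> 'a) set"
  assumes "partial_inj r" "x \<notin> Range r"
  shows "(x, y) \<in> r ^^ m \<Longrightarrow> (x, y) \<in> r ^^ n \<Longrightarrow> m = n"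
proof (induction m arbitrary: n y)
  case 0
  then show ?case using assms(2) by (cases n) auto
next
  case (Suc m)
  show ?case
  proof (cases n)
    case 0
    then show ?thesis using Suc.prems assms(2) by auto
  next
    case (Suc k)
    obtain a b where "(x, a) \<in> r ^^ m" "(a, y) \<in> r" "(x, b) \<in> r ^^ k" "(b, y) \<in> r"
      using Suc.prems Suc by auto
    then show ?thesis using Suc.IH[of a k] partial_injD[OF assms(1)] Suc by metis
  qed
qed

lemma relpow_prefix:
  "(x, y) \<in> (r :: ('a \<times> 'a) set) ^^ n \<Longrightarrow> m \<le> n \<Longrightarrow> \<exists>z. (x, z) \<in> r ^^ m"
  by (auto simp: le_iff_add relpow_add)

lemma relpow_in_Range: "(x, y) \<in> (r :: ('a \<times> 'a) set) ^^ n \<Longrightarrow> y = x \<or> y \<in> Range r"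
  by (cases n) auto

lemma funpow_inj_eq: "inj (k :: 'a \<Rightarrow> 'a) \<Longrightarrow> (k ^^ n) x = (k ^^ n) y \<longleftrightarrow> x = y"
  using inj_fn[of k n] by (simp add: inj_eq)

lemma funpow_diff_eq:
  assumes "inj k" "(k ^^ m) x = (k ^^ n) y" "m \<le> n"
  shows "x = (k ^^ (n - m)) y"
proof -
  have "(k ^^ n) y = (k ^^ m) ((k ^^ (n - m)) y)"
    using assms(3) by (metis comp_apply funpow_add le_add_diff_inverse)
  then show ?thesis using assms funpow_inj_eq by metis
qed

lemma funpow_start_neq:
  assumes "inj k" "s \<notin> range k" "(k ^^ m) s = (k ^^ n) s"
  shows "m = n"
proof -
  have *: "a \<le> b \<Longrightarrow> (k ^^ a) s = (k ^^ b) s \<Longrightarrow> a = b" for a b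
    using funpow_diff_eq[OF assms(1), of a s b s] assms(2)
    by (cases "b - a") auto
  show ?thesis using *[of m n] *[of n m] assms(3) by (cases "m \<le> n") auto
qed

text \<open>The iterates of a missed point \<open>s\<close> are pairwise distinct, so only finitely
  many of them lie in \<open>A\<close>; the ray is the tail beyond the last of these. Asking for
  \<open>x\<close> in the range of \<open>k\<close> keeps \<open>x\<close> apart from every missed
  point.\<close>

lemma far_point:
  assumes "inj k" "s \<notin> range k" "finite A"
  shows "\<exists>x\<in>range k. (\<forall>i. (k ^^ i) x \<notin> A) \<and> inj (\<lambda>i. (k ^^ i) x)"
proof -
  have inj: "inj (\<lambda>i. (k ^^ i) s)"
    using funpow_start_neq[OF assms(1,2)] by (auto intro: injI)
  have "finite {n. (k ^^ n) s \<in> A}"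
    using finite_vimageI[OF assms(3) inj] by (simp add: vimage_def)
  then obtain N where N: "\<And>n. (k ^^ n) s \<in> A \<Longrightarrow> n < N"
    by (metis (mono_tags, lifting) finite_nat_set_iff_bounded mem_Collect_eq)
  have *: "(k ^^ i) ((k ^^ Suc N) s) = (k ^^ (i + Suc N)) s" for i
    by (simp only: funpow_add comp_apply)
  have "inj (\<lambda>i. (k ^^ i) ((k ^^ Suc N) s))"
    unfolding * using inj by (metis (no_types, lifting) add_right_imp_eq injD injI)
  moreover have "(k ^^ i) ((k ^^ Suc N) s) \<notin> A" for i
    unfolding * using N[of "i + Suc N"] by auto
  ultimately show ?thesis by (intro bexI[of _ "(k ^^ Suc N) s"]) auto
qed

text \<open>An instance of \<open>anch\<close> is a finite stage of the construction of an isomorphism from a map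
  with graph containing \<open>G\<close> onto \<open>g\<close>: the finite partial isomorphism \<open>v\<close> covers whole
  \<open>G\<close>-components, and the components that it does not cover are chains, which are therefore free
  to be attached anywhere. Convexity of \<open>Range v\<close> is what makes one more edge always possible.
  The points of \<open>e ` (- range g)\<close> are reserved for the points outside the range of \<open>g\<close>.\<close>

locale anchoring =
  fixes g e :: "'a \<Rightarrow> 'a"
  assumes inj_g: "inj g" and inj_e: "inj_on e (- range g)"
begin

definition anch :: "('a \<times> 'a) set \<Rightarrow> ('a \<times> 'a) set \<Rightarrow> bool" where
  "anch G v \<longleftrightarrow> finite G \<and> partial_inj G \<and> finite v \<and> partial_inj v \<and>
     (\<forall>b. b \<notin> range g \<longrightarrow> e b \<notin> Range G) \<and>
     (\<forall>y z \<beta>. (y, z) \<in> G \<longrightarrow> (y, \<beta>) \<in> v \<longrightarrow> (z, g \<beta>) \<in> v) \<and>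
     (\<forall>y z \<beta>. (y, z) \<in> G \<longrightarrow> (z, \<beta>) \<in> v \<longrightarrow> (\<exists>\<beta>'. \<beta> = g \<beta>' \<and> (y, \<beta>') \<in> v)) \<and>
     (\<forall>y z \<beta>. (y, \<beta>) \<in> v \<longrightarrow> (z, g \<beta>) \<in> v \<longrightarrow> (y, z) \<in> G) \<and>
     (\<forall>\<beta> n. \<beta> \<in> Range v \<longrightarrow> (g ^^ Suc n) \<beta> \<in> Range v \<longrightarrow> g \<beta> \<in> Range v) \<and>
     (\<forall>\<beta> n. \<beta> \<notin> range g \<longrightarrow> (g ^^ n) \<beta> \<in> Range v \<longrightarrow> \<beta> \<in> Range v) \<and>
     (\<forall>x. x \<notin> Domain v \<longrightarrow> (\<exists>z. z \<notin> Range G \<and> (z, x) \<in> G\<^sup>*)) \<and>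
     (\<forall>z \<beta>. (z, \<beta>) \<in> v \<longrightarrow> \<beta> \<notin> range g \<longrightarrow> z = e \<beta>) \<and>
     (\<forall>b \<beta>. b \<notin> range g \<longrightarrow> (e b, \<beta>) \<in> v \<longrightarrow> \<beta> = b)"

lemma anchI:
  assumes "finite G" "partial_inj G" "finite v" "partial_inj v"
    "\<And>b. b \<notin> range g \<Longrightarrow> e b \<notin> Range G"
    "\<And>y z \<beta>. (y, z) \<in> G \<Longrightarrow> (y, \<beta>) \<in> v \<Longrightarrow> (z, g \<beta>) \<in> v"
    "\<And>y z \<beta>. (y, z) \<in> G \<Longrightarrow> (z, \<beta>) \<in> v \<Longrightarrow> \<exists>\<beta>'. \<beta> = g \<beta>' \<and> (y, \<beta>') \<in> v"
    "\<And>y z \<beta>. (y, \<beta>) \<in> v \<Longrightarrow> (z, g \<beta>) \<in> v \<Longrightarrow> (y, z) \<in> G"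
    "\<And>\<beta> n. \<beta> \<in> Range v \<Longrightarrow> (g ^^ Suc n) \<beta> \<in> Range v \<Longrightarrow> g \<beta> \<in> Range v"
    "\<And>\<beta> n. \<beta> \<notin> range g \<Longrightarrow> (g ^^ n) \<beta> \<in> Range v \<Longrightarrow> \<beta> \<in> Range v"
    "\<And>x. x \<notin> Domain v \<Longrightarrow> \<exists>z. z \<notin> Range G \<and> (z, x) \<in> G\<^sup>*"
    "\<And>z \<beta>. (z, \<beta>) \<in> v \<Longrightarrow> \<beta> \<notin> range g \<Longrightarrow> z = e \<beta>"
    "\<And>b \<beta>. b \<notin> range g \<Longrightarrow> (e b, \<beta>) \<in> v \<Longrightarrow> \<beta> = b"
  shows "anch G v"
  unfolding anch_def by (intro conjI allI impI; rule assms; assumption)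

lemma anchD:
  assumes "anch G v"
  shows "finite G" "partial_inj G" "finite v" "partial_inj v"
    "\<And>b. b \<notin> range g \<Longrightarrow> e b \<notin> Range G"
    "\<And>y z \<beta>. (y, z) \<in> G \<Longrightarrow> (y, \<beta>) \<in> v \<Longrightarrow> (z, g \<beta>) \<in> v"
    "\<And>y z \<beta>. (y, z) \<in> G \<Longrightarrow> (z, \<beta>) \<in> v \<Longrightarrow> \<exists>\<beta>'. \<beta> = g \<beta>' \<and> (y, \<beta>') \<in> v"
    "\<And>y z \<beta>. (y, \<beta>) \<in> v \<Longrightarrow> (z, g \<beta>) \<in> v \<Longrightarrow> (y, z) \<in> G"
    "\<And>\<beta> n. \<beta> \<in> Range v \<Longrightarrow> (g ^^ Suc n) \<beta> \<in> Range v \<Longrightarrow> g \<beta> \<in> Range v"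
    "\<And>\<beta> n. \<beta> \<notin> range g \<Longrightarrow> (g ^^ n) \<beta> \<in> Range v \<Longrightarrow> \<beta> \<in> Range v"
    "\<And>x. x \<notin> Domain v \<Longrightarrow> \<exists>z. z \<notin> Range G \<and> (z, x) \<in> G\<^sup>*"
    "\<And>z \<beta>. (z, \<beta>) \<in> v \<Longrightarrow> \<beta> \<notin> range g \<Longrightarrow> z = e \<beta>"
    "\<And>b \<beta>. b \<notin> range g \<Longrightarrow> (e b, \<beta>) \<in> v \<Longrightarrow> \<beta> = b"
  by (insert assms[unfolded anch_def], meson+)

lemma anch_empty: "anch {} {}"
  by (rule anchI) (auto simp: partial_inj_def)

lemma anch_path:
  assumes "anch G v" "(y, z) \<in> G\<^sup>*"
  shows "y \<in> Domain v \<longleftrightarrow> z \<in> Domain v"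
  using assms(2)
proof induction
  case (step z w)
  then show ?case using anchD(6,7)[OF assms(1) step(2)] by blast
qed simp

text \<open>The chain of \<open>G\<close> issuing from \<open>z\<close> is laid along the forward
  orbit of \<open>\<gamma>\<close>, its i-th point on \<open>(g ^^ i) \<gamma>\<close>. If the
  predecessor of \<open>\<gamma>\<close> is already in use as a label, an edge into \<open>z\<close>
  is forced; \<open>L\<close>, which has at most one pair, is that edge. The hypotheses
  \<open>conv\<close> and \<open>conv0\<close> say that \<open>\<gamma>\<close> adjoins the old
  labels without a gap and that no missed point is skipped, which keeps \<open>Range v\<close>
  convex and closed towards starting points.\<close>

lemma anchor_chain:
  assumes A: "anch G v" and z: "z \<notin> Range G" "z \<notin> Domain v"
    and new: "\<And>i. (g ^^ i) \<gamma> \<notin> Range v" and inj: "inj (\<lambda>i. (g ^^ i) \<gamma>)"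
    and start: "\<gamma> \<notin> range g \<Longrightarrow> z = e \<gamma>" "\<And>b. b \<notin> range g \<Longrightarrow> z = e b \<Longrightarrow> \<gamma> = b"
    and L: "L = {(y, z) |y. \<exists>\<beta>. (y, \<beta>) \<in> v \<and> g \<beta> = \<gamma>}" "Domain L \<inter> Domain G = {}"
    and conv: "\<And>n \<delta>. \<delta> \<in> Range v \<Longrightarrow> (g ^^ Suc n) \<delta> = \<gamma> \<Longrightarrow> \<exists>\<beta>\<in>Range v. g \<beta> = \<gamma>"
    and conv0: "\<And>n \<delta>. \<delta> \<notin> range g \<Longrightarrow> (g ^^ Suc n) \<delta> = \<gamma> \<Longrightarrow> \<delta> \<in> Range v"
  shows "\<exists>v'. v \<subseteq> v' \<and> anch (G \<union> L) v' \<and> (z, \<gamma>) \<in> v' \<and> Domain v' \<subseteq> insert z (Domain v \<union> Field G)"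
proof -
  note D = anchD[OF A]
  note PG = partial_injD[OF D(2)] and Pv = partial_injD[OF D(4)]
  define N where "N = {(x, (g ^^ i) \<gamma>) |i x. (z, x) \<in> G ^^ i}"
  have NI: "(z, x) \<in> G ^^ i \<Longrightarrow> (x, (g ^^ i) \<gamma>) \<in> N" for x i unfolding N_def by blast
  have NE: "\<exists>i. b = (g ^^ i) \<gamma> \<and> (z, x) \<in> G ^^ i" if t: "(x, b) \<in> N" for x b
    using t unfolding N_def by blast
  have zN: "(z, \<gamma>) \<in> N" using NI[of z 0] by simp
  have DN: "x \<notin> Domain v" if t: "(x, b) \<in> N" for x b
  proof -
    from NE[OF t] obtain i where "(z, x) \<in> G ^^ i" by blast
    then have "(z, x) \<in> G\<^sup>*" using relpow_imp_rtrancl by blast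
    then show ?thesis using anch_path[OF A] z(2) by blast
  qed
  have RN: "b \<notin> Range v" if t: "(x, b) \<in> N" for x b
    using NE[OF t] new by blast
  have inj': "(g ^^ i) \<gamma> = (g ^^ j) \<gamma> \<Longrightarrow> i = j" for i j using inj by (auto dest: injD)
  have DN': "Domain N \<subseteq> insert z (Range G)"
    using NE relpow_in_Range by fastforce
  have PN: "partial_inj N"
  proof (rule partial_injI)
    fix x y w assume "(x, y) \<in> N" "(x, w) \<in> N"
    then show "y = w" using NE relpow_start_unique[OF D(2) z(1)] by metis
  next
    fix x y w assume "(y, x) \<in> N" "(w, x) \<in> N"
    then show "y = w" using NE relpow_partial_inj[OF D(2)] inj' by metis
  qed
  have finN: "finite N"
    using finite_partial_inj[OF PN] DN' D(1) finite_subset[of "Domain N" "insert z (Range G)"]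
    by (simp add: finite_Range)
  have Lz: "(y, w) \<in> L \<Longrightarrow> w = z" for y w using L by blast
  have Lu: "(y, w) \<in> L \<Longrightarrow> (y', w') \<in> L \<Longrightarrow> y = y'" for y w y' w'
    using L(1) injD[OF inj_g] Pv(2) by blast
  have PGL: "partial_inj (G \<union> L)"
  proof (rule partial_injI)
    fix x y w assume "(x, y) \<in> G \<union> L" "(x, w) \<in> G \<union> L"
    then show "y = w" using PG Lz L(2) by (metis Domain.DomainI IntI UnE empty_iff)
  next
    fix x y w assume "(y, x) \<in> G \<union> L" "(w, x) \<in> G \<union> L"
    then show "y = w" using PG Lz Lu z(1) by (metis Range.intros UnE)
  qed
  have finL: "finite L"
  proof -
    have "L \<subseteq> Domain v \<times> {z}" using L by blast
    then show ?thesis using D(3) finite_Domain finite_subset finite_SigmaI by (metis finite.emptyI finite.insertI)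
  qed
  have "anch (G \<union> L) (v \<union> N)"
  proof (rule anchI)
    show "finite (G \<union> L)" using D(1) finL by simp
    show "partial_inj (G \<union> L)" by (rule PGL)
    show "finite (v \<union> N)" using D(3) finN by simp
    show "partial_inj (v \<union> N)"
      using Pv partial_injD[OF PN] DN RN by (intro partial_injI) blast+
    show "e b \<notin> Range (G \<union> L)" if t: "b \<notin> range g" for b
    proof
      assume "e b \<in> Range (G \<union> L)"
      then have "e b \<in> Range L" using D(5)[OF t] by blast
      then obtain y where y: "(y, e b) \<in> L" by blast
      then have "\<gamma> = b" using start(2)[OF t] Lz by metis
      then show False using y L(1) t by blast
    qed
    show "(z', g \<beta>) \<in> v \<union> N" if t: "(y, z') \<in> G \<union> L" "(y, \<beta>) \<in> v \<union> N" for y z' \<beta>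
    proof (cases "(y, z') \<in> G")
      case True
      show ?thesis
      proof (cases "(y, \<beta>) \<in> v")
        case False
        then obtain i where "\<beta> = (g ^^ i) \<gamma>" "(z, y) \<in> G ^^ i" using NE t by blast
        then show ?thesis using NI[of z' "Suc i"] True by auto
      qed (use True D(6) in blast)
    next
      case False
      then have *: "(y, z') \<in> L" using t by blast
      then have "y \<in> Domain v" using L by blast
      then have "(y, \<beta>) \<in> v" using t DN by blast
      then show ?thesis using * L zN Pv by blast
    qed
    show "\<exists>\<beta>'. \<beta> = g \<beta>' \<and> (y, \<beta>') \<in> v \<union> N" if t: "(y, z') \<in> G \<union> L" "(z', \<beta>) \<in> v \<union> N" for y z' \<beta>
    proof (cases "(y, z') \<in> G")
      case True
      show ?thesis
      proof (cases "(z', \<beta>) \<in> v")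
        case False
        then obtain i where i: "\<beta> = (g ^^ i) \<gamma>" "(z, z') \<in> G ^^ i" using NE t by blast
        then obtain j where j: "i = Suc j" using True z(1) by (cases i) auto
        then obtain p where "(z, p) \<in> G ^^ j" "(p, z') \<in> G" using i by auto
        then have "(z, y) \<in> G ^^ j" using PG True by blast
        then show ?thesis using NI i j by (intro exI[of _ "(g ^^ j) \<gamma>"]) auto
      qed (use True D(7) in blast)
    next
      case False
      then have *: "(y, z') \<in> L" using t by blast
      then have "z' = z" using Lz by blast
      then have "\<beta> = \<gamma>" using t zN z(2) partial_injD[OF PN] by blast
      then show ?thesis using * L by blast
    qed
    show "(y, z') \<in> G \<union> L" if y: "(y, \<beta>) \<in> v \<union> N" and z': "(z', g \<beta>) \<in> v \<union> N" for y z' \<beta>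
    proof -
      consider "(y, \<beta>) \<in> v" "(z', g \<beta>) \<in> v" | "(y, \<beta>) \<in> N" | "(y, \<beta>) \<in> v" "(z', g \<beta>) \<in> N"
        using y z' by blast
      then show ?thesis
      proof cases
        case 1 then show ?thesis using D(8) by blast
      next
        case 2
        then obtain i where i: "\<beta> = (g ^^ i) \<gamma>" "(z, y) \<in> G ^^ i" using NE by blast
        then have gb: "g \<beta> = (g ^^ Suc i) \<gamma>" by simp
        then have "(z', g \<beta>) \<in> N" using new[of "Suc i"] z' by (metis Range.intros UnE)
        then obtain j where "g \<beta> = (g ^^ j) \<gamma>" "(z, z') \<in> G ^^ j" using NE by blast
        then have "(z, z') \<in> G ^^ Suc i" using gb inj' by metis
        then obtain p where "(z, p) \<in> G ^^ i" "(p, z') \<in> G" by auto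
        then show ?thesis using relpow_partial_inj[OF D(2)] i by blast
      next
        case 3
        then obtain i where i: "g \<beta> = (g ^^ i) \<gamma>" "(z, z') \<in> G ^^ i" using NE by blast
        show ?thesis
        proof (cases i)
          case 0
          then show ?thesis using i 3 L by auto
        next
          case (Suc j)
          then have "\<beta> = (g ^^ j) \<gamma>" using i inj_g by (auto simp: inj_def)
          then show ?thesis using new 3 by blast
        qed
      qed
    qed
    show "g \<beta> \<in> Range (v \<union> N)" if b: "\<beta> \<in> Range (v \<union> N)" "(g ^^ Suc n) \<beta> \<in> Range (v \<union> N)" for \<beta> n
    proof (cases "\<beta> \<in> Range v")
      case True
      show ?thesis
      proof (cases "(g ^^ Suc n) \<beta> \<in> Range v")
        case True
        then show ?thesis using D(9) \<open>\<beta> \<in> Range v\<close> by blast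
      next
        case False
        then obtain i where i: "(g ^^ Suc n) \<beta> = (g ^^ i) \<gamma>" using NE b by blast
        show ?thesis
        proof (cases "Suc n \<le> i")
          case True
          then have "\<beta> = (g ^^ (i - Suc n)) \<gamma>" using funpow_diff_eq[OF inj_g i] by simp
          then show ?thesis using new \<open>\<beta> \<in> Range v\<close> by metis
        next
          case False
          then have e: "\<gamma> = (g ^^ (Suc n - i)) \<beta>" using funpow_diff_eq[OF inj_g i[symmetric]] by simp
          obtain k where k: "Suc n - i = Suc k" using False by (cases "Suc n - i") auto
          then obtain \<beta>' where \<beta>': "\<beta>' \<in> Range v" "g \<beta>' = \<gamma>"
            using conv[of \<beta> k] e \<open>\<beta> \<in> Range v\<close> by auto
          then have "\<beta>' = (g ^^ k) \<beta>" using e k inj_g by (auto simp: inj_def)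
          then show ?thesis
          proof (cases k)
            case 0
            then show ?thesis using \<beta>' zN \<open>\<beta>' = (g ^^ k) \<beta>\<close> by auto
          next
            case (Suc l)
            then show ?thesis using D(9)[of \<beta> l] \<beta>' \<open>\<beta>' = (g ^^ k) \<beta>\<close> \<open>\<beta> \<in> Range v\<close> by auto
          qed
        qed
      qed
    next
      case False
      then obtain i x where i: "\<beta> = (g ^^ i) \<gamma>" "(z, x) \<in> G ^^ i" using NE b by blast
      then have s: "(g ^^ Suc n) \<beta> = (g ^^ (Suc n + i)) \<gamma>" by (simp add: funpow_add)
      then have "(g ^^ Suc n) \<beta> \<in> Range N" using b new by (metis Range_Un_eq UnE)
      then obtain j y where j: "(g ^^ Suc n) \<beta> = (g ^^ j) \<gamma>" "(z, y) \<in> G ^^ j" using NE by blast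
      then have "j = Suc n + i" using s inj' by metis
      \<comment> \<open>The chain reaches a position \<open>j > i\<close>, so it also has a point at
        position \<open>Suc i\<close>, and that point is labelled \<open>g \<beta>\<close>.\<close>
      then obtain w where "(z, w) \<in> G ^^ Suc i" using j relpow_prefix[OF j(2), of "Suc i"] by auto
      then show ?thesis using NI[of w "Suc i"] i by auto
    qed
    show "\<beta> \<in> Range (v \<union> N)" if b: "\<beta> \<notin> range g" "(g ^^ n) \<beta> \<in> Range (v \<union> N)" for \<beta> n
    proof (cases "(g ^^ n) \<beta> \<in> Range v")
      case True then show ?thesis using D(10)[OF b(1)] by blast
    next
      case False
      then obtain i where i: "(g ^^ n) \<beta> = (g ^^ i) \<gamma>" using NE b by blast
      show ?thesis
      proof (cases "n \<le> i")
        case True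
        then have *: "\<beta> = (g ^^ (i - n)) \<gamma>" using funpow_diff_eq[OF inj_g i] by simp
        then have "i - n = 0" using b by (cases "i - n") auto
        then show ?thesis using * zN by auto
      next
        case False
        then have e: "\<gamma> = (g ^^ (n - i)) \<beta>" using funpow_diff_eq[OF inj_g i[symmetric]] by simp
        obtain k where k: "n - i = Suc k" using False by (cases "n - i") auto
        then show ?thesis using conv0[OF b(1), of k] e by auto
      qed
    qed
    show "\<exists>w. w \<notin> Range (G \<union> L) \<and> (w, x) \<in> (G \<union> L)\<^sup>*" if x: "x \<notin> Domain (v \<union> N)" for x
    proof -
      obtain w where w: "w \<notin> Range G" "(w, x) \<in> G\<^sup>*" using D(11) x by blast
      have "w \<noteq> z" using w x NI rtrancl_imp_relpow by (metis Domain.DomainI Domain_Un_eq UnCI)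
      then have "w \<notin> Range (G \<union> L)" using w Lz by blast
      then show ?thesis using w rtrancl_mono[of G "G \<union> L"] by blast
    qed
    show "w = e \<beta>" if t: "(w, \<beta>) \<in> v \<union> N" "\<beta> \<notin> range g" for w \<beta>
    proof (cases "(w, \<beta>) \<in> v")
      case False
      then obtain i where i: "\<beta> = (g ^^ i) \<gamma>" "(z, w) \<in> G ^^ i" using NE t by blast
      then have "i = 0" using t(2) by (cases i) auto
      then show ?thesis using i start(1) t(2) by simp
    qed (use t D(12) in blast)
    show "\<beta> = b" if t: "b \<notin> range g" "(e b, \<beta>) \<in> v \<union> N" for b \<beta>
    proof (cases "(e b, \<beta>) \<in> v")
      case False
      then obtain i where i: "\<beta> = (g ^^ i) \<gamma>" "(z, e b) \<in> G ^^ i" using NE t by blast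
      then have "i = 0" using D(5)[OF t(1)] by (cases i) auto
      then show ?thesis using i start(2)[OF t(1)] by simp
    qed (use t D(13) in blast)
  qed
  moreover have "Domain (v \<union> N) \<subseteq> insert z (Domain v \<union> Field G)"
    using DN' by (auto simp: Field_def)
  ultimately show ?thesis using zN by (intro exI[of _ "v \<union> N"]) blast
qed

text \<open>If only \<open>y\<close> is labelled, the chain of \<open>z\<close> is anchored right
  after the label of \<open>y\<close>. If neither end is, the edge links two unlabelled chains, and
  \<open>(z, y) \<notin> G\<^sup>*\<close> makes the result a chain rather than a cycle. If only
  \<open>z\<close> is labelled, \<open>fresh\<close> makes \<open>y\<close> an isolated point, which
  takes the \<open>g\<close>-predecessor of the label of \<open>z\<close>. With both ends labelled,
  \<open>v\<close> would already have decided about the edge, hence \<open>free\<close>.\<close>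

lemma anch_join:
  assumes A: "anch G v" and yz: "y \<notin> Domain G" "z \<notin> Range G" "(z, y) \<notin> G\<^sup>*"
    and zE: "\<And>b. b \<notin> range g \<Longrightarrow> z \<noteq> e b"
    and free: "y \<notin> Domain v \<or> z \<notin> Domain v"
    and fresh: "z \<in> Domain v \<Longrightarrow> y \<notin> Range G \<and> (\<forall>b. b \<notin> range g \<longrightarrow> y \<noteq> e b)"
  shows "\<exists>v'. v \<subseteq> v' \<and> anch (insert (y, z) G) v' \<and> Domain v' \<subseteq> insert z (insert y (Domain v \<union> Field G))"
proof -
  note D = anchD[OF A]
  note PG = partial_injD[OF D(2)] and Pv = partial_injD[OF D(4)]
  have P': "partial_inj (insert (y, z) G)"
    using yz PG by (intro partial_injI) blast+
  have mono: "G\<^sup>* \<subseteq> (insert (y, z) G)\<^sup>*" by (intro rtrancl_mono) blast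
  consider "y \<in> Domain v" "z \<notin> Domain v" | "y \<notin> Domain v" "z \<notin> Domain v" | "y \<notin> Domain v" "z \<in> Domain v"
    using free by blast
  then show ?thesis
  proof cases
    case 1
    then obtain \<beta> where \<beta>: "(y, \<beta>) \<in> v" by blast
    have g\<beta>: "g \<beta> \<notin> Range v" using D(8)[OF \<beta>] yz(1) by blast
    have new: "(g ^^ Suc i) \<beta> \<notin> Range v" for i using D(9)[of \<beta> i] g\<beta> \<beta> by blast
    have L: "insert (y, z) G = G \<union> {(w, z) |w. \<exists>b. (w, b) \<in> v \<and> g b = g \<beta>}"
      using \<beta> injD[OF inj_g] Pv by blast
    have *: "(g ^^ i) (g \<beta>) = (g ^^ Suc i) \<beta>" for i by (simp add: funpow_swap1)
    \<comment> \<open>\<open>\<beta>\<close> is a label but no later point of its orbit is one, so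
      the orbit never returns to \<open>\<beta>\<close>.\<close>
    have "inj (\<lambda>i. (g ^^ i) (g \<beta>))"
    proof (rule injI)
      have le: "i = j" if t: "(g ^^ i) (g \<beta>) = (g ^^ j) (g \<beta>)" "i \<le> j" for i j
      proof -
        have "g \<beta> = (g ^^ (j - i)) (g \<beta>)" by (rule funpow_diff_eq[OF inj_g t])
        then have "\<beta> = (g ^^ (j - i)) \<beta>" using inj_g by (metis funpow_swap1 injD)
        then show ?thesis using new \<beta> t(2) by (cases "j - i") (auto, metis Range.intros)
      qed
      fix i j assume "(g ^^ i) (g \<beta>) = (g ^^ j) (g \<beta>)"
      then show "i = j" using le[of i j] le[of j i] by (cases "i \<le> j") auto
    qed
    moreover have "\<delta> \<in> Range v" if t: "\<delta> \<notin> range g" "(g ^^ Suc n) \<delta> = g \<beta>" for n \<delta>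
    proof -
      have "(g ^^ n) \<delta> = \<beta>" using t inj_g by (auto simp: inj_def)
      then show ?thesis using D(10)[OF t(1)] \<beta> by blast
    qed
    ultimately have "\<exists>v'. v \<subseteq> v' \<and> anch (insert (y, z) G) v' \<and> (z, g \<beta>) \<in> v' \<and> Domain v' \<subseteq> insert z (Domain v \<union> Field G)"
      unfolding L
    proof (intro anchor_chain[OF A yz(2) 1(2) _ _ _ _ refl])
      show "(g ^^ i) (g \<beta>) \<notin> Range v" for i unfolding * by (rule new)
      show "Domain {(w, z) |w. \<exists>b. (w, b) \<in> v \<and> g b = g \<beta>} \<inter> Domain G = {}"
        using \<beta> injD[OF inj_g] Pv(2) yz(1) by blast
    qed (use \<beta> zE in blast)+
    then show ?thesis by blast
  next
    case 2
    have "anch (insert (y, z) G) v"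
    proof (rule anchI)
      show "\<exists>w. w \<notin> Range (insert (y, z) G) \<and> (w, x) \<in> (insert (y, z) G)\<^sup>*" if t: "x \<notin> Domain v" for x
      proof -
        obtain w where w: "w \<notin> Range G" "(w, x) \<in> G\<^sup>*" using D(11) t by blast
        show ?thesis
        proof (cases "w = z")
          case True
          obtain w' where w': "w' \<notin> Range G" "(w', y) \<in> G\<^sup>*" using D(11) 2 by blast
          then have "w' \<noteq> z" using yz by blast
          moreover have "(w', x) \<in> (insert (y, z) G)\<^sup>*"
            using w w' mono True by (meson insertI1 rtrancl.rtrancl_into_rtrancl rtrancl_trans subsetD)
          ultimately show ?thesis using w' by blast
        next
          case False
          then show ?thesis using w mono by blast
        qed
      qed
      show "e b \<notin> Range (insert (y, z) G)" if "b \<notin> range g" for b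
        using D(5) zE that by blast
      show "finite (insert (y, z) G)" using D(1) by simp
      show "(z', g b) \<in> v" if "(y', z') \<in> insert (y, z) G" "(y', b) \<in> v" for y' z' b
        using that D(6) 2 by blast
      show "\<exists>b'. b = g b' \<and> (y', b') \<in> v" if "(y', z') \<in> insert (y, z) G" "(z', b) \<in> v" for y' z' b
        using that D(7) 2 by blast
      show "(y', z') \<in> insert (y, z) G" if "(y', b) \<in> v" "(z', g b) \<in> v" for y' z' b
        using that D(8) by blast
    qed (rule P' D; assumption)+
    then show ?thesis by blast
  next
    case 3
    then obtain \<gamma> where \<gamma>: "(z, \<gamma>) \<in> v" by blast
    then have "\<gamma> \<in> range g" using D(12) zE by blast
    then obtain \<beta> where \<beta>: "\<gamma> = g \<beta>" by blast
    have \<beta>v: "\<beta> \<notin> Range v" using D(8) \<gamma> \<beta> yz(2) by blast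
    have "\<gamma> \<noteq> \<beta>" using \<beta>v \<gamma> by blast
    then have ne: "g \<beta> \<noteq> \<beta>" using \<beta> by simp
    \<comment> \<open>Labels reach back to starting points: a missed \<open>\<beta>\<close> would
      already be in use together with its successor \<open>\<gamma>\<close>. So \<open>y\<close> can
      take the label \<open>\<beta>\<close> without having to be \<open>e \<beta>\<close>.\<close>
    have \<beta>r: "\<beta> \<in> range g" using D(10)[of \<beta> 1] \<beta>v \<gamma> \<beta> by auto
    have P'': "partial_inj (insert (y, \<beta>) v)"
      using 3 \<beta>v Pv by (intro partial_injI) blast+
    have "anch (insert (y, z) G) (insert (y, \<beta>) v)"
    proof (rule anchI)
      show "(y', z') \<in> insert (y, z) G" if t: "(y', b) \<in> insert (y, \<beta>) v" "(z', g b) \<in> insert (y, \<beta>) v" for y' z' b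
      proof -
        have "\<not> (g b = \<beta> \<and> b \<in> Range v)"
          using D(9)[of b 1] \<gamma> \<beta> \<beta>v by auto
        then have "(y', b) = (y, \<beta>) \<and> z' = z \<or> (y', b) \<in> v \<and> (z', g b) \<in> v"
          using t ne Pv \<gamma> \<beta> by blast
        then show ?thesis using D(8) by blast
      qed
      show "g b \<in> Range (insert (y, \<beta>) v)" if b: "b \<in> Range (insert (y, \<beta>) v)" "(g ^^ Suc n) b \<in> Range (insert (y, \<beta>) v)" for b n
      proof (cases "b = \<beta>")
        case True then show ?thesis using \<gamma> \<beta> by blast
      next
        case False
        then have bv: "b \<in> Range v" using b by blast
        show ?thesis
        proof (cases "(g ^^ Suc n) b = \<beta>")
          case True
          then have "(g ^^ Suc (Suc n)) b \<in> Range v" using \<gamma> \<beta> by auto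
          then show ?thesis using D(9)[OF bv] by blast
        next
          case False
          then show ?thesis using D(9)[OF bv, of n] b by blast
        qed
      qed
      show "b \<in> Range (insert (y, \<beta>) v)" if b: "b \<notin> range g" "(g ^^ n) b \<in> Range (insert (y, \<beta>) v)" for b n
      proof (cases "(g ^^ n) b = \<beta>")
        case True
        then have "(g ^^ Suc n) b \<in> Range v" using \<gamma> \<beta> by auto
        then show ?thesis using D(10)[OF b(1)] by blast
      next
        case False
        then show ?thesis using D(10)[OF b(1), of n] b by blast
      qed
      show "\<exists>w. w \<notin> Range (insert (y, z) G) \<and> (w, x) \<in> (insert (y, z) G)\<^sup>*" if x: "x \<notin> Domain (insert (y, \<beta>) v)" for x
      proof -
        obtain w where w: "w \<notin> Range G" "(w, x) \<in> G\<^sup>*" using D(11) x by blast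
        have "w \<noteq> z" using anch_path[OF A w(2)] 3 x by blast
        then show ?thesis using w mono by blast
      qed
      show "w = e b" if t: "(w, b) \<in> insert (y, \<beta>) v" "b \<notin> range g" for w b
        using t \<beta>r D(12) by blast
      show "(z', g b) \<in> insert (y, \<beta>) v" if t: "(y', z') \<in> insert (y, z) G" "(y', b) \<in> insert (y, \<beta>) v" for y' z' b
        using t \<gamma> \<beta> D(6) yz(1) 3 by blast
      show "\<exists>b'. b = g b' \<and> (y', b') \<in> insert (y, \<beta>) v" if t: "(y', z') \<in> insert (y, z) G" "(z', b) \<in> insert (y, \<beta>) v" for y' z' b
        using t \<gamma> \<beta> D(7) fresh[OF 3(2)] Pv yz by blast
      show "e b \<notin> Range (insert (y, z) G)" if "b \<notin> range g" for b
        using D(5) zE that by blast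
      show "finite (insert (y, z) G)" "finite (insert (y, \<beta>) v)" using D(1,3) by simp_all
      show "b' = b" if "b \<notin> range g" "(e b, b') \<in> insert (y, \<beta>) v" for b b'
        using that D(13) fresh[OF 3(2)] by blast
    qed (rule P' P'')+
    then show ?thesis by (intro exI[of _ "insert (y, \<beta>) v"]) auto
  qed
qed

text \<open>A finite cycle of \<open>g\<close> offers no injective orbit along which a chain could
  be laid, so it is realised in one stroke by \<open>k\<close> isolated points joined cyclically.
  They are all labelled at once, so the unlabelled components are still chains.\<close>

lemma anch_cycle:
  assumes A: "anch G v" and k: "k > 0" "(g ^^ k) \<gamma> = \<gamma>" "inj_on (\<lambda>i. (g ^^ i) \<gamma>) {..<k}"
    and new: "\<And>i. (g ^^ i) \<gamma> \<notin> Range v"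
    and ys: "inj_on ys {..<k}" "\<And>i. i < k \<Longrightarrow> ys i \<notin> Domain v \<union> Field G"
      "\<And>i b. i < k \<Longrightarrow> b \<notin> range g \<Longrightarrow> ys i \<noteq> e b"
  shows "anch (G \<union> (\<lambda>i. (ys i, ys (Suc i mod k))) ` {..<k}) (v \<union> (\<lambda>i. (ys i, (g ^^ i) \<gamma>)) ` {..<k})"
proof -
  define H where "H = (\<lambda>i. (ys i, ys (Suc i mod k))) ` {..<k}"
  define N where "N = (\<lambda>i. (ys i, (g ^^ i) \<gamma>)) ` {..<k}"
  note D = anchD[OF A]
  note PG = partial_injD[OF D(2)] and Pv = partial_injD[OF D(4)]
  have md: "(g ^^ (i mod k)) \<gamma> = (g ^^ i) \<gamma>" for i using funpow_mod_eq[OF k(2)] .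
  have Suc_mod_inj: "i = j" if ij: "i < k" "j < k" "Suc i mod k = Suc j mod k" for i j
    using ij by (auto simp: mod_Suc split: if_splits)
  have eqv: "i = j" if ij: "i < k" "j < k" "(g ^^ i) \<gamma> = (g ^^ j) \<gamma>" for i j
    using inj_onD[OF k(3) ij(3)] ij by simp
  have eqy: "i = j" if ij: "i < k" "j < k" "ys i = ys j" for i j
    using inj_onD[OF ys(1) ij(3)] ij by simp
  have HE: "\<exists>i<k. y = ys i \<and> z = ys (Suc i mod k)" if t: "(y, z) \<in> H" for y z using t unfolding H_def by auto
  have NE: "\<exists>i<k. y = ys i \<and> b = (g ^^ i) \<gamma>" if t: "(y, b) \<in> N" for y b using t unfolding N_def by auto
  have NI: "(ys i, (g ^^ i) \<gamma>) \<in> N" if t: "i < k" for i using t unfolding N_def by auto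
  have HI: "(ys i, ys (Suc i mod k)) \<in> H" if t: "i < k" for i using t unfolding H_def by auto
  have ml: "Suc i mod k < k" for i using k(1) by simp
  define Cy where "Cy = range (\<lambda>i. (g ^^ i) \<gamma>)"
  have CyN: "Range N = Cy"
  proof
    show "Cy \<subseteq> Range N"
    proof
      fix b assume "b \<in> Cy"
      then obtain i where "b = (g ^^ (i mod k)) \<gamma>" using md unfolding Cy_def by auto
      then show "b \<in> Range N" using NI[of "i mod k"] k(1) by (metis Range.intros mod_less_divisor)
    qed
  qed (auto simp: Cy_def N_def)
  have Cyg: "g b \<in> Cy \<longleftrightarrow> b \<in> Cy" for b
  proof
    assume "g b \<in> Cy"
    then obtain i where "g b = (g ^^ i) \<gamma>" unfolding Cy_def by auto
    also have "\<dots> = (g ^^ i) ((g ^^ k) \<gamma>)" using k(2) by simp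
    also have "\<dots> = (g ^^ (i + k)) \<gamma>" by (simp add: funpow_add)
    also have "\<dots> = g ((g ^^ (i + k - 1)) \<gamma>)" using k(1) by (cases "i + k") auto
    finally show "b \<in> Cy" using injD[OF inj_g] unfolding Cy_def by blast
  next
    assume "b \<in> Cy"
    then obtain i where "b = (g ^^ i) \<gamma>" unfolding Cy_def by auto
    then have "g b = (g ^^ Suc i) \<gamma>" by simp
    then show "g b \<in> Cy" unfolding Cy_def by blast
  qed
  have Cygn: "(g ^^ n) b \<in> Cy \<longleftrightarrow> b \<in> Cy" for b n by (induction n) (auto simp: Cyg)
  have Cyv: "b \<notin> Range v" if t: "b \<in> Cy" for b using t new unfolding Cy_def by blast
  have Cyr: "b \<in> range g" if t: "b \<in> Cy" for b
  proof -
    obtain i where "b = (g ^^ i) ((g ^^ k) \<gamma>)" using t k(2) unfolding Cy_def by auto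
    then have "b = (g ^^ (i + k)) \<gamma>" by (simp add: funpow_add)
    also have "\<dots> = g ((g ^^ (i + k - 1)) \<gamma>)" using k(1) by (cases "i + k") auto
    finally show ?thesis by blast
  qed
  have Hfresh: "y \<notin> Field G" "z \<notin> Field G" "y \<notin> Domain v" "z \<notin> Domain v" if t: "(y, z) \<in> H" for y z
    using HE[OF t] ys(2) ml by blast+
  have Nfresh: "y \<notin> Field G" "y \<notin> Domain v" if t: "(y, b) \<in> N" for y b
    using NE[OF t] ys(2) by blast+
  show ?thesis unfolding H_def[symmetric] N_def[symmetric]
  proof (rule anchI)
    show "finite (G \<union> H)" "finite (v \<union> N)" using D(1,3) unfolding H_def N_def by auto
    show "partial_inj (G \<union> H)"
    proof (rule partial_injI)
      fix x y z assume t: "(x, y) \<in> G \<union> H" "(x, z) \<in> G \<union> H"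
      show "y = z"
      proof (cases "(x, y) \<in> G")
        case True
        then have "(x, z) \<in> G" using t Hfresh by (meson FieldI1 UnE)
        then show ?thesis using PG(1) True by blast
      next
        case False
        then have "(x, y) \<in> H" "(x, z) \<in> H" using t Hfresh by (meson FieldI1 UnE)+
        then show ?thesis using HE eqy by metis
      qed
    next
      fix x y z assume t: "(y, x) \<in> G \<union> H" "(z, x) \<in> G \<union> H"
      show "y = z"
      proof (cases "(y, x) \<in> G")
        case True
        then have "(z, x) \<in> G" using t Hfresh by (meson FieldI2 UnE)
        then show ?thesis using PG(2) True by blast
      next
        case False
        then have "(y, x) \<in> H" "(z, x) \<in> H" using t Hfresh by (meson FieldI2 UnE)+
        then show ?thesis using HE eqy ml Suc_mod_inj by metis
      qed
    qed
    show "partial_inj (v \<union> N)"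
    proof (rule partial_injI)
      fix x y z assume t: "(x, y) \<in> v \<union> N" "(x, z) \<in> v \<union> N"
      show "y = z"
      proof (cases "(x, y) \<in> v")
        case True
        then have "(x, z) \<in> v" using t Nfresh(2) by (meson Domain.DomainI UnE)
        then show ?thesis using Pv(1) True by blast
      next
        case False
        then have "(x, y) \<in> N" "(x, z) \<in> N" using t Nfresh(2) by (meson Domain.DomainI UnE)+
        then show ?thesis using NE eqy by metis
      qed
    next
      fix x y z assume t: "(y, x) \<in> v \<union> N" "(z, x) \<in> v \<union> N"
      show "y = z"
      proof (cases "(y, x) \<in> v")
        case True
        then have "(z, x) \<in> v" using t Cyv CyN by blast
        then show ?thesis using Pv(2) True by blast
      next
        case False
        then have "(y, x) \<in> N" "(z, x) \<in> N" using t Cyv CyN by blast+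
        then show ?thesis using NE eqv by metis
      qed
    qed
    show "e b \<notin> Range (G \<union> H)" if t: "b \<notin> range g" for b
      using D(5)[OF t] ys(3)[OF _ t] HE ml by (metis Range.cases Range_Un_eq UnE)
    show "(z, g b) \<in> v \<union> N" if t: "(y, z) \<in> G \<union> H" "(y, b) \<in> v \<union> N" for y z b
    proof (cases "(y, z) \<in> G")
      case True
      then have "(y, b) \<in> v" using t Nfresh(1) by (meson FieldI1 UnE)
      then show ?thesis using D(6) True by blast
    next
      case False
      then have "(y, z) \<in> H" "(y, b) \<in> N" using t Hfresh(3) by (meson Domain.DomainI UnE)+
      then obtain i where "i < k" "y = ys i" "z = ys (Suc i mod k)" "b = (g ^^ i) \<gamma>" using HE NE eqy by metis
      then show ?thesis using NI[OF ml, of i] md[of "Suc i"] by simp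
    qed
    show "\<exists>b'. b = g b' \<and> (y, b') \<in> v \<union> N" if t: "(y, z) \<in> G \<union> H" "(z, b) \<in> v \<union> N" for y z b
    proof (cases "(y, z) \<in> G")
      case True
      then have "(z, b) \<in> v" using t Nfresh(1) by (meson FieldI2 UnE)
      then show ?thesis using D(7) True by blast
    next
      case False
      then have "(y, z) \<in> H" "(z, b) \<in> N" using t Hfresh(4) by (meson Domain.DomainI UnE)+
      then obtain i where i: "i < k" "y = ys i" "b = (g ^^ (Suc i mod k)) \<gamma>" using HE NE eqy ml by metis
      then have "b = g ((g ^^ i) \<gamma>)" using md[of "Suc i"] by simp
      then show ?thesis using NI[OF i(1)] i(2) by blast
    qed
    show "(y, z) \<in> G \<union> H" if t: "(y, b) \<in> v \<union> N" "(z, g b) \<in> v \<union> N" for y z b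
    proof (cases "b \<in> Cy")
      case True
      then have "(y, b) \<in> N" "(z, g b) \<in> N" using t Cyv Cyg by blast+
      then obtain i j where ij: "i < k" "y = ys i" "b = (g ^^ i) \<gamma>" "j < k" "z = ys j" "g b = (g ^^ j) \<gamma>"
        using NE by metis
      then have "(g ^^ (Suc i mod k)) \<gamma> = (g ^^ j) \<gamma>" using md[of "Suc i"] by simp
      then have "j = Suc i mod k" using eqv[OF ml ij(4)] by metis
      then show ?thesis using HI[OF ij(1)] ij by blast
    next
      case False
      then have "(y, b) \<in> v" "(z, g b) \<in> v" using t CyN Cyg by blast+
      then show ?thesis using D(8) by blast
    qed
    show "g b \<in> Range (v \<union> N)" if t: "b \<in> Range (v \<union> N)" "(g ^^ Suc n) b \<in> Range (v \<union> N)" for b n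
    proof (cases "b \<in> Cy")
      case True then show ?thesis using CyN Cyg by blast
    next
      case False
      then have "(g ^^ Suc n) b \<notin> Cy" using Cygn by blast
      then show ?thesis using False D(9)[of b n] t CyN by blast
    qed
    show "b \<in> Range (v \<union> N)" if t: "b \<notin> range g" "(g ^^ n) b \<in> Range (v \<union> N)" for b n
    proof (cases "b \<in> Cy")
      case True then show ?thesis using CyN by blast
    next
      case False
      then have "(g ^^ n) b \<notin> Cy" using Cygn by blast
      then show ?thesis using D(10)[OF t(1), of n] t CyN by blast
    qed
    show "\<exists>z. z \<notin> Range (G \<union> H) \<and> (z, x) \<in> (G \<union> H)\<^sup>*" if t: "x \<notin> Domain (v \<union> N)" for x
    proof -
      obtain z where z: "z \<notin> Range G" "(z, x) \<in> G\<^sup>*" using D(11)[of x] t by blast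
      have "z \<notin> Range H"
      proof
        assume "z \<in> Range H"
        then obtain y where y: "(y, z) \<in> H" by blast
        then have "z = x" using z(2) Hfresh(2) by (metis FieldI1 converse_rtranclE)
        then show False using y HE ml NI t by (metis Domain.DomainI Domain_Un_eq UnCI)
      qed
      moreover have "(z, x) \<in> (G \<union> H)\<^sup>*" using z(2) rtrancl_mono[of G "G \<union> H"] by blast
      ultimately show ?thesis using z(1) by blast
    qed
    show "z = e b" if t: "(z, b) \<in> v \<union> N" "b \<notin> range g" for z b
      using t D(12) Cyr CyN by blast
    show "b' = b" if t: "b \<notin> range g" "(e b, b') \<in> v \<union> N" for b b'
      using t(2) D(13)[OF t(1)] ys(3)[OF _ t(1)] NE by (metis UnE)
  qed
qed

end

section \<open>Products of two conjugates\<close>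

text \<open>If \<open>h = G \<circ> F\<close>, the points missed by \<open>h\<close> are the
  \<open>G\<close>-images of the points missed by \<open>F\<close>, together with the points missed
  by \<open>G\<close>. The maps \<open>e1\<close> and \<open>e2\<close> fix these roles in advance:
  \<open>e1 s\<close> is to be the \<open>G\<close>-image of the point labelled \<open>s\<close> in
  \<open>u\<close>, and \<open>e2 b\<close> is to be the point labelled \<open>b\<close> in
  \<open>v\<close>.\<close>

locale factoring = anchoring g e2 for g e2 :: "'a \<Rightarrow> 'a" +
  fixes f h e1 :: "'a \<Rightarrow> 'a"
  assumes inj_f: "inj f" and inj_h: "inj h" and inj_e1: "inj_on e1 (- range f)"
    and e_disj: "e1 ` (- range f) \<inter> e2 ` (- range g) = {}"
    and e_cover: "e1 ` (- range f) \<union> e2 ` (- range g) = - range h"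
    and f_not_surj: "range f \<noteq> UNIV" and g_not_surj: "range g \<noteq> UNIV"
begin

text \<open>Identify the points of the underlying set with those of \<open>h\<close>, and let \<open>u\<close> be a finite partial
  isomorphism onto \<open>f\<close>. It determines part of the unique map \<open>G\<close> with \<open>h = G \<circ> F\<close>, where \<open>F\<close> is
  the copy of \<open>f\<close>; outside the range of \<open>F\<close> that map is prescribed by \<open>e1\<close>.\<close>

definition Gr :: "('a \<times> 'a) set \<Rightarrow> ('a \<times> 'a) set" where
  "Gr u = {(y, h x) |x y. \<exists>\<alpha>. (x, \<alpha>) \<in> u \<and> (y, f \<alpha>) \<in> u} \<union> {(y, e1 s) |y s. s \<notin> range f \<and> (y, s) \<in> u}"

definition ok :: "('a \<times> 'a) set \<Rightarrow> ('a \<times> 'a) set \<Rightarrow> bool" where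
  "ok u v \<longleftrightarrow> finite u \<and> partial_inj u \<and> anch (Gr u) v"

lemma okD:
  assumes "ok u v"
  shows "finite u" "partial_inj u" "anch (Gr u) v"
    "(x, a) \<in> u \<Longrightarrow> (x, b) \<in> u \<Longrightarrow> a = b" "(x, a) \<in> u \<Longrightarrow> (y, a) \<in> u \<Longrightarrow> x = y"
  using assms partial_injD[of u] unfolding ok_def by metis+

lemma e1_range: "s \<notin> range f \<Longrightarrow> e1 s \<notin> range h" and e2_range: "b \<notin> range g \<Longrightarrow> e2 b \<notin> range h"
  using e_cover by blast+

lemma Gr_Domain: "Domain (Gr u) \<subseteq> Domain u"
  unfolding Gr_def by blast

lemma Gr_mono: "u \<subseteq> u' \<Longrightarrow> Gr u \<subseteq> Gr u'"
  unfolding Gr_def by blast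

text \<open>A new label can complete a pair on two sides: \<open>x\<close> becomes the image of the
  point labelled by the predecessor of \<open>\<alpha>\<close>, or the argument whose image is
  labelled \<open>f \<alpha>\<close>. For a fixed point \<open>\<alpha>\<close> of \<open>f\<close>
  the point \<open>x\<close> is its own image, which is why the last set refers to the enlarged
  labelling.\<close>

lemma Gr_insert: "Gr (insert (x, \<alpha>) u) = Gr u \<union> {(x, h p) |p a. (p, a) \<in> u \<and> f a = \<alpha>}
    \<union> {(x, e1 \<alpha>) |_::unit. \<alpha> \<notin> range f} \<union> {(q, h x) |q. (q, f \<alpha>) \<in> insert (x, \<alpha>) u}"
  unfolding Gr_def by auto

lemma Gr_cases:
  assumes "(y, z) \<in> Gr u"
  obtains (edge) x \<alpha> where "z = h x" "(x, \<alpha>) \<in> u" "(y, f \<alpha>) \<in> u"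
  | (start) s where "z = e1 s" "s \<notin> range f" "(y, s) \<in> u"
  using assms unfolding Gr_def by blast

lemma Gr_range_h:
  assumes "(y, h x) \<in> Gr u"
  shows "\<exists>\<alpha>. (x, \<alpha>) \<in> u \<and> (y, f \<alpha>) \<in> u"
  using assms
proof (cases rule: Gr_cases)
  case (edge x' \<alpha>)
  then show ?thesis using injD[OF inj_h, of x x'] by blast
next
  case (start s)
  then show ?thesis using e1_range[of s] by (metis rangeI)
qed

lemma Gr_start:
  assumes "(y, e1 s) \<in> Gr u" "s \<notin> range f"
  shows "(y, s) \<in> u"
  using assms(1)
proof (cases rule: Gr_cases)
  case (edge x' \<alpha>)
  then show ?thesis using e1_range[of s] assms(2) by (metis rangeI)
next
  case (start s')
  then show ?thesis using inj_onD[OF inj_e1, of s s'] assms(2) by simp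
qed

lemma partial_inj_insert:
  assumes "partial_inj u" "x \<notin> Domain u" "\<alpha> \<notin> Range u"
  shows "partial_inj (insert (x, \<alpha>) u)"
  using partial_injD[OF assms(1)] assms(2,3) by (intro partial_injI) blast+

lemma ok_empty: "ok {} {}"
  unfolding ok_def using anch_empty by (simp add: Gr_def partial_inj_def)

lemma far_f: "finite A \<Longrightarrow> \<exists>\<alpha>\<in>range f. (\<forall>i. (f ^^ i) \<alpha> \<notin> A) \<and> inj (\<lambda>i. (f ^^ i) \<alpha>)"
  using far_point[OF inj_f] f_not_surj by blast

lemma far_h: "finite A \<Longrightarrow> \<exists>x\<in>range h. (\<forall>i. (h ^^ i) x \<notin> A) \<and> inj (\<lambda>i. (h ^^ i) x)"
  using far_point[OF inj_h] g_not_surj e2_range by blast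

text \<open>A label on a ray of \<open>f\<close> beyond all used ones has no used neighbour and is
  not missed by \<open>f\<close>, so it forces no edge.\<close>

lemma place_point:
  assumes ok: "ok u v" and x: "x \<notin> Domain u"
  shows "\<exists>u'. u \<subseteq> u' \<and> ok u' v \<and> Domain u' = insert x (Domain u) \<and> Gr u' = Gr u"
proof -
  note O = okD[OF ok]
  obtain \<alpha>0 where \<alpha>0: "\<And>i. (f ^^ i) \<alpha>0 \<notin> Range u" "inj (\<lambda>i. (f ^^ i) \<alpha>0)"
    using far_f[of "Range u"] O(1) by (auto simp: finite_Range)
  define \<alpha> where "\<alpha> = f \<alpha>0"
  have a: "\<alpha>0 \<notin> Range u" "\<alpha> \<notin> Range u" "f \<alpha> \<notin> Range u"
    using \<alpha>0(1)[of 0] \<alpha>0(1)[of 1] \<alpha>0(1)[of 2] by (auto simp: \<alpha>_def numeral_2_eq_2)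
  have ne: "f \<alpha> \<noteq> \<alpha>" using injD[OF \<alpha>0(2), of 1 2] by (auto simp: \<alpha>_def numeral_2_eq_2)
  have G: "Gr (insert (x, \<alpha>) u) = Gr u"
    unfolding Gr_insert using a ne by (auto simp: \<alpha>_def inj_eq[OF inj_f])
  then have "ok (insert (x, \<alpha>) u) v"
    using O partial_inj_insert[OF O(2) x a(2)] unfolding ok_def by simp
  then show ?thesis using G by (intro exI[of _ "insert (x, \<alpha>) u"]) auto
qed

lemma place_edge:
  assumes u: "finite u" "partial_inj u" and xy: "x \<notin> Domain u" "y \<notin> Domain u" "x \<noteq> y"
  shows "\<exists>u'. u \<subseteq> u' \<and> finite u' \<and> partial_inj u' \<and> Domain u' = insert x (insert y (Domain u)) \<and>
    Gr u' = insert (y, h x) (Gr u)"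
proof -
  obtain \<alpha>0 where \<alpha>0: "\<And>i. (f ^^ i) \<alpha>0 \<notin> Range u" "inj (\<lambda>i. (f ^^ i) \<alpha>0)"
    using far_f[of "Range u"] u(1) by (auto simp: finite_Range)
  define \<alpha> where "\<alpha> = f \<alpha>0"
  have a: "\<alpha>0 \<notin> Range u" "\<alpha> \<notin> Range u" "f \<alpha> \<notin> Range u" "f (f \<alpha>) \<notin> Range u"
    using \<alpha>0(1)[of 0] \<alpha>0(1)[of 1] \<alpha>0(1)[of 2] \<alpha>0(1)[of 3]
    by (auto simp: \<alpha>_def numeral_2_eq_2 numeral_3_eq_3)
  have ne: "f \<alpha> \<noteq> \<alpha>" "f (f \<alpha>) \<noteq> \<alpha>" "f (f \<alpha>) \<noteq> f \<alpha>"
    using injD[OF \<alpha>0(2), of 1 2] injD[OF \<alpha>0(2), of 1 3] injD[OF \<alpha>0(2), of 2 3]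
    by (auto simp: \<alpha>_def numeral_2_eq_2 numeral_3_eq_3)
  have 1: "Gr (insert (x, \<alpha>) u) = Gr u"
    unfolding Gr_insert using a ne by (auto simp: \<alpha>_def inj_eq[OF inj_f])
  have p: "{(y, h p) |p a. (p, a) \<in> insert (x, \<alpha>) u \<and> f a = f \<alpha>} = {(y, h x)}"
    using a(2) by (auto simp: inj_eq[OF inj_f])
  have q: "{(q, h y) |q. (q, f (f \<alpha>)) \<in> insert (y, f \<alpha>) (insert (x, \<alpha>) u)} = {}"
    using a ne by blast
  have G: "Gr (insert (y, f \<alpha>) (insert (x, \<alpha>) u)) = insert (y, h x) (Gr u)"
    unfolding Gr_insert[of y] 1 p q by blast
  have "partial_inj (insert (y, f \<alpha>) (insert (x, \<alpha>) u))"
    using u xy a ne by (intro partial_inj_insert) auto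
  then show ?thesis using G u(1) by (intro exI[of _ "insert (y, f \<alpha>) (insert (x, \<alpha>) u)"]) auto
qed

text \<open>The point to receive the label \<open>\<alpha>\<close> lies far out on a ray of
  \<open>h\<close>, so that \<open>x\<close> and \<open>h x\<close> are isolated in
  \<open>Gr u\<close>. The label forces at most one edge out of \<open>x\<close> (\<open>S1\<close>)
  and at most one into \<open>h x\<close> (\<open>S2\<close>); each has a fresh end, and
  \<open>anch_join\<close> inserts them in turn. The set \<open>A\<close> and the predecessor
  \<open>x0\<close> are for later use, where certain points have to stay unlabelled.\<close>

lemma extend_range:
  assumes ok: "ok u v" and \<alpha>: "\<alpha> \<notin> Range u" and A: "finite A"
  obtains u' v' x0 x where "u \<subseteq> u'" "v \<subseteq> v'" "ok u' v'" "(x, \<alpha>) \<in> u'" "Domain u' = insert x (Domain u)"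
    "x \<notin> A" "h x \<notin> A" "h x \<notin> Domain u'" "x = h x0" "x0 \<notin> Domain u'" "x0 \<notin> Domain v'"
proof -
  note O = okD[OF ok]
  note D = anchD[OF O(3)]
  let ?T = "A \<union> Domain u \<union> Domain v \<union> Field (Gr u) \<union> h ` Domain u"
  have "finite ?T" using O(1) D(1,3) A by (simp add: finite_Domain finite_Field)
  then obtain x0 where x0: "\<And>i. (h ^^ i) x0 \<notin> ?T" "inj (\<lambda>i. (h ^^ i) x0)" "x0 \<in> range h"
    using far_h[of ?T] by blast
  define x where "x = h x0"
  have xT: "x0 \<notin> ?T" "x \<notin> ?T" "h x \<notin> ?T"
    using x0(1)[of 0] x0(1)[of 1] x0(1)[of 2] unfolding x_def by (simp_all add: numeral_2_eq_2)
  have ne: "h x \<noteq> x" "x0 \<noteq> x" "x0 \<noteq> h x"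
    using injD[OF x0(2), of 1 2] injD[OF x0(2), of 0 1] injD[OF x0(2), of 0 2]
    unfolding x_def by (auto simp: numeral_2_eq_2)
  have rh: "x0 \<in> range h" "x \<in> range h" "h x \<in> range h" using x0(3) x_def by blast+
  define G where "G = Gr u"
  define S1 where "S1 = {(x, h p) |p a. (p, a) \<in> u \<and> f a = \<alpha>} \<union> {(x, e1 \<alpha>) |_::unit. \<alpha> \<notin> range f}"
  define S2 where "S2 = {(q, h x) |q. (q, f \<alpha>) \<in> insert (x, \<alpha>) u}"
  define u' where "u' = insert (x, \<alpha>) u"
  have Gr': "Gr u' = G \<union> S1 \<union> S2"
    unfolding u'_def Gr_insert S1_def S2_def G_def by blast
  have xu: "x \<notin> Domain u" "h x \<notin> Domain u" "x0 \<notin> Domain u" using xT by blast+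
  have u': "finite u'" "partial_inj u'" "Domain u' = insert x (Domain u)"
    using O(1) partial_inj_insert[OF O(2) xu(1) \<alpha>] by (auto simp: u'_def)
  have AG: "anch G v" using O(3) by (simp add: G_def)
  have xG: "x \<notin> Field G" "h x \<notin> Field G" "x0 \<notin> Field G" "x \<notin> Domain v" "h x \<notin> Domain v" "x0 \<notin> Domain v"
    using xT unfolding G_def by blast+
  have S1x: "w = x" if "(w, z) \<in> S1" for w z using that unfolding S1_def by blast
  have S1z: "z \<notin> Range G \<and> z \<noteq> x \<and> z \<noteq> h x \<and> z \<noteq> x0 \<and> (\<forall>b. b \<notin> range g \<longrightarrow> z \<noteq> e2 b)" if z: "(w, z) \<in> S1" for w z
  proof -
    consider p a where "z = h p" "(p, a) \<in> u" "f a = \<alpha>" | "z = e1 \<alpha>" "\<alpha> \<notin> range f"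
      using z unfolding S1_def by blast
    then show ?thesis
    proof cases
      case 1
      have "h p \<notin> Range G" using Gr_range_h[of _ p u] 1 O(4) \<alpha> unfolding G_def by blast
      moreover have "h p \<in> ?T" using 1 by blast
      then have "h p \<noteq> x" "h p \<noteq> h x" "h p \<noteq> x0" using xT by metis+
      moreover have "h p \<noteq> e2 b" if "b \<notin> range g" for b using e2_range[OF that] by (metis rangeI)
      ultimately show ?thesis using 1(1) by simp
    next
      case 2
      have "e1 \<alpha> \<notin> Range G" using Gr_start[OF _ 2(2)] \<alpha> unfolding G_def by blast
      moreover have "e1 \<alpha> \<notin> range h" using e1_range[OF 2(2)] .
      moreover have "e1 \<alpha> \<noteq> e2 b" if "b \<notin> range g" for b using e_disj 2(2) that by blast
      ultimately show ?thesis using 2(1) rh by metis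
    qed
  qed
  have S1u: "S1 = {} \<or> (\<exists>z. S1 = {(x, z)})"
  proof (cases "\<alpha> \<in> range f")
    case True
    then obtain a where a: "\<alpha> = f a" by blast
    then have "S1 = {(x, h p) |p. (p, a) \<in> u}" unfolding S1_def by (auto simp: inj_eq[OF inj_f])
    then show ?thesis using O(5) by blast
  next
    case False
    then show ?thesis unfolding S1_def by blast
  qed
  have "\<exists>v1. v \<subseteq> v1 \<and> anch (G \<union> S1) v1 \<and> Domain v1 \<subseteq> insert x (Domain v \<union> Field G \<union> Range S1)"
    using S1u
  proof
    assume "\<exists>z. S1 = {(x, z)}"
    then obtain z where z: "S1 = {(x, z)}" by blast
    then have z': "z \<notin> Range G" "z \<noteq> x" "\<And>b. b \<notin> range g \<Longrightarrow> z \<noteq> e2 b" using S1z by blast+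
    have "(z, x) \<notin> G\<^sup>*" using xG(1) z'(2) by (metis FieldI2 rtranclE)
    moreover have "x \<notin> Domain G" "x \<notin> Range G" using xG(1) by (auto simp: Field_def)
    moreover have "x \<noteq> e2 b" if "b \<notin> range g" for b using e2_range[OF that] rh(2) by metis
    ultimately obtain v1 where "v \<subseteq> v1" "anch (insert (x, z) G) v1" "Domain v1 \<subseteq> insert z (insert x (Domain v \<union> Field G))"
      using anch_join[OF AG _ z'(1) _ z'(3), of x] xG(4) by blast
    then show ?thesis using z by (intro exI[of _ v1]) auto
  qed (use AG in auto)
  then obtain v1 where v1: "v \<subseteq> v1" "anch (G \<union> S1) v1" "Domain v1 \<subseteq> insert x (Domain v \<union> Field G \<union> Range S1)"
    by blast
  have hx1: "h x \<notin> Domain v1" "h x \<notin> Domain (G \<union> S1)" "h x \<notin> Range (G \<union> S1)" and x01: "x0 \<notin> Domain v1" "x0 \<notin> Field (G \<union> S1)"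
  proof -
    have S: "h x \<notin> Range S1" "x0 \<notin> Range S1" "Domain S1 \<subseteq> {x}" using S1z S1x by blast+
    show "h x \<notin> Domain v1" "x0 \<notin> Domain v1" using v1(3) S xG ne by blast+
    show "h x \<notin> Domain (G \<union> S1)" "h x \<notin> Range (G \<union> S1)" "x0 \<notin> Field (G \<union> S1)"
      using S xG ne unfolding Field_def by blast+
  qed
  \<comment> \<open>A point labelled \<open>f \<alpha>\<close> gets an outgoing edge only once
    \<open>\<alpha>\<close> is in use. The exceptional case is a fixed point \<open>\<alpha>\<close>
    of \<open>f\<close>: then \<open>q\<close> is \<open>x\<close> itself, and \<open>S1\<close> is
    empty.\<close>
  have S2q: "q \<notin> Domain (G \<union> S1) \<and> q \<noteq> h x \<and> q \<noteq> x0" if q: "(q, f \<alpha>) \<in> u'" for q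
  proof (cases "f \<alpha> = \<alpha>")
    case True
    then have "q = x" using q \<alpha> unfolding u'_def by auto
    moreover have "\<alpha> \<in> range f" using True by (metis rangeI)
    then have "S1 = {}" unfolding S1_def using \<alpha> inj_eq[OF inj_f, of _ \<alpha>] True by auto
    ultimately show ?thesis using xG ne by (auto simp: Field_def)
  next
    case False
    then have q: "(q, f \<alpha>) \<in> u" using that unfolding u'_def by blast
    have "q \<notin> Domain G"
    proof
      assume "q \<in> Domain G"
      then obtain z where "(q, z) \<in> Gr u" unfolding G_def by blast
      then consider x' a where "(x', a) \<in> u" "(q, f a) \<in> u" | s where "s \<notin> range f" "(q, s) \<in> u"
        unfolding Gr_def by blast
      then show False
      proof cases
        case 1
        then have "f a = f \<alpha>" using O(4) q by blast
        then have "a = \<alpha>" using injD[OF inj_f] by blast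
        then show False using 1 \<alpha> by blast
      next
        case 2
        then have "s = f \<alpha>" using O(4) q by blast
        then show False using 2 by blast
      qed
    qed
    moreover have "q \<in> Domain u" using q by blast
    ultimately show ?thesis using S1x xu by blast
  qed
  have S2u: "S2 = {} \<or> (\<exists>q. (q, f \<alpha>) \<in> u' \<and> S2 = {(q, h x)})"
    using partial_injD(2)[OF u'(2)] unfolding S2_def u'_def by blast
  have "\<exists>v'. v1 \<subseteq> v' \<and> anch (G \<union> S1 \<union> S2) v' \<and> x0 \<notin> Domain v'"
    using S2u
  proof
    assume "\<exists>q. (q, f \<alpha>) \<in> u' \<and> S2 = {(q, h x)}"
    then obtain q where q: "(q, f \<alpha>) \<in> u'" "S2 = {(q, h x)}" by blast
    note q' = S2q[OF q(1)]
    have "(h x, q) \<notin> (G \<union> S1)\<^sup>*" using hx1(2) q' by (metis Domain.DomainI converse_rtranclE)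
    moreover have "h x \<noteq> e2 b" if "b \<notin> range g" for b using e2_range[OF that] rh(3) by metis
    ultimately obtain v' where "v1 \<subseteq> v'" "anch (insert (q, h x) (G \<union> S1)) v'"
      "Domain v' \<subseteq> insert (h x) (insert q (Domain v1 \<union> Field (G \<union> S1)))"
      using anch_join[OF v1(2), of q "h x"] q' hx1 by blast
    then show ?thesis using q(2) x01 q' ne by (intro exI[of _ v']) auto
  qed (use v1 x01 in auto)
  then obtain v' where v': "v1 \<subseteq> v'" "anch (Gr u') v'" "x0 \<notin> Domain v'" unfolding Gr' by blast
  have "ok u' v'" using u' v' unfolding ok_def by blast
  moreover have "x \<notin> A" "h x \<notin> A" using xT by blast+
  moreover have "u \<subseteq> u'" "(x, \<alpha>) \<in> u'" by (auto simp: u'_def)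
  moreover have "v \<subseteq> v'" using v1 v' by blast
  moreover have "h x \<notin> Domain u'" "x0 \<notin> Domain u'" using u'(3) xu ne by auto
  ultimately show thesis using that[of u' v' x x0] u'(3) v'(3) x_def by blast
qed

section \<open>Prolonging chains and covering points by the labelling of the second factor\<close>

definition extends :: "('a \<times> 'a) set \<Rightarrow> ('a \<times> 'a) set \<Rightarrow> ('a \<times> 'a) set \<Rightarrow> ('a \<times> 'a) set \<Rightarrow> bool" where
  "extends u v u' v' \<longleftrightarrow> u \<subseteq> u' \<and> v \<subseteq> v' \<and> ok u' v'"

lemma extends_trans: "extends u v u' v' \<Longrightarrow> extends u' v' u'' v'' \<Longrightarrow> extends u v u'' v''"
  unfolding extends_def by blast

lemma extends_refl: "ok u v \<Longrightarrow> extends u v u v"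
  unfolding extends_def by blast

lemma append_point:
  assumes ok: "ok u v" and q: "(q, \<eta>) \<in> v" "q \<notin> Domain (Gr u)" and A: "finite A"
  shows "\<exists>u' v' r. extends u v u' v' \<and> (r, g \<eta>) \<in> v' \<and> r \<notin> Domain u' \<and> r \<notin> A \<and> Domain u' \<inter> A \<subseteq> insert q (Domain u)"
proof -
  obtain u1 where u1: "u \<subseteq> u1" "ok u1 v" "q \<in> Domain u1" "Domain u1 = insert q (Domain u)" "Gr u1 = Gr u"
    using place_point[OF ok, of q] ok by (cases "q \<in> Domain u") auto
  then obtain \<beta> where \<beta>: "(q, \<beta>) \<in> u1" by blast
  have "\<beta> \<in> range f"
  proof (rule ccontr)
    assume "\<beta> \<notin> range f"
    then have "(q, e1 \<beta>) \<in> Gr u1" using \<beta> unfolding Gr_def by blast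
    then show False using q(2) u1(5) by blast
  qed
  then obtain \<alpha> where \<alpha>: "\<beta> = f \<alpha>" by blast
  have "\<alpha> \<notin> Range u1"
  proof
    assume "\<alpha> \<in> Range u1"
    then obtain p where "(p, \<alpha>) \<in> u1" by blast
    then have "(q, h p) \<in> Gr u1" using \<beta> \<alpha> unfolding Gr_def by blast
    then show False using q(2) u1(5) by blast
  qed
  then obtain u' v' x0 x where u': "u1 \<subseteq> u'" "v \<subseteq> v'" "ok u' v'" "(x, \<alpha>) \<in> u'" "Domain u' = insert x (Domain u1)"
    "x \<notin> A" "h x \<notin> A" "h x \<notin> Domain u'" "x = h x0" "x0 \<notin> Domain u'" "x0 \<notin> Domain v'"
    by (rule extend_range[OF u1(2) _ A])
  have "(q, h x) \<in> Gr u'" using u'(1,4) \<beta> \<alpha> unfolding Gr_def by blast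
  then have "(h x, g \<eta>) \<in> v'" using anchD(6)[OF okD(3)[OF u'(3)]] q(1) u'(2) by blast
  moreover have "extends u v u' v'" using u1(1) u'(1-3) unfolding extends_def by blast
  moreover have "Domain u' \<inter> A \<subseteq> insert q (Domain u)" unfolding u'(5) u1(4) using u'(6) by auto
  ultimately show ?thesis using u'(7,8) by (intro exI[of _ u'] exI[of _ v'] exI[of _ "h x"] conjI)
qed

text \<open>A point \<open>z\<close> that is not reserved must have a preimage under
  \<open>G\<close>. If \<open>z = h x1\<close>, it is the image of \<open>x1\<close> under the first
  factor; otherwise \<open>z = e1 s\<close>, and it is the point labelled \<open>s\<close>. Either
  is obtained by covering one more label.\<close>

lemma prepend_point:
  assumes ok: "ok u v" and z: "z \<notin> Range (Gr u)" "\<And>b. b \<notin> range g \<Longrightarrow> z \<noteq> e2 b"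
  shows "\<exists>u' v' x0. extends u v u' v' \<and> (h x0, z) \<in> Gr u' \<and> x0 \<notin> Domain u' \<and> x0 \<notin> Domain v'"
proof (cases "z \<in> range h")
  case False
  then obtain s where s: "s \<notin> range f" "z = e1 s" using z(2) e_cover by blast
  have "s \<notin> Range u" using z(1) s unfolding Gr_def by blast
  then obtain u' v' x0 x where u': "u \<subseteq> u'" "v \<subseteq> v'" "ok u' v'" "(x, s) \<in> u'" "Domain u' = insert x (Domain u)"
    "x \<notin> {}" "h x \<notin> {}" "h x \<notin> Domain u'" "x = h x0" "x0 \<notin> Domain u'" "x0 \<notin> Domain v'"
    by (rule extend_range[OF ok _ finite.emptyI])
  have "(h x0, z) \<in> Gr u'" using u'(4,9) s unfolding Gr_def by blast
  moreover have "extends u v u' v'" using u'(1-3) unfolding extends_def by blast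
  ultimately show ?thesis using u'(10,11) by blast
next
  case True
  then obtain x1 where x1: "z = h x1" by blast
  obtain u1 where u1: "u \<subseteq> u1" "ok u1 v" "x1 \<in> Domain u1" "Gr u1 = Gr u"
    using place_point[OF ok, of x1] ok by (cases "x1 \<in> Domain u") auto
  then obtain \<alpha> where \<alpha>: "(x1, \<alpha>) \<in> u1" by blast
  have "f \<alpha> \<notin> Range u1"
  proof
    assume "f \<alpha> \<in> Range u1"
    then obtain y where "(y, f \<alpha>) \<in> u1" by blast
    then have "(y, z) \<in> Gr u1" using \<alpha> x1 unfolding Gr_def by blast
    then show False using z(1) u1(4) by blast
  qed
  then obtain u' v' x0 x where u': "u1 \<subseteq> u'" "v \<subseteq> v'" "ok u' v'" "(x, f \<alpha>) \<in> u'" "Domain u' = insert x (Domain u1)"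
    "x \<notin> {}" "h x \<notin> {}" "h x \<notin> Domain u'" "x = h x0" "x0 \<notin> Domain u'" "x0 \<notin> Domain v'"
    by (rule extend_range[OF u1(2) _ finite.emptyI])
  have "(h x0, z) \<in> Gr u'" using u'(1,4,9) u1(1) \<alpha> x1 unfolding Gr_def by blast
  moreover have "extends u v u' v'" using u'(1-3) u1(1) unfolding extends_def by blast
  ultimately show ?thesis using u'(10,11) by blast
qed

lemma extend_anchor_start:
  assumes ok: "ok u v" and b: "b \<notin> range g"
  shows "\<exists>v'. extends u v u v' \<and> (e2 b, b) \<in> v'"
proof (cases "e2 b \<in> Domain v")
  case True
  then obtain \<beta> where "(e2 b, \<beta>) \<in> v" by blast
  then have "(e2 b, b) \<in> v" using anchD(13)[OF okD(3)[OF ok] b] by blast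
  then show ?thesis using extends_refl[OF ok] by blast
next
  case False
  note D = anchD[OF okD(3)[OF ok]]
  have b': "b \<notin> Range v" using D(12) b False by blast
  have "(g ^^ i) b \<notin> Range v" for i using D(10)[OF b, of i] b' by blast
  moreover have "inj (\<lambda>i. (g ^^ i) b)" using funpow_start_neq[OF inj_g b] by (auto intro: injI)
  moreover have "{(y, e2 b) |y. \<exists>\<beta>. (y, \<beta>) \<in> v \<and> g \<beta> = b} = {}" using b by blast
  moreover have "(g ^^ Suc n) \<delta> \<noteq> b" for n \<delta> using b by auto
  moreover have "b = b'" if "b' \<notin> range g" "e2 b = e2 b'" for b' using inj_onD[OF inj_e that(2)] that(1) b by simp
  ultimately obtain v' where "v \<subseteq> v'" "anch (Gr u \<union> {}) v'" "(e2 b, b) \<in> v'"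
    using anchor_chain[OF okD(3)[OF ok] D(5)[OF b] False, of b "{}"] by auto
  then show ?thesis using okD[OF ok] unfolding extends_def ok_def by auto
qed

text \<open>The orbit of \<open>b\<close> is infinite but only finitely many labels are in use; the
  point that carries the last used label of this orbit has no outgoing edge.\<close>

lemma chain_end:
  assumes ok: "ok u v" and b: "b \<notin> range g" "b \<in> Range v"
  shows "\<exists>q \<eta>. (q, \<eta>) \<in> v \<and> q \<notin> Domain (Gr u)"
proof -
  note D = anchD[OF okD(3)[OF ok]]
  have inj: "inj (\<lambda>i. (g ^^ i) b)" using funpow_start_neq[OF inj_g b(1)] by (auto intro: injI)
  have "finite {n. (g ^^ n) b \<in> Range v}"
    using finite_vimageI[OF finite_Range[OF D(3)] inj] by (simp add: vimage_def)
  moreover have "{n. (g ^^ n) b \<in> Range v} \<noteq> {}" using b(2) by (auto intro!: exI[of _ 0])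
  ultimately obtain n where n: "(g ^^ n) b \<in> Range v" "(g ^^ Suc n) b \<notin> Range v"
    by (metis (mono_tags, lifting) Max_ge Max_in mem_Collect_eq Suc_n_not_le_n)
  then obtain q where q: "(q, (g ^^ n) b) \<in> v" by blast
  have "q \<notin> Domain (Gr u)" using D(6)[OF _ q] n(2) by auto
  then show ?thesis using q by blast
qed

text \<open>Follow \<open>x\<close> back to the start \<open>z\<close> of its chain. If
  \<open>z\<close> is reserved, the chain begins a forward cycle. Otherwise it is hung on the end
  \<open>q\<close> of the labelled part of a forward cycle of \<open>g\<close>. Joining
  \<open>q\<close> to \<open>z\<close> directly may conflict with labels that \<open>u\<close> has
  already assigned, so both chains are first prolonged, backwards to \<open>h x0\<close> and
  forwards to \<open>r\<close>, with \<open>x0\<close> and \<open>r\<close> unlabelled in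
  \<open>u\<close>; then \<open>place_edge\<close> can impose the edge from \<open>r\<close> to
  \<open>h x0\<close>.\<close>

lemma extend_anchor:
  assumes ok: "ok u v"
  shows "\<exists>u' v'. extends u v u' v' \<and> x \<in> Domain v'"
proof -
  obtain b where b: "b \<notin> range g" using g_not_surj by blast
  obtain v0 where v0: "extends u v u v0" "(e2 b, b) \<in> v0" using extend_anchor_start[OF ok b] by blast
  then have ok0: "ok u v0" unfolding extends_def by blast
  show ?thesis
  proof (cases "x \<in> Domain v0")
    case True then show ?thesis using v0 by blast
  next
    case nx: False
    obtain z where z: "z \<notin> Range (Gr u)" "(z, x) \<in> (Gr u)\<^sup>*" using anchD(11)[OF okD(3)[OF ok0] nx] by blast
    show ?thesis
    proof (cases "\<exists>b. b \<notin> range g \<and> z = e2 b")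
      case True
      then obtain c where "c \<notin> range g" "z = e2 c" by blast
      then obtain v' where v': "extends u v u v'" "(z, c) \<in> v'" using extend_anchor_start[OF ok] by blast
      then have "anch (Gr u) v'" unfolding extends_def ok_def by blast
      then have "x \<in> Domain v'" using anch_path z(2) v'(2) by blast
      then show ?thesis using v' by blast
    next
      case False
      obtain u1 v2 x0 where 1: "extends u v0 u1 v2" "(h x0, z) \<in> Gr u1" "x0 \<notin> Domain u1" "x0 \<notin> Domain v2"
        using prepend_point[OF ok0 z(1)] False by blast
      have ok2: "ok u1 v2" and e2': "extends u v u1 v2" using 1(1) v0(1) unfolding extends_def by blast+
      have px: "(h x0, x) \<in> (Gr u1)\<^sup>*"
        using 1(1,2) z(2) rtrancl_mono[OF Gr_mono, of u u1] unfolding extends_def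
        by (meson converse_rtrancl_into_rtrancl subsetD)
      have b2: "b \<in> Range v2" using v0(2) 1(1) unfolding extends_def by blast
      obtain q \<eta> where q: "(q, \<eta>) \<in> v2" "q \<notin> Domain (Gr u1)"
        using chain_end[OF ok2 b b2] by blast
      have qx: "q \<noteq> x0" using q(1) 1(4) by blast
      obtain u3 v3 r where 3: "extends u1 v2 u3 v3" "(r, g \<eta>) \<in> v3" "r \<notin> Domain u3" "r \<notin> {x0}"
        "Domain u3 \<inter> {x0} \<subseteq> insert q (Domain u1)"
        using append_point[OF ok2 q, of "{x0}"] by auto
      have ok3: "ok u3 v3" and e3: "extends u v u3 v3" using 3(1) e2' extends_trans unfolding extends_def by blast+
      have x03: "x0 \<notin> Domain u3" using 3(5) qx 1(3) by blast
      have px3: "(h x0, x) \<in> (Gr u3)\<^sup>*"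
        using 3(1) px rtrancl_mono[OF Gr_mono, of u1 u3] unfolding extends_def by blast
      show ?thesis
      \<comment> \<open>The prolongations may have labelled \<open>x\<close> already.\<close>
      proof (cases "x \<in> Domain v3")
        case True then show ?thesis using e3 by blast
      next
        case False
        note A3 = okD(3)[OF ok3]
        have hx: "h x0 \<notin> Domain v3" using anch_path[OF A3 px3] False by blast
        have r: "r \<in> Domain v3" "r \<notin> Domain (Gr u3)" using 3 Gr_Domain by blast+
        have hr: "h x0 \<notin> Range (Gr u3)" using Gr_range_h x03 by blast
        have "(h x0, r) \<notin> (Gr u3)\<^sup>*" using anch_path[OF A3] hx r(1) by blast
        moreover have "h x0 \<noteq> e2 c" if "c \<notin> range g" for c using e2_range[OF that] by (metis rangeI)
        ultimately obtain v4 where v4: "v3 \<subseteq> v4" "anch (insert (r, h x0) (Gr u3)) v4"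
          using anch_join[OF A3 r(2) hr] hx by blast
        obtain u4 where u4: "u3 \<subseteq> u4" "finite u4" "partial_inj u4" "Gr u4 = insert (r, h x0) (Gr u3)"
          using place_edge[of u3 x0 r] okD[OF ok3] x03 3(3,4) by blast
        have ok4: "ok u4 v4" using u4 v4 unfolding ok_def by simp
        have "h x0 \<in> Domain v4"
          using anch_path[OF v4(2), of r "h x0"] v4(1) r(1) by blast
        then have "x \<in> Domain v4"
          using anch_path[OF v4(2), of "h x0" x] px3 rtrancl_mono[of "Gr u3" "insert (r, h x0) (Gr u3)"] by blast
        moreover have "extends u v u4 v4" using ok4 e3 u4(1) v4(1) unfolding extends_def by blast
        ultimately show ?thesis by blast
      qed
    qed
  qed
qed

end

context factoring
begin

section \<open>Covering every point of the range of the second labelling\<close>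

lemma place_edges:
  fixes k :: nat
  assumes u: "finite u" "partial_inj u"
    and x: "inj_on xs {..<k}" "xs ` {..<k} \<inter> Domain u = {}"
    and y: "inj_on ys {..<k}" "ys ` {..<k} \<inter> Domain u = {}"
    and xy: "xs ` {..<k} \<inter> ys ` {..<k} = {}"
  shows "\<exists>u'. u \<subseteq> u' \<and> finite u' \<and> partial_inj u' \<and> Domain u' = Domain u \<union> xs ` {..<k} \<union> ys ` {..<k} \<and>
    Gr u' = Gr u \<union> (\<lambda>i. (ys i, h (xs i))) ` {..<k}"
  using x y xy
proof (induction k)
  case 0
  then show ?case using u by auto
next
  case (Suc k)
  have "inj_on xs {..<k}" "inj_on ys {..<k}" using Suc.prems by (auto simp: lessThan_Suc)
  moreover have "xs ` {..<k} \<inter> Domain u = {}" "ys ` {..<k} \<inter> Domain u = {}" "xs ` {..<k} \<inter> ys ` {..<k} = {}"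
    using Suc.prems by (auto simp: lessThan_Suc)
  ultimately obtain u1 where u1: "u \<subseteq> u1" "finite u1" "partial_inj u1" "Domain u1 = Domain u \<union> xs ` {..<k} \<union> ys ` {..<k}"
    "Gr u1 = Gr u \<union> (\<lambda>i. (ys i, h (xs i))) ` {..<k}"
    using Suc.IH by metis
  have "xs k \<notin> Domain u1" "ys k \<notin> Domain u1" "xs k \<noteq> ys k"
    unfolding u1(4) using Suc.prems by (auto simp: lessThan_Suc)
  then obtain u' where u': "u1 \<subseteq> u'" "finite u'" "partial_inj u'" "Domain u' = insert (xs k) (insert (ys k) (Domain u1))"
    "Gr u' = insert (ys k, h (xs k)) (Gr u1)"
    using place_edge[OF u1(2,3)] by metis
  have "u \<subseteq> u'" using u1(1) u'(1) by simp
  moreover have "Domain u' = Domain u \<union> xs ` {..<Suc k} \<union> ys ` {..<Suc k}"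
    unfolding u'(4) u1(4) lessThan_Suc by auto
  moreover have "Gr u' = Gr u \<union> (\<lambda>i. (ys i, h (xs i))) ` {..<Suc k}"
    unfolding u'(5) u1(5) lessThan_Suc by auto
  ultimately show ?case using u'(2,3) by metis
qed

lemma extends_ok: "extends u v u' v' \<Longrightarrow> ok u' v'"
  unfolding extends_def by blast

lemma append_range:
  assumes ok: "ok u v" and "\<gamma> \<in> Range v"
  shows "\<exists>u' v'. extends u v u' v' \<and> g \<gamma> \<in> Range v'"
proof -
  obtain q where q: "(q, \<gamma>) \<in> v" using assms(2) by blast
  show ?thesis
  proof (cases "q \<in> Domain (Gr u)")
    case True
    then have "g \<gamma> \<in> Range v" using anchD(6)[OF okD(3)[OF ok] _ q] by blast
    then show ?thesis using extends_refl[OF ok] by blast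
  next
    case False
    then show ?thesis using append_point[OF ok q False finite.emptyI] by blast
  qed
qed

lemma prepend_range:
  assumes ok: "ok u v" and "g \<gamma> \<in> Range v"
  shows "\<exists>u' v'. extends u v u' v' \<and> \<gamma> \<in> Range v'"
proof -
  note D = anchD[OF okD(3)[OF ok]]
  obtain z where z: "(z, g \<gamma>) \<in> v" using assms(2) by blast
  show ?thesis
  proof (cases "z \<in> Range (Gr u)")
    case True
    then obtain y where "(y, z) \<in> Gr u" by blast
    then obtain \<beta> where "g \<gamma> = g \<beta>" "(y, \<beta>) \<in> v" using D(7)[OF _ z] by blast
    then have "\<gamma> \<in> Range v" using injD[OF inj_g, of \<gamma> \<beta>] by blast
    then show ?thesis using extends_refl[OF ok] by blast
  next
    case False
    have "z \<noteq> e2 b" if "b \<notin> range g" for b using D(13)[OF that] z that by blast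
    then obtain u' v' x0 where *: "extends u v u' v'" "(h x0, z) \<in> Gr u'"
      using prepend_point[OF ok False] by blast
    then have A: "anch (Gr u') v'" "(z, g \<gamma>) \<in> v'" using z unfolding extends_def ok_def by blast+
    obtain \<beta> where "g \<gamma> = g \<beta>" "(h x0, \<beta>) \<in> v'" using anchD(7)[OF A(1) *(2) A(2)] by blast
    then have "\<gamma> \<in> Range v'" using injD[OF inj_g, of \<gamma> \<beta>] by blast
    then show ?thesis using * by blast
  qed
qed

lemma append_range_pow:
  assumes "ok u v" "\<gamma> \<in> Range v"
  shows "\<exists>u' v'. extends u v u' v' \<and> (g ^^ n) \<gamma> \<in> Range v'"
proof (induction n)
  case 0
  then show ?case using assms extends_refl by auto
next
  case (Suc n)
  then obtain u' v' where 1: "extends u v u' v'" "(g ^^ n) \<gamma> \<in> Range v'" by blast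
  then obtain u'' v'' where "extends u' v' u'' v''" "g ((g ^^ n) \<gamma>) \<in> Range v''"
    using append_range[OF extends_ok[OF 1(1)] 1(2)] by blast
  then show ?case using extends_trans[OF 1(1)] by auto
qed

lemma prepend_range_pow:
  "ok u v \<Longrightarrow> (g ^^ n) \<gamma> \<in> Range v \<Longrightarrow> \<exists>u' v'. extends u v u' v' \<and> \<gamma> \<in> Range v'"
proof (induction n arbitrary: u v)
  case 0
  then show ?case using extends_refl by auto
next
  case (Suc n)
  then obtain u' v' where 1: "extends u v u' v'" "(g ^^ n) \<gamma> \<in> Range v'"
    using prepend_range[of u v "(g ^^ n) \<gamma>"] by auto
  then obtain u'' v'' where "extends u' v' u'' v''" "\<gamma> \<in> Range v''"
    using Suc.IH[OF extends_ok[OF 1(1)] 1(2)] by blast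
  then show ?case using extends_trans[OF 1(1)] by blast
qed

text \<open>Declaring \<open>ys i\<close> to be the image of \<open>xs i\<close> under the first
  factor makes \<open>G\<close> send \<open>ys i\<close> to \<open>h (xs i)\<close>, so it is enough
  that this is the next of the points \<open>ys\<close>.\<close>

lemma extend_finite_cycle:
  assumes ok: "ok u v" and k: "k > 0" "(g ^^ k) \<gamma> = \<gamma>" "inj_on (\<lambda>i. (g ^^ i) \<gamma>) {..<k}"
    and new: "\<And>i. (g ^^ i) \<gamma> \<notin> Range v"
  shows "\<exists>u' v'. extends u v u' v' \<and> \<gamma> \<in> Range v'"
proof -
  note O = okD[OF ok]
  note D = anchD[OF O(3)]
  define T where "T = Domain u \<union> Domain v \<union> Field (Gr u)"
  have "finite T" using O(1) D(1,3) unfolding T_def by (simp add: finite_Domain finite_Field)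
  then obtain w where w: "\<And>i. (h ^^ i) w \<notin> T" "inj (\<lambda>i. (h ^^ i) w)" using far_h[OF \<open>finite T\<close>] by metis
  \<comment> \<open>Even and odd positions on one ray keep \<open>xs\<close> and \<open>ys\<close>
    disjoint; the shift \<open>Suc i mod k\<close> makes \<open>h (xs i)\<close> the cyclic
    successor of \<open>ys i\<close>.\<close>
  define xs where "xs i = (h ^^ (2 * (Suc i mod k))) w" for i
  define ys where "ys i = (h ^^ (2 * i + 1)) w" for i
  have hx: "h (xs i) = ys (Suc i mod k)" for i unfolding xs_def ys_def by simp
  have eq: "(h ^^ i) w = (h ^^ j) w \<longleftrightarrow> i = j" for i j using w(2) by (auto dest: injD)
  have sm: "i = j" if "Suc i mod k = Suc j mod k" "i < k" "j < k" for i j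
    using that by (auto simp: mod_Suc split: if_splits)
  have "inj_on xs {..<k}"
  proof (rule inj_onI)
    fix i j assume ij: "i \<in> {..<k}" "j \<in> {..<k}" "xs i = xs j"
    then have "Suc i mod k = Suc j mod k" unfolding xs_def eq by linarith
    then show "i = j" using sm ij by blast
  qed
  moreover have iy: "inj_on ys {..<k}"
    unfolding ys_def by (rule inj_onI) (simp add: eq del: funpow.simps)
  moreover have "xs ` {..<k} \<inter> ys ` {..<k} = {}"
  proof -
    have "xs i \<noteq> ys j" for i j unfolding xs_def ys_def eq
      by (metis dvd_triv_left even_plus_one_iff)
    then show ?thesis by blast
  qed
  moreover have "xs ` {..<k} \<inter> Domain u = {}" "ys ` {..<k} \<inter> Domain u = {}"
    using w(1) unfolding xs_def ys_def T_def by blast+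
  ultimately obtain u' where u': "u \<subseteq> u'" "finite u'" "partial_inj u'"
    "Gr u' = Gr u \<union> (\<lambda>i. (ys i, h (xs i))) ` {..<k}"
    using place_edges[OF O(1,2), of xs k ys] by auto
  have "ys i \<notin> Domain v \<union> Field (Gr u)" for i using w(1) unfolding ys_def T_def by blast
  moreover have "ys i \<noteq> e2 b" if "b \<notin> range g" for i b
  proof -
    have "ys i = h ((h ^^ (2 * i)) w)" unfolding ys_def by simp
    then show ?thesis using e2_range[OF that] by (metis rangeI)
  qed
  ultimately have "anch (Gr u') (v \<union> (\<lambda>i. (ys i, (g ^^ i) \<gamma>)) ` {..<k})"
    unfolding u'(4) hx using anch_cycle[OF O(3) k new iy] by blast
  moreover have "\<gamma> \<in> Range (v \<union> (\<lambda>i. (ys i, (g ^^ i) \<gamma>)) ` {..<k})"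
  proof -
    have "(ys 0, (g ^^ 0) \<gamma>) \<in> (\<lambda>i. (ys i, (g ^^ i) \<gamma>)) ` {..<k}" using k(1) by blast
    then show ?thesis by auto
  qed
  ultimately show ?thesis using u' unfolding extends_def ok_def by blast
qed

text \<open>The cycle of \<open>\<gamma>\<close> is infinite, has no used label and no missed point
  before \<open>\<gamma>\<close>. So an isolated fresh point can carry \<open>\<gamma>\<close>
  without forcing any edge: \<open>anchor_chain\<close> with empty \<open>L\<close>.\<close>

lemma extend_open_cycle:
  assumes ok: "ok u v" and new: "\<And>i n \<delta>. \<delta> \<in> Range v \<Longrightarrow> (g ^^ i) \<gamma> \<noteq> (g ^^ n) \<delta>"
    and "inj (\<lambda>i. (g ^^ i) \<gamma>)" and bw: "\<And>n \<delta>. (g ^^ n) \<delta> = \<gamma> \<Longrightarrow> \<delta> \<in> range g"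
  shows "\<exists>u' v'. extends u v u' v' \<and> \<gamma> \<in> Range v'"
proof -
  note O = okD[OF ok]
  note D = anchD[OF O(3)]
  define T where "T = Domain v \<union> Field (Gr u)"
  have "finite T" using D(1,3) unfolding T_def by (simp add: finite_Domain finite_Field)
  then obtain w where w: "\<And>i. (h ^^ i) w \<notin> T" "w \<in> range h" using far_h[OF \<open>finite T\<close>] by metis
  have w': "w \<notin> Domain v" "w \<notin> Range (Gr u)" using w(1)[of 0] unfolding T_def Field_def by simp_all
  have L: "{} = {(y, w) |y. \<exists>\<beta>. (y, \<beta>) \<in> v \<and> g \<beta> = \<gamma>}" using new[of _ 0 1] by fastforce
  have start: "\<gamma> \<notin> range g \<Longrightarrow> w = e2 \<gamma>" using bw[of 0 \<gamma>] by simp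
  have e2: "\<gamma> = b" if "b \<notin> range g" "w = e2 b" for b using e2_range[OF that(1)] w(2) that(2) by metis
  have nv: "(g ^^ i) \<gamma> \<notin> Range v" for i using new[of _ i 0] by fastforce
  have c: "\<exists>\<beta>\<in>Range v. g \<beta> = \<gamma>" if "\<delta> \<in> Range v" "(g ^^ Suc n) \<delta> = \<gamma>" for n \<delta>
    using new[OF that(1), of 0 "Suc n"] that(2) by simp
  have c0: "\<delta> \<in> Range v" if "\<delta> \<notin> range g" "(g ^^ Suc n) \<delta> = \<gamma>" for n \<delta>
    using bw[OF that(2)] that(1) by blast
  have "\<exists>v'. v \<subseteq> v' \<and> anch (Gr u \<union> {}) v' \<and> (w, \<gamma>) \<in> v' \<and> Domain v' \<subseteq> insert w (Domain v \<union> Field (Gr u))"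
  proof (rule anchor_chain[OF O(3) w'(2,1) nv assms(3) start e2 L])
    show "Domain {} \<inter> Domain (Gr u) = {}" by simp
  qed (assumption | rule c c0)+
  then obtain v' where v': "v \<subseteq> v'" "anch (Gr u) v'" "(w, \<gamma>) \<in> v'"
    unfolding Un_empty_right by (elim exE conjE)
  have "extends u v u v'" using O v'(1,2) unfolding extends_def ok_def by simp
  then show ?thesis using v'(3) by blast
qed

text \<open>If the cycle of \<open>\<beta>\<close> carries a used label, walk forwards from there
  until beyond \<open>\<beta>\<close> and then back to it. If it is a forward cycle, walk from its
  missed point, which can only label the reserved point. What remains is an untouched finite or open
  cycle.\<close>

lemma extend_anchor_range:
  assumes ok: "ok u v"
  shows "\<exists>u' v'. extends u v u' v' \<and> \<beta> \<in> Range v'"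
proof -
  consider (touched) m n \<delta> where "\<delta> \<in> Range v" "(g ^^ m) \<beta> = (g ^^ n) \<delta>"
    | (fwd) n b where "b \<notin> range g" "(g ^^ n) b = \<beta>"
    | (other) "\<And>m n \<delta>. \<delta> \<in> Range v \<Longrightarrow> (g ^^ m) \<beta> \<noteq> (g ^^ n) \<delta>" "\<And>n \<delta>. (g ^^ n) \<delta> = \<beta> \<Longrightarrow> \<delta> \<in> range g"
    by blast
  then show ?thesis
  proof cases
    case touched
    then obtain u1 v1 where 1: "extends u v u1 v1" "(g ^^ m) \<beta> \<in> Range v1"
      using append_range_pow[OF ok, of \<delta> n] by auto
    then obtain u2 v2 where "extends u1 v1 u2 v2" "\<beta> \<in> Range v2"
      using prepend_range_pow[OF extends_ok[OF 1(1)] 1(2)] by blast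
    then show ?thesis using extends_trans[OF 1(1)] by blast
  next
    case fwd
    obtain v1 where v1: "extends u v u v1" "(e2 b, b) \<in> v1" using extend_anchor_start[OF ok fwd(1)] by blast
    have "b \<in> Range v1" using v1(2) by blast
    then obtain u2 v2 where "extends u v1 u2 v2" "(g ^^ n) b \<in> Range v2"
      using append_range_pow[OF extends_ok[OF v1(1)]] by blast
    then show ?thesis using extends_trans[OF v1(1)] fwd(2) by blast
  next
    case other
    have new: "(g ^^ i) \<beta> \<notin> Range v" for i using other(1)[of _ i 0] by fastforce
    show ?thesis
    proof (cases "inj (\<lambda>i. (g ^^ i) \<beta>)")
      case True
      then show ?thesis using extend_open_cycle[OF ok] other by blast
    next
      case False
      then obtain i j where ij: "i < j" "(g ^^ i) \<beta> = (g ^^ j) \<beta>"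
        unfolding inj_def by (metis linorder_neqE_nat)
      define k where "k = (LEAST k. 0 < k \<and> (g ^^ k) \<beta> = \<beta>)"
      have "0 < j - i \<and> (g ^^ (j - i)) \<beta> = \<beta>" using funpow_diff_eq[OF inj_g ij(2)] ij(1) by auto
      then have k: "0 < k" "(g ^^ k) \<beta> = \<beta>" unfolding k_def by (metis (mono_tags, lifting) LeastI)+
      have min: "\<not> (0 < l \<and> (g ^^ l) \<beta> = \<beta>)" if "l < k" for l using not_less_Least that unfolding k_def by blast
      have less: "(g ^^ a) \<beta> \<noteq> (g ^^ b) \<beta>" if "a < b" "b < k" for a b
      proof
        assume "(g ^^ a) \<beta> = (g ^^ b) \<beta>"
        then have "(g ^^ (b - a)) \<beta> = \<beta>" using funpow_diff_eq[OF inj_g, of a \<beta> b \<beta>] that(1) by simp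
        moreover have "b - a < k" "0 < b - a" using that by auto
        ultimately show False using min by metis
      qed
      have "inj_on (\<lambda>i. (g ^^ i) \<beta>) {..<k}"
        by (intro inj_onI) (metis less lessThan_iff linorder_neqE_nat)
      then show ?thesis using extend_finite_cycle[OF ok k _ new] by blast
    qed
  qed
qed

lemma extend_all:
  assumes ok: "ok u v"
  shows "\<exists>u' v'. extends u v u' v' \<and> x \<in> Domain u' \<and> x \<in> Range u' \<and> x \<in> Domain v' \<and> x \<in> Range v'"
proof -
  obtain u1 where 1: "extends u v u1 v" "x \<in> Domain u1"
    using place_point[OF ok, of x] extends_refl[OF ok] unfolding extends_def by (cases "x \<in> Domain u") blast+
  have "\<exists>u2 v2. extends u1 v u2 v2 \<and> x \<in> Range u2"
  proof (cases "x \<in> Range u1")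
    case True
    then show ?thesis using extends_refl[OF extends_ok[OF 1(1)]] by blast
  next
    case False
    from extend_range[OF extends_ok[OF 1(1)] False finite.emptyI] obtain u2 v2 y where
      "u1 \<subseteq> u2" "v \<subseteq> v2" "ok u2 v2" "(y, x) \<in> u2" by metis
    then show ?thesis unfolding extends_def by blast
  qed
  then obtain u2 v2 where 2: "extends u1 v u2 v2" "x \<in> Range u2" by blast
  then obtain u3 v3 where 3: "extends u2 v2 u3 v3" "x \<in> Domain v3"
    using extend_anchor[OF extends_ok[OF 2(1)]] by blast
  then obtain u4 v4 where 4: "extends u3 v3 u4 v4" "x \<in> Range v4"
    using extend_anchor_range[OF extends_ok[OF 3(1)]] by blast
  have "extends u v u4 v4" using 1(1) 2(1) 3(1) 4(1) by (metis extends_trans)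
  moreover have "x \<in> Domain u4" "x \<in> Range u4" "x \<in> Domain v4"
    using 1 2 3 4 unfolding extends_def by blast+
  ultimately show ?thesis using 4(2) by blast
qed

section \<open>The limit of the stages\<close>

lemma partial_inj_total:
  assumes "partial_inj r" "Domain r = UNIV" "Range r = UNIV"
  shows "\<exists>p. bij p \<and> (\<forall>x y. (x, y) \<in> r \<longleftrightarrow> p x = y)"
proof -
  have "\<forall>x. \<exists>y. (x, y) \<in> r" using assms(2) by blast
  then obtain p where p: "\<And>x. (x, p x) \<in> r" by metis
  then have iff: "(x, y) \<in> r \<longleftrightarrow> p x = y" for x y using partial_injD(1)[OF assms(1)] by blast
  have "inj p" using p partial_injD(2)[OF assms(1)] by (intro injI) metis
  moreover have "surj p" using assms(3) iff by (metis Range.cases UNIV_I surjI surj_def)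
  ultimately show ?thesis using iff by (auto simp: bij_def)
qed

text \<open>Back and forth: every step covers one more point in the domains and ranges of both
  labellings, so the unions are permutations \<open>p\<close> and \<open>q\<close>. The product
  formula at \<open>x\<close> needs only one late stage: with \<open>y\<close> the image of
  \<open>x\<close> under the copy of \<open>f\<close>, this stage has the edge from \<open>y\<close>
  to \<open>h x\<close>, and \<open>v\<close> turns edges into steps of \<open>g\<close>.\<close>

theorem conjugates_exist:
  assumes "countable (UNIV :: 'a set)"
  shows "\<exists>p q. bij p \<and> bij q \<and> h = (inv q \<circ> g \<circ> q) \<circ> (inv p \<circ> f \<circ> p)"
proof -
  define R where "R n s s' \<longleftrightarrow> extends (fst s) (snd s) (fst s') (snd s') \<and>
    from_nat_into UNIV n \<in> Domain (fst s') \<inter> Range (fst s') \<inter> Domain (snd s') \<inter> Range (snd s')" for n s s'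
  have "\<exists>s. \<forall>n. ok (fst (s n)) (snd (s n)) \<and> R n (s n) (s (Suc n))"
  proof (rule dependent_nat_choice)
    show "\<exists>s. ok (fst s) (snd s)" using ok_empty by (intro exI[of _ "({}, {})"]) simp
    show "\<exists>s'. ok (fst s') (snd s') \<and> R n s s'" if t: "ok (fst s) (snd s)" for s n
    proof -
      obtain u' v' where "extends (fst s) (snd s) u' v'"
        "from_nat_into UNIV n \<in> Domain u' \<inter> Range u' \<inter> Domain v' \<inter> Range v'"
        using extend_all[OF t, of "from_nat_into UNIV n"] by blast
      then show ?thesis unfolding R_def extends_def by (intro exI[of _ "(u', v')"]) auto
    qed
  qed
  then obtain s where s: "\<And>n. ok (fst (s n)) (snd (s n))" "\<And>n. R n (s n) (s (Suc n))" by blast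
  define u where "u n = fst (s n)" for n
  define v where "v n = snd (s n)" for n
  have ok: "ok (u n) (v n)" for n using s(1) by (simp add: u_def v_def)
  have step: "u n \<subseteq> u (Suc n)" "v n \<subseteq> v (Suc n)" for n
    using s(2)[of n] unfolding R_def extends_def u_def v_def by blast+
  have umono: "u m \<subseteq> u n" if "m \<le> n" for m n using lift_Suc_mono_le[of u, OF step(1) that] .
  have vmono: "v m \<subseteq> v n" if "m \<le> n" for m n using lift_Suc_mono_le[of v, OF step(2) that] .
  have cover: "x \<in> Domain (\<Union>n. u n)" "x \<in> Range (\<Union>n. u n)" "x \<in> Domain (\<Union>n. v n)" "x \<in> Range (\<Union>n. v n)" for x
  proof -
    obtain n where "from_nat_into UNIV n = x"
      using from_nat_into_surj[OF assms, of x] by auto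
    then have "x \<in> Domain (u (Suc n)) \<inter> Range (u (Suc n)) \<inter> Domain (v (Suc n)) \<inter> Range (v (Suc n))"
      using s(2)[of n] unfolding R_def u_def v_def by simp
    then show "x \<in> Domain (\<Union>n. u n)" "x \<in> Range (\<Union>n. u n)" "x \<in> Domain (\<Union>n. v n)" "x \<in> Range (\<Union>n. v n)"
      by blast+
  qed
  have common: "\<exists>k. a \<in> w k \<and> b \<in> w k" if t: "a \<in> (\<Union>n. w n)" "b \<in> (\<Union>n. w n)" "\<And>m n. m \<le> n \<Longrightarrow> w m \<subseteq> w n"
    for a b and w :: "nat \<Rightarrow> ('a \<times> 'a) set"
  proof -
    obtain m n where mn: "a \<in> w m" "b \<in> w n" using t(1,2) by blast
    have "a \<in> w (max m n)" by (rule subsetD[OF t(3)[OF max.cobounded1] mn(1)])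
    moreover have "b \<in> w (max m n)" by (rule subsetD[OF t(3)[OF max.cobounded2] mn(2)])
    ultimately show ?thesis by (intro exI conjI)
  qed
  have union_inj: "partial_inj (\<Union>n. w n)" if t: "\<And>n. partial_inj (w n)" "\<And>m n. m \<le> n \<Longrightarrow> w m \<subseteq> w n"
    for w :: "nat \<Rightarrow> ('a \<times> 'a) set"
  proof (rule partial_injI)
    fix x y z assume "(x, y) \<in> (\<Union>n. w n)" "(x, z) \<in> (\<Union>n. w n)"
    from common[where w = w, OF this t(2)] obtain k where "(x, y) \<in> w k" "(x, z) \<in> w k" by blast
    then show "y = z" using partial_injD(1)[OF t(1)] by blast
  next
    fix x y z assume "(y, x) \<in> (\<Union>n. w n)" "(z, x) \<in> (\<Union>n. w n)"
    from common[where w = w, OF this t(2)] obtain k where "(y, x) \<in> w k" "(z, x) \<in> w k" by blast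
    then show "y = z" using partial_injD(2)[OF t(1)] by blast
  qed
  have "partial_inj (\<Union>n. u n)" by (rule union_inj[where w = u, OF okD(2)[OF ok] umono])
  from partial_inj_total[OF this] obtain p where p: "bij p" "\<And>x y. (x, y) \<in> (\<Union>n. u n) \<longleftrightarrow> p x = y"
    using cover(1,2) by (metis UNIV_eq_I)
  have "partial_inj (\<Union>n. v n)" by (rule union_inj[where w = v, OF anchD(4)[OF okD(3)[OF ok]] vmono])
  from partial_inj_total[OF this] obtain q where q: "bij q" "\<And>x y. (x, y) \<in> (\<Union>n. v n) \<longleftrightarrow> q x = y"
    using cover(3,4) by (metis UNIV_eq_I)
  have "h x = ((inv q \<circ> g \<circ> q) \<circ> (inv p \<circ> f \<circ> p)) x" for x
  proof -
    define y where "y = inv p (f (p x))"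
    have py: "p y = f (p x)" unfolding y_def using p(1) by (meson bij_inv_eq_iff)
    have "(x, p x) \<in> (\<Union>n. u n)" "(y, f (p x)) \<in> (\<Union>n. u n)" using p(2) py by blast+
    from common[where w = u, OF this umono] obtain k where k: "(x, p x) \<in> u k" "(y, f (p x)) \<in> u k" by blast
    obtain l where l: "(y, q y) \<in> v l" using q(2) by blast
    define n where "n = max k l"
    have "(y, h x) \<in> Gr (u n)" using k umono[of k n] unfolding Gr_def n_def by fastforce
    moreover have "(y, q y) \<in> v n" using l vmono[of l n] unfolding n_def by auto
    ultimately have "(h x, g (q y)) \<in> v n" using anchD(6)[OF okD(3)[OF ok]] by blast
    then have "q (h x) = g (q y)" using q(2) by blast
    then show ?thesis unfolding comp_def y_def[symmetric] using q(1) by (metis bij_inv_eq_iff)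
  qed
  then show ?thesis using p(1) q(1) by blast
qed

end

section \<open>Cycles and conjugacy of injections\<close>

definition closed_under :: "('a \<Rightarrow> 'a) \<Rightarrow> 'a set \<Rightarrow> bool" where
  "closed_under f S \<longleftrightarrow> (\<forall>x. f x \<in> S \<longleftrightarrow> x \<in> S)"

text \<open>For an injective map this is the two-sided orbit; comparing forward iterates avoids
  inverse powers, which need not exist.\<close>

definition cyc :: "('a \<Rightarrow> 'a) \<Rightarrow> 'a \<Rightarrow> 'a set" where
  "cyc f x = {y. \<exists>m n. (f ^^ m) x = (f ^^ n) y}"

lemma cycI: "(f ^^ m) x = (f ^^ n) y \<Longrightarrow> y \<in> cyc f x"
  unfolding cyc_def by blast

lemma cyc_refl [simp]: "x \<in> cyc f x"
  by (rule cycI[of 0 _ _ 0]) simp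

lemma funpow_in_cyc [simp]: "(f ^^ n) x \<in> cyc f x"
  by (rule cycI[of n _ _ 0]) simp

lemma cyc_sym: "y \<in> cyc f x \<Longrightarrow> x \<in> cyc f y"
  unfolding cyc_def mem_Collect_eq by metis

lemma closed_funpow: "closed_under f S \<Longrightarrow> (f ^^ n) x \<in> S \<longleftrightarrow> x \<in> S"
  by (induction n) (auto simp: closed_under_def)

lemma closed_cyc: "closed_under f (cyc f x)"
  unfolding closed_under_def
proof (intro allI iffI)
  fix y assume "f y \<in> cyc f x"
  then obtain m n where "(f ^^ m) x = (f ^^ n) (f y)" unfolding cyc_def by blast
  then show "y \<in> cyc f x" by (intro cycI[of m _ _ "Suc n"]) (simp add: funpow_swap1)
next
  fix y assume "y \<in> cyc f x"
  then obtain m n where "(f ^^ m) x = (f ^^ n) y" unfolding cyc_def by blast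
  then show "f y \<in> cyc f x" by (intro cycI[of "Suc m" _ _ n]) (simp add: funpow_swap1)
qed

lemma cyc_subset:
  assumes "closed_under f S" "x \<in> S"
  shows "cyc f x \<subseteq> S"
proof
  fix y assume "y \<in> cyc f x"
  then obtain m n where "(f ^^ m) x = (f ^^ n) y" unfolding cyc_def by blast
  then show "y \<in> S" using closed_funpow[OF assms(1)] assms(2) by metis
qed

lemma cyc_eq: "y \<in> cyc f x \<Longrightarrow> cyc f y = cyc f x"
  using cyc_subset[OF closed_cyc] cyc_sym by (metis subset_antisym)

lemma cyc_disjoint: "y \<notin> cyc f x \<Longrightarrow> cyc f x \<inter> cyc f y = {}"
  using cyc_eq cyc_refl by (metis disjoint_iff)

lemma is_cycle_iff: "is_cycle f S \<longleftrightarrow> (\<exists>x. S = cyc f x)"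
proof
  assume S: "is_cycle f S"
  then obtain x where x: "x \<in> S" and cl: "closed_under f S" unfolding is_cycle_def closed_under_def by blast
  have "cyc f x \<subseteq> S" using cyc_subset[OF cl x] .
  moreover have "cyc f x \<noteq> {}" using cyc_refl by fast
  ultimately have "S = cyc f x"
    using S closed_cyc[of f x] unfolding is_cycle_def closed_under_def by (metis psubsetI)
  then show "\<exists>x. S = cyc f x" by blast
next
  assume "\<exists>x. S = cyc f x"
  then obtain x where S: "S = cyc f x" by blast
  have "T = S" if T: "closed_under f T" "T \<noteq> {}" "T \<subseteq> S" for T
  proof -
    obtain y where y: "y \<in> T" using T(2) by blast
    have "cyc f y \<subseteq> T" by (rule cyc_subset[OF T(1) y])
    moreover have "cyc f y = S" using cyc_eq[of y f x] y S T(3) by blast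
    ultimately show ?thesis using T(3) by simp
  qed
  then have "\<forall>T. T \<subset> S \<and> T \<noteq> {} \<longrightarrow> \<not> closed_under f T" by (auto simp: psubset_eq)
  moreover have "S \<noteq> {}" using S cyc_refl by fast
  moreover have "closed_under f S" using closed_cyc S by simp
  ultimately show "is_cycle f S" unfolding is_cycle_def closed_under_def by (intro conjI)
qed

lemma is_cycle_cyc [simp]: "is_cycle f (cyc f x)"
  using is_cycle_iff by blast

lemma is_cycle_eq: "is_cycle f S \<Longrightarrow> x \<in> S \<Longrightarrow> S = cyc f x"
  using is_cycle_iff cyc_eq by metis

lemma cyc_periodic:
  assumes "inj f" "k > 0" "(f ^^ k) x = x"
  shows "cyc f x = (\<lambda>i. (f ^^ i) x) ` {..<k}"
proof
  let ?I = "(\<lambda>i. (f ^^ i) x) ` {..<k}"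
  have I: "(f ^^ i) x \<in> ?I" for i
    using funpow_mod_eq[OF assms(3), of i] assms(2) by (metis imageI lessThan_iff mod_less_divisor)
  have "closed_under f ?I"
    unfolding closed_under_def
  proof (intro allI iffI)
    fix z assume "f z \<in> ?I"
    then obtain i where "f z = (f ^^ i) x" by blast
    also have "\<dots> = (f ^^ (i + k)) x" using assms(3) by (simp add: funpow_add)
    also have "\<dots> = f ((f ^^ (i + k - 1)) x)" using assms(2) by (cases "i + k") auto
    finally show "z \<in> ?I" using I injD[OF assms(1)] by metis
  next
    fix z assume "z \<in> ?I"
    then obtain i where "z = (f ^^ i) x" by blast
    then show "f z \<in> ?I" using I[of "Suc i"] by simp
  qed
  moreover have "x \<in> ?I" using I[of 0] by simp
  ultimately show "cyc f x \<subseteq> ?I" by (rule cyc_subset)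
qed auto

lemma cyc_infinite_iff:
  assumes "inj f"
  shows "infinite (cyc f x) \<longleftrightarrow> (\<forall>i j. (f ^^ i) x = (f ^^ j) x \<longrightarrow> i = j)"
proof
  assume inf: "infinite (cyc f x)"
  have *: "\<not> i < j" if "(f ^^ i) x = (f ^^ j) x" for i j
  proof
    assume "i < j"
    then have "(f ^^ (j - i)) x = x" "j - i > 0" using funpow_diff_eq[OF assms that] by simp_all
    then have "finite (cyc f x)" using cyc_periodic[OF assms, of "j - i" x] by simp
    then show False using inf by simp
  qed
  show "\<forall>i j. (f ^^ i) x = (f ^^ j) x \<longrightarrow> i = j" using * by (metis linorder_neqE_nat)
next
  assume "\<forall>i j. (f ^^ i) x = (f ^^ j) x \<longrightarrow> i = j"
  then have "inj (\<lambda>i. (f ^^ i) x)" by (auto intro: injI)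
  then have "infinite (range (\<lambda>i. (f ^^ i) x))" using finite_imageD by auto
  moreover have "range (\<lambda>i. (f ^^ i) x) \<subseteq> cyc f x" by (rule image_subsetI) (rule funpow_in_cyc)
  ultimately show "infinite (cyc f x)" using finite_subset by blast
qed

lemma cyc_finite:
  assumes "inj f" "finite (cyc f x)"
  shows "card (cyc f x) > 0" "(f ^^ card (cyc f x)) x = x"
    "\<And>i. 0 < i \<Longrightarrow> i < card (cyc f x) \<Longrightarrow> (f ^^ i) x \<noteq> x"
    "(f ^^ i) x = (f ^^ j) x \<longleftrightarrow> i mod card (cyc f x) = j mod card (cyc f x)"
    "cyc f x \<subseteq> range f"
proof -
  obtain i j where ij: "(f ^^ i) x = (f ^^ j) x" "i < j"
    using cyc_infinite_iff[OF assms(1), of x] assms(2) by (metis linorder_neqE_nat)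
  define k where "k = (LEAST k. 0 < k \<and> (f ^^ k) x = x)"
  have "0 < j - i \<and> (f ^^ (j - i)) x = x" using funpow_diff_eq[OF assms(1) ij(1)] ij(2) by simp
  then have k: "0 < k" "(f ^^ k) x = x" unfolding k_def by (metis (mono_tags, lifting) LeastI)+
  have min: "(f ^^ l) x \<noteq> x" if "0 < l" "l < k" for l
    using not_less_Least[of l] that unfolding k_def by blast
  have less: "(f ^^ a) x \<noteq> (f ^^ b) x" if "a < b" "b < k" for a b
  proof
    assume "(f ^^ a) x = (f ^^ b) x"
    then have "(f ^^ (b - a)) x = x" using funpow_diff_eq[OF assms(1), of a x b x] that(1) by simp
    then show False using min[of "b - a"] that by simp
  qed
  have inj: "inj_on (\<lambda>i. (f ^^ i) x) {..<k}"
    by (intro inj_onI) (metis less lessThan_iff linorder_neqE_nat)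
  have cy: "cyc f x = (\<lambda>i. (f ^^ i) x) ` {..<k}" by (rule cyc_periodic[OF assms(1) k])
  then have ck: "card (cyc f x) = k" using card_image[OF inj] by simp
  show "card (cyc f x) > 0" "(f ^^ card (cyc f x)) x = x" using ck k by simp_all
  show "(f ^^ i) x \<noteq> x" if "0 < i" "i < card (cyc f x)" for i using min that ck by simp
  have "(f ^^ (i mod k)) x = (f ^^ (j mod k)) x \<longleftrightarrow> i mod k = j mod k" for i j
    using inj_on_eq_iff[OF inj, of "i mod k" "j mod k"] k(1) by simp
  then show "(f ^^ i) x = (f ^^ j) x \<longleftrightarrow> i mod card (cyc f x) = j mod card (cyc f x)" for i j
    unfolding ck using funpow_mod_eq[OF k(2)] by metis
  show "cyc f x \<subseteq> range f"
  proof
    fix y assume "y \<in> cyc f x"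
    then obtain i where "y = (f ^^ i) x" unfolding cy by blast
    also have "\<dots> = (f ^^ (i + k)) x" using k(2) by (simp add: funpow_add)
    also have "\<dots> = f ((f ^^ (i + k - 1)) x)" using k(1) by (cases "i + k") auto
    finally show "y \<in> range f" by blast
  qed
qed

text \<open>Of two points on one cycle, one is a forward iterate of the other and hence lies in the
  range, unless they coincide.\<close>

lemma cyc_start_unique:
  assumes "inj f" "y \<in> cyc f x" "x \<notin> range f" "y \<notin> range f"
  shows "x = y"
proof -
  have *: "a = b" if "(f ^^ m) a = (f ^^ n) b" "m \<le> n" "a \<notin> range f" for a b m n
  proof -
    have "a = (f ^^ (n - m)) b" using funpow_diff_eq[OF assms(1) that(1,2)] .
    then show ?thesis using that(3) by (cases "n - m") auto
  qed
  obtain m n where "(f ^^ m) x = (f ^^ n) y" using assms(2) unfolding cyc_def by blast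
  then show ?thesis using *[of m x n y] *[of n y m x] assms(3,4) by (cases "m \<le> n") auto
qed

section \<open>Cycle types and their numbers\<close>

datatype cycle_type = Fwd | Open | Per nat

definition ctype :: "('a \<Rightarrow> 'a) \<Rightarrow> 'a set \<Rightarrow> cycle_type" where
  "ctype f S = (if finite S then Per (card S) else if S \<subseteq> range f then Open else Fwd)"

definition ecard :: "'a set \<Rightarrow> enat" where
  "ecard A = (if finite A then enat (card A) else \<infinity>)"

text \<open>One count indexed by the type lets finite, open and forward cycles be treated by the
  same equations.\<close>

definition cnt :: "cycle_type \<Rightarrow> ('a \<Rightarrow> 'a) \<Rightarrow> enat" where
  "cnt \<tau> f = ecard {S. is_cycle f S \<and> ctype f S = \<tau>}"

lemma count_sets_eq_ecard: "count_sets P = ecard {S. P S}"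
  unfolding count_sets_def ecard_def by simp

lemma C_eq_cnt: "C n f = cnt (Per n) f"
  unfolding C_def cnt_def count_sets_eq_ecard
  by (rule arg_cong[of _ _ ecard], rule Collect_cong) (auto simp: ctype_def)

lemma C_open_eq_cnt: "C_open f = cnt Open f"
  unfolding C_open_def cnt_def count_sets_eq_ecard
  by (rule arg_cong[of _ _ ecard], rule Collect_cong) (auto simp: ctype_def open_cycle_def)

lemma C_fwd_eq_cnt: "C_fwd f = cnt Fwd f"
  unfolding C_fwd_def cnt_def count_sets_eq_ecard
  by (rule arg_cong[of _ _ ecard], rule Collect_cong) (auto simp: ctype_def fwd_cycle_def)

lemma defect_eq_ecard: "defect f = ecard (- range f)"
  unfolding defect_def ecard_def by (simp add: Compl_eq_Diff_UNIV)

lemma ecard_bij_betw: "bij_betw b A B \<Longrightarrow> ecard A = ecard B"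
  unfolding ecard_def using bij_betw_finite bij_betw_same_card by metis

lemma ecard_eq_bij_betw:
  assumes "ecard A = ecard B" "countable A" "countable B"
  shows "\<exists>b. bij_betw b A B"
proof (cases "finite A")
  case True
  then have "finite B" "card A = card B" using assms(1) unfolding ecard_def by (auto split: if_splits)
  then show ?thesis using True finite_same_card_bij by blast
next
  case False
  then have "infinite B" using assms(1) unfolding ecard_def by (auto split: if_splits)
  then have "bij_betw (from_nat_into B \<circ> to_nat_on A) A B"
    using bij_betw_trans[OF to_nat_on_infinite[OF assms(2) False] bij_betw_from_nat_into[OF assms(3)]] by blast
  then show ?thesis by blast
qed

lemma ecard_Un_disjoint: "A \<inter> B = {} \<Longrightarrow> ecard (A \<union> B) = ecard A + ecard B"
  unfolding ecard_def by (auto simp: card_Un_disjoint)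

text \<open>Sending a missed point to its cycle is a bijection onto the forward cycles: a finite
  cycle has no missed point, and no cycle has two.\<close>

lemma defect_eq_C_fwd:
  assumes "inj f"
  shows "defect f = C_fwd f"
proof -
  have "bij_betw (cyc f) (- range f) {S. is_cycle f S \<and> ctype f S = Fwd}"
    unfolding bij_betw_def
  proof
    show "inj_on (cyc f) (- range f)"
    proof (rule inj_onI)
      fix x y assume xy: "x \<in> - range f" "y \<in> - range f" "cyc f x = cyc f y"
      then have "y \<in> cyc f x" using cyc_refl by metis
      then show "x = y" using cyc_start_unique[OF assms] xy by simp
    qed
    have "ctype f (cyc f x) = Fwd" if "x \<notin> range f" for x
    proof -
      have "\<not> cyc f x \<subseteq> range f" using that cyc_refl by (metis subsetD)
      then show ?thesis using cyc_finite(5)[OF assms, of x] unfolding ctype_def by auto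
    qed
    moreover have "\<exists>x. x \<notin> range f \<and> S = cyc f x" if t: "is_cycle f S" "ctype f S = Fwd" for S
    proof -
      obtain x where "x \<in> S" "x \<notin> range f" using t(2) unfolding ctype_def by (auto split: if_splits)
      then show ?thesis using is_cycle_eq[OF t(1)] by blast
    qed
    ultimately show "cyc f ` (- range f) = {S. is_cycle f S \<and> ctype f S = Fwd}" by auto
  qed
  then show ?thesis using ecard_bij_betw unfolding defect_eq_ecard C_fwd_eq_cnt cnt_def by blast
qed

lemma funpow_add_apply: "(f ^^ m) ((f ^^ n) x) = (f ^^ (m + n)) x"
  by (simp add: funpow_add)

section \<open>Isomorphic cycles and conjugate injections\<close>

text \<open>Pairs the points at the same signed distance \<open>m - n\<close> from the base points
  \<open>x\<close> and \<open>y\<close>, written with natural exponents only. Under the hypotheses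
  of \<open>cyc_iso\<close> it is the graph of an isomorphism of cycles.\<close>

definition matched :: "('a \<Rightarrow> 'a) \<Rightarrow> ('b \<Rightarrow> 'b) \<Rightarrow> 'a \<Rightarrow> 'b \<Rightarrow> 'a \<Rightarrow> 'b \<Rightarrow> bool" where
  "matched f g x y z w \<longleftrightarrow> (\<exists>m n. (f ^^ m) x = (f ^^ n) z \<and> (g ^^ m) y = (g ^^ n) w)"

lemma matched_sym: "matched f g x y z w \<longleftrightarrow> matched g f y x w z"
  unfolding matched_def by blast

lemma matched_unique:
  assumes "inj g" "\<And>i j. (f ^^ i) x = (f ^^ j) x \<longleftrightarrow> (g ^^ i) y = (g ^^ j) y"
    and "matched f g x y z w" "matched f g x y z w'"
  shows "w = w'"
proof -
  obtain m n where 1: "(f ^^ m) x = (f ^^ n) z" "(g ^^ m) y = (g ^^ n) w" using assms(3) unfolding matched_def by blast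
  obtain m' n' where 2: "(f ^^ m') x = (f ^^ n') z" "(g ^^ m') y = (g ^^ n') w'" using assms(4) unfolding matched_def by blast
  have "(f ^^ (n' + m)) x = (f ^^ (n' + n)) z" using 1(1) by (metis funpow_add_apply)
  also have "\<dots> = (f ^^ (n + m')) x" using 2(1) by (metis add.commute funpow_add_apply)
  finally have "(g ^^ (n' + m)) y = (g ^^ (n + m')) y" using assms(2) by blast
  moreover have "(g ^^ (n' + m)) y = (g ^^ (n + n')) w" using 1(2) by (metis add.commute funpow_add_apply)
  moreover have "(g ^^ (n + m')) y = (g ^^ (n + n')) w'" using 2(2) by (metis funpow_add_apply)
  ultimately show ?thesis using funpow_inj_eq[OF assms(1)] by metis
qed

text \<open>Only a point \<open>z\<close> that precedes \<open>x\<close> is critical, as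
  \<open>y\<close> must then be pulled back equally often. That is possible if the target cycle has
  no missed point, and it does not occur if \<open>x\<close> is itself missed.\<close>

lemma matched_total:
  assumes "x \<notin> range f \<or> cyc g y \<subseteq> range g" "z \<in> cyc f x"
  assumes "inj f"
  shows "\<exists>w. matched f g x y z w \<and> w \<in> cyc g y"
proof -
  obtain m n where mn: "(f ^^ m) x = (f ^^ n) z" using assms(2) unfolding cyc_def by blast
  have "\<exists>w. (g ^^ m) y = (g ^^ n) w"
  proof (cases "n \<le> m")
    case True
    then have "(g ^^ m) y = (g ^^ n) ((g ^^ (m - n)) y)" unfolding funpow_add_apply by simp
    then show ?thesis by blast
  next
    case False
    then have "x = (f ^^ (n - m)) z" using funpow_diff_eq[OF assms(3) mn] by simp
    then have "x \<in> range f" using False by (cases "n - m") auto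
    then have r: "cyc g y \<subseteq> range g" using assms(1) by blast
    have "\<exists>w. (g ^^ k) w = y" for k
    proof (induction k)
      case (Suc k)
      then obtain w where w: "(g ^^ k) w = y" by blast
      then have "w \<in> cyc g y" using cyc_sym funpow_in_cyc by metis
      then obtain v where "w = g v" using r by blast
      then have "(g ^^ Suc k) v = y" using w by (simp add: funpow_swap1)
      then show ?case by blast
    qed simp
    then obtain w where "(g ^^ (n - m)) w = y" by blast
    then have "(g ^^ m) y = (g ^^ n) w" using False funpow_add_apply[of m g "n - m" w] by simp
    then show ?thesis by blast
  qed
  then obtain w where w: "(g ^^ m) y = (g ^^ n) w" by blast
  have "w \<in> cyc g y" by (rule cycI[OF w])
  moreover have "matched f g x y z w" unfolding matched_def using mn w by (intro exI conjI)
  ultimately show ?thesis by blast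
qed

lemma cyc_iso:
  assumes "inj f" "inj g"
    and per: "\<And>i j. (f ^^ i) x = (f ^^ j) x \<longleftrightarrow> (g ^^ i) y = (g ^^ j) y"
    and start: "x \<notin> range f \<and> y \<notin> range g \<or> cyc f x \<subseteq> range f \<and> cyc g y \<subseteq> range g"
  shows "\<exists>d. bij_betw d (cyc f x) (cyc g y) \<and> (\<forall>z\<in>cyc f x. d (f z) = g (d z))"
proof -
  have st: "x \<notin> range f \<or> cyc g y \<subseteq> range g" "y \<notin> range g \<or> cyc f x \<subseteq> range f"
    using start by argo+
  have "\<forall>z\<in>cyc f x. \<exists>w. matched f g x y z w \<and> w \<in> cyc g y"
    using matched_total[OF st(1) _ assms(1)] by (intro ballI)
  then obtain d where d: "\<And>z. z \<in> cyc f x \<Longrightarrow> matched f g x y z (d z) \<and> d z \<in> cyc g y" by metis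
  have uniq: "w = d z" if "matched f g x y z w" "z \<in> cyc f x" for z w
    using matched_unique[OF assms(2) per that(1)] d[OF that(2)] by blast
  have uniq': "z = z'" if "matched f g x y z w" "matched f g x y z' w" for z z' w
    using matched_unique[OF assms(1) per[symmetric]] that unfolding matched_sym[of f g] by blast
  have "inj_on d (cyc f x)" using d uniq' by (intro inj_onI) metis
  moreover have "w \<in> d ` cyc f x" if t: "w \<in> cyc g y" for w
  proof -
    obtain z where "matched g f y x w z" "z \<in> cyc f x" using matched_total[OF st(2) t assms(2)] by (elim exE conjE)
    then show ?thesis using uniq[of z w] unfolding matched_sym[of g f] by blast
  qed
  then have "d ` cyc f x = cyc g y" using d by blast
  moreover have "d (f z) = g (d z)" if t: "z \<in> cyc f x" for z
  proof -
    have fz: "f z \<in> cyc f x" using closed_cyc t unfolding closed_under_def by metis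
    obtain m n where "(f ^^ m) x = (f ^^ n) z" "(g ^^ m) y = (g ^^ n) (d z)"
      using d[OF t] unfolding matched_def by blast
    then have "(f ^^ Suc m) x = (f ^^ n) (f z)" "(g ^^ Suc m) y = (g ^^ n) (g (d z))"
      by (simp_all add: funpow_swap1)
    then have "matched f g x y (f z) (g (d z))" unfolding matched_def by blast
    then show ?thesis using uniq[OF _ fz] by metis
  qed
  ultimately show ?thesis unfolding bij_betw_def by blast
qed

lemma cycle_iso:
  assumes "inj f" "inj g" "is_cycle f S" "is_cycle g T" "ctype f S = ctype g T"
  shows "\<exists>d. bij_betw d S T \<and> (\<forall>z\<in>S. d (f z) = g (d z))"
proof (cases "finite S")
  case True
  then have T: "finite T" "card S = card T" using assms(5) unfolding ctype_def by (auto split: if_splits)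
  obtain x y where xy: "S = cyc f x" "T = cyc g y" using assms(3,4) is_cycle_iff by metis
  have "(f ^^ i) x = (f ^^ j) x \<longleftrightarrow> (g ^^ i) y = (g ^^ j) y" for i j
    using cyc_finite(4)[OF assms(1), of x i j] cyc_finite(4)[OF assms(2), of y i j] True T xy by simp
  then show ?thesis using cyc_iso[OF assms(1,2), of x y] cyc_finite(5)[OF assms(1), of x]
      cyc_finite(5)[OF assms(2), of y] True T xy by simp
next
  case False
  then have T: "infinite T" "S \<subseteq> range f \<longleftrightarrow> T \<subseteq> range g"
    using assms(5) unfolding ctype_def by (auto split: if_splits)
  have "\<exists>x y. S = cyc f x \<and> T = cyc g y \<and> (x \<notin> range f \<and> y \<notin> range g \<or> cyc f x \<subseteq> range f \<and> cyc g y \<subseteq> range g)"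
  proof (cases "S \<subseteq> range f")
    case True
    then show ?thesis using T(2) assms(3,4) is_cycle_iff by metis
  next
    case False
    then obtain x y where "x \<in> S" "x \<notin> range f" "y \<in> T" "y \<notin> range g" using T(2) by blast
    then show ?thesis using is_cycle_eq[OF assms(3)] is_cycle_eq[OF assms(4)] by blast
  qed
  then obtain x y where xy: "S = cyc f x" "T = cyc g y"
    "x \<notin> range f \<and> y \<notin> range g \<or> cyc f x \<subseteq> range f \<and> cyc g y \<subseteq> range g" by blast
  have "(f ^^ i) x = (f ^^ j) x \<longleftrightarrow> (g ^^ i) y = (g ^^ j) y" for i j
    using cyc_infinite_iff[OF assms(1), of x] cyc_infinite_iff[OF assms(2), of y] False T(1) xy(1,2) by metis
  then show ?thesis using cyc_iso[OF assms(1,2) _ xy(3)] xy(1,2) by simp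
qed

text \<open>Equal counts give a type-preserving bijection \<open>\<beta>\<close> between the cycles
  of the two maps; cycles of the same type are isomorphic, and the isomorphisms glue because cycles
  partition the set. Countability is what makes two infinite families of cycles
  equinumerous.\<close>

theorem conjugate_if_cnt_eq:
  fixes f g :: "'a \<Rightarrow> 'a"
  assumes cb: "countable (UNIV :: 'a set)" and inj: "inj f" "inj g" and cnt: "\<And>\<tau>. cnt \<tau> f = cnt \<tau> g"
  shows "\<exists>d. bij d \<and> d \<circ> f = g \<circ> d"
proof -
  define A where "A k \<tau> = {S. is_cycle k S \<and> ctype k S = \<tau>}" for k :: "'a \<Rightarrow> 'a" and \<tau>
  have "countable (A k \<tau>)" for k \<tau>
  proof -
    have "A k \<tau> \<subseteq> range (cyc k)" unfolding A_def by (auto simp: is_cycle_iff)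
    then show ?thesis using countable_image[OF cb] countable_subset by blast
  qed
  then have "\<exists>b. bij_betw b (A f \<tau>) (A g \<tau>)" for \<tau>
    using ecard_eq_bij_betw[of "A f \<tau>" "A g \<tau>"] cnt[of \<tau>] unfolding cnt_def A_def by blast
  then obtain b where b: "\<And>\<tau>. bij_betw (b \<tau>) (A f \<tau>) (A g \<tau>)" by metis
  define \<beta> where "\<beta> S = b (ctype f S) S" for S
  have \<beta>: "is_cycle g (\<beta> S)" "ctype g (\<beta> S) = ctype f S" if "is_cycle f S" for S
    using bij_betwE[OF b[of "ctype f S"]] that unfolding A_def \<beta>_def by auto
  have \<beta>_inj: "S = T" if "is_cycle f S" "is_cycle f T" "\<beta> S = \<beta> T" for S T
  proof -
    have "ctype f S = ctype f T" using \<beta>(2)[OF that(1)] \<beta>(2)[OF that(2)] that(3) by simp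
    then show ?thesis
      using inj_onD[OF bij_betw_imp_inj_on[OF b[of "ctype f S"]], of S T] that unfolding \<beta>_def A_def by simp
  qed
  have \<beta>_surj: "\<exists>S. is_cycle f S \<and> \<beta> S = T" if t: "is_cycle g T" for T
  proof -
    have "T \<in> A g (ctype g T)" using t unfolding A_def by simp
    then obtain S where "S \<in> A f (ctype g T)" "T = b (ctype g T) S"
      using bij_betw_imp_surj_on[OF b[of "ctype g T"]] by blast
    then show ?thesis unfolding A_def \<beta>_def by (intro exI[of _ S]) simp
  qed
  have "\<exists>d. bij_betw d S (\<beta> S) \<and> (\<forall>z\<in>S. d (f z) = g (d z))" if "is_cycle f S" for S
    using cycle_iso[OF inj that \<beta>(1)[OF that] \<beta>(2)[OF that, symmetric]] .
  then obtain D where D': "\<And>S. is_cycle f S \<Longrightarrow> bij_betw (D S) S (\<beta> S) \<and> (\<forall>z\<in>S. D S (f z) = g (D S z))"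
    by metis
  then have D: "\<And>S. is_cycle f S \<Longrightarrow> bij_betw (D S) S (\<beta> S)"
    "\<And>S z. is_cycle f S \<Longrightarrow> z \<in> S \<Longrightarrow> D S (f z) = g (D S z)" by simp_all
  define d where "d x = D (cyc f x) x" for x
  have d_in: "d x \<in> \<beta> (cyc f x)" for x
    unfolding d_def by (rule bspec[OF bij_betwE[OF D(1)[OF is_cycle_cyc]] cyc_refl])
  have "inj d"
  proof (rule injI)
    fix x y assume xy: "d x = d y"
    have "\<beta> (cyc f x) = cyc g (d x)" "\<beta> (cyc f y) = cyc g (d y)"
      by (rule is_cycle_eq[OF \<beta>(1)[OF is_cycle_cyc] d_in])+
    then have "\<beta> (cyc f x) = \<beta> (cyc f y)" using xy by simp
    then have eq: "cyc f x = cyc f y" by (rule \<beta>_inj[OF is_cycle_cyc is_cycle_cyc])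
    then have "y \<in> cyc f x" using cyc_refl[of y f] by simp
    moreover have "D (cyc f x) x = D (cyc f x) y" using xy eq unfolding d_def by simp
    ultimately show "x = y"
      using inj_onD[OF bij_betw_imp_inj_on[OF D(1)[OF is_cycle_cyc]]] cyc_refl by metis
  qed
  moreover have "\<exists>x. d x = y" for y
  proof -
    obtain S where S: "is_cycle f S" "\<beta> S = cyc g y" using \<beta>_surj[OF is_cycle_cyc] by blast
    then obtain x where x: "x \<in> S" "D S x = y"
      using bij_betw_imp_surj_on[OF D(1)[OF S(1)]] cyc_refl[of y g] by (metis imageE)
    then show ?thesis using is_cycle_eq[OF S(1)] unfolding d_def by metis
  qed
  then have "surj d" by (metis surjI)
  moreover have "d (f x) = g (d x)" for x
  proof -
    have "f x \<in> cyc f x" using funpow_in_cyc[of 1 f x] by simp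
    then have "cyc f (f x) = cyc f x" by (rule cyc_eq)
    then show ?thesis using D(2)[OF is_cycle_cyc cyc_refl] unfolding d_def by metis
  qed
  ultimately show ?thesis by (intro exI[of _ d]) (auto simp: bij_def)
qed

section \<open>Cycle counts after a transposition\<close>

lemma closed_comp_transpose:
  assumes "x \<in> S \<longleftrightarrow> y \<in> S"
  shows "closed_under (f \<circ> transpose x y) S \<longleftrightarrow> closed_under f S"
proof -
  have t: "transpose x y z \<in> S \<longleftrightarrow> z \<in> S" for z using assms by (auto simp: transpose_def)
  show ?thesis
  proof
    assume "closed_under f S"
    then show "closed_under (f \<circ> transpose x y) S" using t by (simp add: closed_under_def)
  next
    assume *: "closed_under (f \<circ> transpose x y) S"
    show "closed_under f S"
      unfolding closed_under_def
    proof
      fix z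
      have "(f \<circ> transpose x y) (transpose x y z) = f z" by simp
      then show "f z \<in> S \<longleftrightarrow> z \<in> S" using * t unfolding closed_under_def by metis
    qed
  qed
qed

lemma comp_transpose_twice [simp]: "f \<circ> transpose x y \<circ> transpose x y = f"
  by (simp add: comp_assoc)

lemma inj_comp_transpose: "inj f \<Longrightarrow> inj (f \<circ> transpose x y)"
  by (simp add: inj_compose inj_on_subset)

lemma range_comp_transpose [simp]: "range (f \<circ> transpose x y) = range f"
  by (metis bij_is_surj bij_transpose image_comp)

lemma ctype_comp_transpose [simp]: "ctype (f \<circ> transpose x y) S = ctype f S"
  unfolding ctype_def range_comp_transpose ..

lemma is_cycle_comp_transpose:
  assumes "x \<notin> S" "y \<notin> S"
  shows "is_cycle (f \<circ> transpose x y) S \<longleftrightarrow> is_cycle f S"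
proof -
  have cl: "closed_under (f \<circ> transpose x y) T \<longleftrightarrow> closed_under f T" if "T \<subseteq> S" for T
    using closed_comp_transpose[of x T y f] that assms by blast
  have "(T \<subset> S \<and> T \<noteq> {} \<longrightarrow> \<not> closed_under (f \<circ> transpose x y) T) \<longleftrightarrow>
    (T \<subset> S \<and> T \<noteq> {} \<longrightarrow> \<not> closed_under f T)" for T
    using cl[of T] by auto
  then show ?thesis unfolding is_cycle_def closed_under_def[symmetric] cl[OF order_refl] by presburger
qed

lemma cyc_comp_transpose_subset:
  assumes "closed_under f S" "x \<in> S" "y \<in> S" "z \<in> S"
  shows "cyc (f \<circ> transpose x y) z \<subseteq> S"
  using cyc_subset[of "f \<circ> transpose x y" S z] closed_comp_transpose[of x S y f] assms by simp

text \<open>The transposition acts first, so the new map sends \<open>y\<close> to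
  \<open>f x\<close> and then follows \<open>f\<close> up to \<open>(f ^^ k) x = y\<close>; this
  closes \<open>A\<close> into a cycle of length \<open>k\<close>. The rest of the old cycle, with
  \<open>x\<close> now sent to \<open>f y\<close>, remains one cycle.\<close>

lemma cyc_split:
  assumes inj: "inj f" and k: "k > 0" "y = (f ^^ k) x" "\<And>i. 0 < i \<Longrightarrow> i < k \<Longrightarrow> (f ^^ i) x \<noteq> y" and ne: "x \<noteq> y"
  defines "A \<equiv> (\<lambda>i. (f ^^ i) x) ` {1..k}"
  shows "cyc (f \<circ> transpose x y) y = A" "cyc (f \<circ> transpose x y) x = cyc f x - A" "card A = k" "finite A" "A \<subseteq> cyc f x" "A \<subseteq> range f"
proof -
  define F where "F = f \<circ> transpose x y"
  have nx: "(f ^^ i) x \<noteq> x" if i: "0 < i" "i \<le> k" for i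
  proof
    assume *: "(f ^^ i) x = x"
    have "y = (f ^^ (k - i)) ((f ^^ i) x)" using k(2) i by (simp add: funpow_add_apply)
    then have "(f ^^ (k - i)) x = y" using * by simp
    moreover have "i < k" using * k(2) ne i(2) by (metis le_neq_implies_less)
    ultimately show False using k(3)[of "k - i"] i(1) by simp
  qed
  show cA: "card A = k" unfolding A_def
  proof -
    have *: "\<not> i < j" if "i \<in> {1..k}" "j \<in> {1..k}" "(f ^^ i) x = (f ^^ j) x" for i j
      using funpow_diff_eq[OF inj that(3)] nx[of "j - i"] that(1,2) by fastforce
    have "inj_on (\<lambda>i. (f ^^ i) x) {1..k}" by (intro inj_onI) (metis * linorder_neqE_nat)
    then show "card ((\<lambda>i. (f ^^ i) x) ` {1..k}) = k" by (simp add: card_image)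
  qed
  show fA: "finite A" unfolding A_def by simp
  show Af: "A \<subseteq> cyc f x" unfolding A_def by (rule image_subsetI) (rule funpow_in_cyc)
  show "A \<subseteq> range f"
  proof
    fix z assume "z \<in> A"
    then obtain i where "i \<in> {1..k}" "z = (f ^^ i) x" unfolding A_def by blast
    then show "z \<in> range f" by (cases i) auto
  qed
  have AI: "(f ^^ i) x \<in> A" if "0 < i" "i \<le> k" for i unfolding A_def using that by auto
  have AE: "\<exists>i. 0 < i \<and> i \<le> k \<and> z = (f ^^ i) x" if z: "z \<in> A" for z
  proof -
    obtain i where "i \<in> {1..k}" "z = (f ^^ i) x" using z unfolding A_def by blast
    then show ?thesis by (intro exI[of _ i]) simp
  qed
  have xA: "x \<notin> A" using AE nx by metis
  have yA: "y \<in> A" using AI[of k] k by simp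
  have fy: "F y = f x" unfolding F_def by simp
    have fi: "F ((f ^^ i) x) = (f ^^ Suc i) x" if "0 < i" "i < k" for i
    using nx[of i] k(3)[of i] that unfolding F_def by simp
  have it: "(F ^^ i) y = (f ^^ i) x" if "0 < i" "i \<le> k" for i
    using that
  proof (induction i)
    case (Suc i)
    show ?case
    proof (cases "i = 0")
      case False
      then have "(F ^^ Suc i) y = F ((f ^^ i) x)" using Suc by simp
      then show ?thesis using fi[of i] False Suc.prems by simp
    qed (use fy in simp)
  qed simp
  have "closed_under F A"
    unfolding closed_under_def
  proof (intro allI iffI)
    fix z assume "z \<in> A"
    then obtain i where i: "0 < i" "i \<le> k" "z = (f ^^ i) x" using AE by blast
    show "F z \<in> A"
    proof (cases "i = k")
      case True
      then show ?thesis using fy i k AI[of 1] by simp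
    next
      case False
      then show ?thesis using fi[of i] i AI[of "Suc i"] by simp
    qed
  next
    fix z assume "F z \<in> A"
    then obtain i where i: "0 < i" "i \<le> k" "F z = (f ^^ i) x" using AE by blast
    have injf': "inj F" unfolding F_def by (rule inj_comp_transpose[OF inj])
    show "z \<in> A"
    proof (cases "i = 1")
      case True
      then have "F z = F y" using i fy by simp
      then show ?thesis using injD[OF injf'] yA by metis
    next
      case False
      then have "F ((f ^^ (i - 1)) x) = (f ^^ i) x" using fi[of "i - 1"] i by simp
      then have "z = (f ^^ (i - 1)) x" using injD[OF injf', of z] i(3) by metis
      then show ?thesis using AI[of "i - 1"] i False by simp
    qed
  qed
  then have "cyc F y \<subseteq> A" using yA by (rule cyc_subset)
  moreover have "A \<subseteq> cyc F y"
  proof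
    fix z assume "z \<in> A"
    then obtain i where "0 < i" "i \<le> k" "z = (f ^^ i) x" using AE by blast
    then show "z \<in> cyc F y" using it[of i] funpow_in_cyc[of i F y] by simp
  qed
  ultimately have cy: "cyc F y = A" by blast
  have ycyc: "y \<in> cyc f x" using k(2) by simp
  have 1: "cyc F x \<subseteq> cyc f x"
    unfolding F_def by (rule cyc_comp_transpose_subset[OF closed_cyc cyc_refl ycyc cyc_refl])
  have 2: "cyc F x \<inter> cyc F y = {}" using cyc_disjoint[of x F y] xA cy by blast
  \<comment> \<open>A set that contains both \<open>x\<close> and \<open>y\<close> is closed under
    \<open>f\<close> exactly if it is closed under \<open>F\<close>, so the old cycle is not larger
    than the two new ones together.\<close>
  have cl: "closed_under F (cyc F x \<union> A)"
    using closed_cyc[of F x] \<open>closed_under F A\<close> unfolding closed_under_def by simp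
  then have "closed_under f (cyc F x \<union> A)"
    using closed_comp_transpose[of x "cyc F x \<union> A" y f] yA cl unfolding F_def by simp
  then have "cyc f x \<subseteq> cyc F x \<union> A" by (rule cyc_subset) simp
  then show "cyc (f \<circ> transpose x y) x = cyc f x - A" "cyc (f \<circ> transpose x y) y = A"
    using 1 2 cy unfolding F_def by blast+
qed

definition delta :: "cycle_type \<Rightarrow> cycle_type \<Rightarrow> enat" where
  "delta \<tau> \<sigma> = (if \<tau> = \<sigma> then 1 else 0)"

lemma ecard_empty [simp]: "ecard {} = 0"
  unfolding ecard_def by (simp add: zero_enat_def)

lemma ecard_insert_type: "ecard {S \<in> {T}. ctype f S = \<tau>} = delta (ctype f T) \<tau>"
proof -
  have "{S \<in> {T}. ctype f S = \<tau>} = (if ctype f T = \<tau> then {T} else {})" by auto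
  then show ?thesis unfolding delta_def ecard_def by (simp add: one_enat_def zero_enat_def)
qed

text \<open>Isolates what composing with the transposition of \<open>x\<close> and \<open>y\<close>
  cannot change; every effect is confined to the cycles through these two points.\<close>

definition base :: "'a \<Rightarrow> 'a \<Rightarrow> cycle_type \<Rightarrow> ('a \<Rightarrow> 'a) \<Rightarrow> enat" where
  "base x y \<tau> f = ecard {S. x \<notin> S \<and> y \<notin> S \<and> is_cycle f S \<and> ctype f S = \<tau>}"

lemma base_comp_transpose: "base x y \<tau> (f \<circ> transpose x y) = base x y \<tau> f"
  unfolding base_def by (rule arg_cong[of _ _ ecard]) (intro Collect_cong, use is_cycle_comp_transpose in \<open>metis ctype_comp_transpose\<close>)

lemma cnt_base:
  "cnt \<tau> f = base x y \<tau> f + ecard {S \<in> {cyc f x, cyc f y}. ctype f S = \<tau>}"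
proof -
  let ?A = "{S. x \<notin> S \<and> y \<notin> S \<and> is_cycle f S \<and> ctype f S = \<tau>}"
  let ?B = "{S \<in> {cyc f x, cyc f y}. ctype f S = \<tau>}"
  have "{S. is_cycle f S \<and> ctype f S = \<tau>} = ?A \<union> ?B"
    using is_cycle_eq[of f] is_cycle_cyc[of f] by blast
  moreover have "?A \<inter> ?B = {}" by auto
  ultimately show ?thesis unfolding cnt_def base_def by (simp only: ecard_Un_disjoint)
qed

lemma cnt_same:
  assumes "cyc f x = cyc f y"
  shows "cnt \<tau> f = base x y \<tau> f + delta (ctype f (cyc f x)) \<tau>"
  using cnt_base[of \<tau> f x y] ecard_insert_type[of "cyc f x" f \<tau>] assms by simp

lemma cnt_diff:
  assumes "cyc f x \<noteq> cyc f y"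
  shows "cnt \<tau> f = base x y \<tau> f + (delta (ctype f (cyc f x)) \<tau> + delta (ctype f (cyc f y)) \<tau>)"
proof -
  have "{S \<in> {cyc f x, cyc f y}. ctype f S = \<tau>} = {S \<in> {cyc f x}. ctype f S = \<tau>} \<union> {S \<in> {cyc f y}. ctype f S = \<tau>}"
    by auto
  moreover have "{S \<in> {cyc f x}. ctype f S = \<tau>} \<inter> {S \<in> {cyc f y}. ctype f S = \<tau>} = {}" using assms by auto
  ultimately show ?thesis unfolding cnt_base[of \<tau> f x y] by (simp only: ecard_Un_disjoint ecard_insert_type)
qed

lemma ctype_Diff_finite:
  assumes "infinite S" "finite A" "A \<subseteq> range f"
  shows "ctype f (S - A) = ctype f S"
proof -
  have "S - A \<subseteq> range f \<longleftrightarrow> S \<subseteq> range f" using assms(3) by blast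
  then show ?thesis using assms(1,2) unfolding ctype_def by simp
qed

text \<open>One cycle of \<open>f\<close> becomes two cycles of \<open>f'\<close>, one of them of length \<open>k\<close>; the other one has
  either the (infinite) type of the original cycle or the complementary length \<open>j\<close>.\<close>

definition splits :: "nat \<Rightarrow> ('a \<Rightarrow> 'a) \<Rightarrow> ('a \<Rightarrow> 'a) \<Rightarrow> bool" where
  "splits k f f' \<longleftrightarrow> k > 0 \<and> ((\<forall>\<tau>. cnt \<tau> f' = cnt \<tau> f + delta (Per k) \<tau>) \<or>
    (\<exists>b j. j > 0 \<and> (\<forall>\<tau>. cnt \<tau> f = b \<tau> + delta (Per (j + k)) \<tau> \<and>
       cnt \<tau> f' = b \<tau> + (delta (Per j) \<tau> + delta (Per k) \<tau>))))"

text \<open>The part removed from an infinite cycle is finite and has no missed point, so the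
  remainder keeps its type and the net effect is one additional \<open>k\<close>-cycle. A finite
  cycle has its length divided as \<open>j + k\<close>.\<close>

lemma cnt_split:
  assumes inj: "inj f" and k: "k > 0" "y = (f ^^ k) x" "\<And>i. 0 < i \<Longrightarrow> i < k \<Longrightarrow> (f ^^ i) x \<noteq> y" and ne: "x \<noteq> y"
  shows "infinite (cyc f x) \<Longrightarrow> cnt \<tau> (f \<circ> transpose x y) = cnt \<tau> f + delta (Per k) \<tau>"
    and "splits k f (f \<circ> transpose x y)"
proof -
  let ?f = "f \<circ> transpose x y"
  define A where "A = (\<lambda>i. (f ^^ i) x) ` {1..k}"
  have sp: "cyc ?f y = A" "cyc ?f x = cyc f x - A" "card A = k" "finite A" "A \<subseteq> cyc f x" "A \<subseteq> range f"
    unfolding A_def by (rule cyc_split[OF inj k ne]; assumption)+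
  have "cyc f x = cyc f y" using cyc_eq[of y f x] k(2) by simp
  then have 1: "cnt \<tau> f = base x y \<tau> f + delta (ctype f (cyc f x)) \<tau>" for \<tau> by (rule cnt_same)
  have xA: "x \<in> cyc f x - A" using cyc_refl[of x ?f] unfolding sp(2) .
  have "cyc ?f x \<noteq> cyc ?f y" unfolding sp(1,2) using xA by blast
  moreover have "ctype f A = Per k" using sp(3,4) unfolding ctype_def by simp
  ultimately have 2: "cnt \<tau> ?f = base x y \<tau> f + (delta (ctype f (cyc f x - A)) \<tau> + delta (Per k) \<tau>)" for \<tau>
    using cnt_diff[of ?f x y \<tau>] by (simp only: sp(1,2) base_comp_transpose ctype_comp_transpose simp_thms)
  show inf: "cnt \<tau> ?f = cnt \<tau> f + delta (Per k) \<tau>" if "infinite (cyc f x)" for \<tau>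
    unfolding 1 2 ctype_Diff_finite[OF that sp(4,6)] by (simp add: add.assoc)
  show "splits k f ?f"
  proof (cases "finite (cyc f x)")
    case False
    then show ?thesis unfolding splits_def using inf k(1) by blast
  next
    case True
    define j where "j = card (cyc f x - A)"
    have "card (cyc f x - A) > 0" using True xA by (metis card_gt_0_iff empty_iff finite_Diff)
    moreover have "card (cyc f x) = j + k"
      unfolding j_def using sp(3,4,5) True by (metis card_Diff_subset card_mono le_add_diff_inverse2)
    moreover have "ctype f (cyc f x) = Per (card (cyc f x))" "ctype f (cyc f x - A) = Per j"
      using True unfolding ctype_def j_def by simp_all
    ultimately have "j > 0" "\<forall>\<tau>. cnt \<tau> f = base x y \<tau> f + delta (Per (j + k)) \<tau> \<and>
      cnt \<tau> ?f = base x y \<tau> f + (delta (Per j) \<tau> + delta (Per k) \<tau>)"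
      unfolding 1 2 j_def by simp_all
    then show ?thesis unfolding splits_def using k(1)
      by (intro conjI disjI2 exI[of _ "\<lambda>\<tau>. base x y \<tau> f"] exI[of _ j])
  qed
qed

lemma same_cycle_cases:
  assumes inj: "inj f" and ne: "x \<noteq> y" and y: "y \<in> cyc f x"
  obtains (fwd) k where "k > 0" "y = (f ^^ k) x" "\<And>i. 0 < i \<Longrightarrow> i < k \<Longrightarrow> (f ^^ i) x \<noteq> y"
  | (bwd) k where "k > 0" "x = (f ^^ k) y" "\<And>i. 0 < i \<Longrightarrow> i < k \<Longrightarrow> (f ^^ i) y \<noteq> x"
proof -
  have *: "\<exists>k>0. y = (f ^^ k) x \<and> (\<forall>i<k. (f ^^ i) x \<noteq> y)" if "x \<noteq> y" "(f ^^ m) x = y" for x y m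
  proof -
    define k where "k = (LEAST k. (f ^^ k) x = y)"
    have k: "(f ^^ k) x = y" unfolding k_def using that(2) by (rule LeastI)
    have "(f ^^ i) x \<noteq> y" if "i < k" for i using not_less_Least that unfolding k_def by blast
    moreover have "k > 0" using k that(1) by (cases k) auto
    ultimately show ?thesis using k by blast
  qed
  obtain m n where mn: "(f ^^ m) x = (f ^^ n) y" using y unfolding cyc_def by blast
  show thesis
  proof (cases "m \<le> n")
    case True
    then have "(f ^^ (n - m)) y = x" using funpow_diff_eq[OF inj mn] by simp
    from *[OF ne[symmetric] this] show ?thesis using bwd by blast
  next
    case False
    then have "(f ^^ (m - n)) x = y" using funpow_diff_eq[OF inj mn[symmetric]] by simp
    from *[OF ne this] show ?thesis using fwd by blast
  qed
qed

lemma splits_same_cycle: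
  assumes inj: "inj f" and ne: "x \<noteq> y" and y: "y \<in> cyc f x"
  shows "\<exists>k. splits k f (f \<circ> transpose x y)"
proof (cases rule: same_cycle_cases[OF assms])
  case (1 k)
  from cnt_split(2)[OF inj 1 ne] show ?thesis by blast
next
  case (2 k)
  from cnt_split(2)[OF inj 2 ne[symmetric]] show ?thesis unfolding transpose_commute[of y x] by blast
qed

text \<open>In the composed map, \<open>y\<close> first runs through the whole finite cycle of
  \<open>x\<close>, arriving at \<open>x\<close> after \<open>card (cyc f x)\<close> steps. The same
  transposition therefore splits this cycle off again: a merge is a split read backwards.\<close>

lemma merge_step:
  assumes inj: "inj f" and fin: "finite (cyc f x)" and y: "y \<notin> cyc f x"
  shows "((f \<circ> transpose x y) ^^ card (cyc f x)) y = x"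
    "\<And>i. 0 < i \<Longrightarrow> i < card (cyc f x) \<Longrightarrow> ((f \<circ> transpose x y) ^^ i) y \<noteq> x"
proof -
  let ?n = "card (cyc f x)"
  define F where "F = f \<circ> transpose x y"
  note per = cyc_finite[OF inj fin]
  have Fz: "F z = f (transpose x y z)" for z unfolding F_def by simp
  have it: "(F ^^ i) y = (f ^^ i) x" if "0 < i" "i \<le> ?n" for i
    using that
  proof (induction i)
    case (Suc i)
    show ?case
    proof (cases "i = 0")
      case False
      then have "(F ^^ i) y = (f ^^ i) x" using Suc.IH Suc.prems by (metis Suc_leD gr0I)
      then have "(F ^^ Suc i) y = F ((f ^^ i) x)" by (metis comp_apply funpow.simps(2))
      moreover have "(f ^^ i) x \<noteq> x" using per(3)[of i] False Suc.prems by simp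
      moreover have "(f ^^ i) x \<noteq> y" using y funpow_in_cyc by metis
      ultimately show ?thesis using Fz[of "(f ^^ i) x"] by simp
    qed (simp add: Fz)
  qed simp
  show "((f \<circ> transpose x y) ^^ ?n) y = x" unfolding F_def[symmetric] using it[of ?n] per(1,2) by simp
  show "((f \<circ> transpose x y) ^^ i) y \<noteq> x" if "0 < i" "i < ?n" for i unfolding F_def[symmetric] using it[of i] per(3)[OF that] that by simp
qed

lemma cnt_merge:
  assumes inj: "inj f" and fin: "finite (cyc f x)" and inf: "infinite (cyc f y)"
  shows "cnt \<tau> f = cnt \<tau> (f \<circ> transpose x y) + delta (Per (card (cyc f x))) \<tau>"
proof -
  let ?f = "f \<circ> transpose y x" and ?n = "card (cyc f x)"
  have y: "y \<notin> cyc f x" using fin inf cyc_eq by metis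
  have ne: "y \<noteq> x" using y cyc_refl by metis
  have n: "?n > 0" using cyc_finite(1)[OF inj fin] .
  note ms = merge_step[OF inj fin y, unfolded transpose_commute[of x y]]
  have injf': "inj ?f" by (rule inj_comp_transpose[OF inj])
  have "cyc (?f \<circ> transpose y x) y = cyc ?f y - (\<lambda>i. (?f ^^ i) y) ` {1..?n}"
    by (rule cyc_split(2)[OF injf' n ms(1)[symmetric] ms(2) ne])
  then have "infinite (cyc ?f y)" using inf unfolding comp_transpose_twice by (metis finite_Diff)
  then show ?thesis
    using cnt_split(1)[OF injf' n ms(1)[symmetric] ms(2) ne, of \<tau>] unfolding comp_transpose_twice
    by (simp add: transpose_commute)
qed

lemma infinite_ctype: "infinite S \<Longrightarrow> ctype f S = (if S - range f = {} then Open else Fwd)"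
  unfolding ctype_def by auto

lemma cycle_start_card:
  assumes "inj f" "is_cycle f S"
  shows "finite (S - range f)" "card (S - range f) = (if S - range f = {} then 0 else 1)"
proof -
  define E where "E = S - range f"
  have "\<exists>a. E \<subseteq> {a}"
  proof (cases "E = {}")
    case False
    then obtain a where a: "a \<in> S" "a \<notin> range f" unfolding E_def by blast
    have "b = a" if "b \<in> E" for b
      using cyc_start_unique[OF assms(1), of b a] is_cycle_eq[OF assms(2) a(1)] that a(2)
      unfolding E_def by (metis DiffE cyc_refl cyc_eq is_cycle_eq[OF assms(2)] a(1))
    then show ?thesis by blast
  qed simp
  then obtain a where "E \<subseteq> {a}" by blast
  then have "E = {} \<or> E = {a}" by blast
  then have "finite E" "card E = (if E = {} then 0 else 1)" by auto
  then show "finite (S - range f)" "card (S - range f) = (if S - range f = {} then 0 else 1)"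
    unfolding E_def by simp_all
qed

text \<open>Both cycles are infinite before and after, since \<open>merge_step\<close> would put
  \<open>x\<close> and \<open>y\<close> on one cycle if one of the cycles were finite. The union of
  the two cycles and the range are the same for both maps, hence so is the number of missed points
  on that union; as a cycle has at most one of them, the two types agree up to order.\<close>

lemma cnt_swap:
  assumes inj: "inj f" and y: "y \<notin> cyc f x" "y \<notin> cyc (f \<circ> transpose x y) x"
  shows "cnt \<tau> (f \<circ> transpose x y) = cnt \<tau> f" "2 \<le> cnt Open f + cnt Fwd f"
proof -
  let ?f = "f \<circ> transpose x y"
  have injf': "inj ?f" by (rule inj_comp_transpose[OF inj])
  have x: "x \<notin> cyc f y" "x \<notin> cyc ?f y" using y cyc_sym[of x f y] cyc_sym[of x ?f y] by argo+
  have inf: "infinite (cyc h x)" "infinite (cyc h y)"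
    if "inj h" "y \<notin> cyc h x" "y \<notin> cyc (h \<circ> transpose x y) x" for h
  proof -
    let ?h = "h \<circ> transpose x y"
    show "infinite (cyc h x)"
    proof
      assume "finite (cyc h x)"
      from merge_step(1)[OF that(1) this that(2)] have "x \<in> cyc ?h y" using funpow_in_cyc by metis
      then show False using that(3) cyc_sym[of x ?h y] by argo
    qed
    show "infinite (cyc h y)"
    proof
      assume f: "finite (cyc h y)"
      have "x \<notin> cyc h y" using that(2) cyc_sym[of x h y] by argo
      from merge_step(1)[OF that(1) f this] have "y \<in> cyc (h \<circ> transpose y x) x" using funpow_in_cyc by metis
      then show False using that(3) by (simp add: transpose_commute)
    qed
  qed
  have i1: "infinite (cyc f x)" "infinite (cyc f y)" by (rule inf[OF inj y])+
  have i2: "infinite (cyc ?f x)" "infinite (cyc ?f y)"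
    using inf[OF injf' y(2)] y(1) unfolding comp_transpose_twice by blast+
  define U where "U h = cyc h x \<union> cyc h y" for h :: "'a \<Rightarrow> 'a"
  have Usub: "U (h \<circ> transpose x y) \<subseteq> U h" for h
  proof -
    have "closed_under h (U h)" using closed_cyc[of h x] closed_cyc[of h y] unfolding closed_under_def U_def by simp
    then have "cyc (h \<circ> transpose x y) z \<subseteq> U h" if "z \<in> {x, y}" for z
      using cyc_comp_transpose_subset[of h "U h" x y z] that unfolding U_def by auto
    then show ?thesis unfolding U_def[of "h \<circ> transpose x y"] by blast
  qed
  have U: "U ?f = U f" using Usub[of f] Usub[of ?f] unfolding comp_transpose_twice by blast
  have cU: "card (U h - range h) = card (cyc h x - range h) + card (cyc h y - range h)"
    if "inj h" "y \<notin> cyc h x" for h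
  proof -
    have "U h - range h = (cyc h x - range h) \<union> (cyc h y - range h)" unfolding U_def by blast
    moreover have "(cyc h x - range h) \<inter> (cyc h y - range h) = {}" using cyc_disjoint[OF that(2)] by blast
    ultimately show ?thesis using cycle_start_card(1)[OF that(1) is_cycle_cyc] by (simp add: card_Un_disjoint)
  qed
  have cards: "card (cyc f x - range f) + card (cyc f y - range f) = card (cyc ?f x - range f) + card (cyc ?f y - range f)"
    using cU[OF inj y(1)] cU[OF injf' y(2)] U unfolding range_comp_transpose by simp
  define a b c d where "a \<longleftrightarrow> cyc f x - range f = {}" and "b \<longleftrightarrow> cyc f y - range f = {}"
    and "c \<longleftrightarrow> cyc ?f x - range f = {}" and "d \<longleftrightarrow> cyc ?f y - range f = {}"
  have na: "card (cyc f x - range f) = (if a then 0 else 1)" "card (cyc f y - range f) = (if b then 0 else 1)"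
    unfolding a_def b_def by (rule cycle_start_card(2)[OF inj is_cycle_cyc])+
  have nc: "card (cyc ?f x - range f) = (if c then 0 else 1)" "card (cyc ?f y - range f) = (if d then 0 else 1)"
    unfolding c_def d_def
    by (rule cycle_start_card(2)[OF injf' is_cycle_cyc, unfolded range_comp_transpose])+
  have abcd: "(if a then 0 else 1) + (if b then 0 else 1) = (if c then 0 else 1) + (if d then 0 else 1 :: nat)"
    using cards unfolding na nc .
  have ct: "ctype f (cyc f x) = (if a then Open else Fwd)" "ctype f (cyc f y) = (if b then Open else Fwd)"
    "ctype f (cyc ?f x) = (if c then Open else Fwd)" "ctype f (cyc ?f y) = (if d then Open else Fwd)"
    unfolding a_def b_def c_def d_def by (rule infinite_ctype; fact)+
  have ne1: "cyc f x \<noteq> cyc f y" "cyc ?f x \<noteq> cyc ?f y" using x cyc_refl by metis+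
  have 1: "cnt \<tau> f = base x y \<tau> f + (delta (if a then Open else Fwd) \<tau> + delta (if b then Open else Fwd) \<tau>)" for \<tau>
    using cnt_diff[OF ne1(1), of \<tau>] ct by simp
  have 2: "cnt \<tau> ?f = base x y \<tau> f + (delta (if c then Open else Fwd) \<tau> + delta (if d then Open else Fwd) \<tau>)" for \<tau>
    using cnt_diff[OF ne1(2), of \<tau>] ct by (simp only: base_comp_transpose ctype_comp_transpose)
  show "cnt \<tau> ?f = cnt \<tau> f" for \<tau>
    using abcd unfolding 1 2 by (auto split: if_splits simp: add.commute)
  show "2 \<le> cnt Open f + cnt Fwd f"
  proof -
    have "cnt Open f + cnt Fwd f = (base x y Open f + base x y Fwd f) + 2"
      unfolding 1 delta_def by (auto simp: algebra_simps)
    then show ?thesis by simp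
  qed
qed

text \<open>If the points share a cycle of \<open>f\<close>, it splits. If they share one of the
  composed map, then \<open>f\<close> arises from that map by a split, because the transposition is
  an involution. Otherwise \<open>cnt_swap\<close> applies.\<close>

lemma transpose_cases:
  assumes inj: "inj f" and ne: "x \<noteq> y"
  obtains (split) k where "splits k f (f \<circ> transpose x y)"
  | (merge) k where "splits k (f \<circ> transpose x y) f"
  | (swap) "\<And>\<tau>. cnt \<tau> (f \<circ> transpose x y) = cnt \<tau> f" "2 \<le> cnt Open f + cnt Fwd f"
proof (cases "y \<in> cyc f x \<or> y \<in> cyc (f \<circ> transpose x y) x")
  case True
  then show ?thesis
    using splits_same_cycle[OF inj ne] splits_same_cycle[OF inj_comp_transpose[OF inj] ne] split merge
      comp_transpose_twice by metis
next
  case False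
  then have "y \<notin> cyc f x" "y \<notin> cyc (f \<circ> transpose x y) x" by blast+
  then show ?thesis using swap cnt_swap[OF inj] by blast
qed

lemma finite_cycle_comp_transpose:
  assumes inj: "inj f" and ne: "x \<noteq> y" and y: "y \<in> cyc f x"
  shows "finite (cyc (f \<circ> transpose x y) x) \<or> finite (cyc (f \<circ> transpose x y) y)"
proof (cases rule: same_cycle_cases[OF assms])
  case (1 k)
  from cyc_split(1)[OF inj 1 ne] show ?thesis by simp
next
  case (2 k)
  from cyc_split(1)[OF inj 2 ne[symmetric]] show ?thesis unfolding transpose_commute[of y x] by simp
qed

section \<open>Finite changes of the cycle counts and their parity\<close>

lemma approx_fin_iff: "approx_fin f g \<longleftrightarrow> cnt Open f = cnt Open g \<and> cnt Fwd f = cnt Fwd g \<and>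
    finite {n. 0 < n \<and> C n f \<noteq> C n g} \<and> (\<forall>n>0. C n f \<noteq> C n g \<longrightarrow> C n f \<noteq> \<infinity> \<and> C n g \<noteq> \<infinity>)"
  unfolding approx_fin_def C_open_eq_cnt C_fwd_eq_cnt ..

lemma approx_fin_refl: "approx_fin f f"
  unfolding approx_fin_def by simp

lemma approx_fin_sym: "approx_fin f g \<Longrightarrow> approx_fin g f"
  unfolding approx_fin_def by (simp add: eq_commute conj_commute)

lemma approx_fin_trans:
  assumes "approx_fin f g" "approx_fin g h"
  shows "approx_fin f h"
proof -
  have "{n. 0 < n \<and> C n f \<noteq> C n h} \<subseteq> {n. 0 < n \<and> C n f \<noteq> C n g} \<union> {n. 0 < n \<and> C n g \<noteq> C n h}" by auto
  then have "finite {n. 0 < n \<and> C n f \<noteq> C n h}"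
    using assms finite_subset unfolding approx_fin_def by (metis (no_types, lifting) finite_UnI)
  moreover have "\<forall>n>0. C n f \<noteq> C n h \<longrightarrow> C n f \<noteq> \<infinity> \<and> C n h \<noteq> \<infinity>"
    using assms unfolding approx_fin_def by metis
  ultimately show ?thesis using assms unfolding approx_fin_def by simp
qed

lemma approx_fin_if_cnt_eq: "(\<And>\<tau>. cnt \<tau> f = cnt \<tau> g) \<Longrightarrow> approx_fin f g"
  unfolding approx_fin_iff C_eq_cnt by simp

definition fin_counts :: "('a \<Rightarrow> 'a) \<Rightarrow> bool" where
  "fin_counts f \<longleftrightarrow> (\<forall>n>0. C n f < \<infinity>)"

lemma fin_counts_approx: "approx_fin f g \<Longrightarrow> fin_counts f \<Longrightarrow> fin_counts g"
  unfolding approx_fin_def fin_counts_def by (metis enat_ord_simps(4))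

text \<open>The sum whose parity decides \<open>approx_even\<close>, kept as an integer so that it
  can be added along sequences of maps.\<close>

definition count_diff :: "('a \<Rightarrow> 'a) \<Rightarrow> ('a \<Rightarrow> 'a) \<Rightarrow> int" where
  "count_diff f g = (\<Sum>n\<in>{n. 0 < n \<and> C n f \<noteq> C n g}. int (the_enat (C n f)) - int (the_enat (C n g)))"

lemma approx_even_iff: "approx_even f g \<longleftrightarrow> approx_fin f g \<and> even (count_diff f g)"
  unfolding approx_even_def count_diff_def ..

text \<open>Terms with equal counts vanish even when the counts are infinite, because
  \<open>the_enat\<close> then gives one and the same value twice. This lets sums with different
  index sets be compared over a common one.\<close>

lemma count_diff_superset:
  assumes "finite F" "{n. 0 < n \<and> C n f \<noteq> C n g} \<subseteq> F" "F \<subseteq> {0<..}"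
  shows "count_diff f g = (\<Sum>n\<in>F. int (the_enat (C n f)) - int (the_enat (C n g)))"
  unfolding count_diff_def using assms by (intro sum.mono_neutral_left) auto

lemma count_diff_trans:
  assumes "approx_fin f g" "approx_fin g h"
  shows "count_diff f h = count_diff f g + count_diff g h"
proof -
  let ?F = "{n. 0 < n \<and> C n f \<noteq> C n g} \<union> {n. 0 < n \<and> C n g \<noteq> C n h}"
  have F: "finite ?F" "?F \<subseteq> {0<..}" using assms unfolding approx_fin_def by auto
  have "count_diff f h = (\<Sum>n\<in>?F. int (the_enat (C n f)) - int (the_enat (C n h)))"
    using F by (intro count_diff_superset) auto
  moreover have "count_diff f g = (\<Sum>n\<in>?F. int (the_enat (C n f)) - int (the_enat (C n g)))"
    using F by (intro count_diff_superset) auto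
  moreover have "count_diff g h = (\<Sum>n\<in>?F. int (the_enat (C n g)) - int (the_enat (C n h)))"
    using F by (intro count_diff_superset) auto
  ultimately show ?thesis by (simp add: sum.distrib[symmetric])
qed

lemma count_diff_self [simp]: "count_diff f f = 0"
  unfolding count_diff_def by simp

lemma count_diff_swap: "approx_fin f g \<Longrightarrow> count_diff g f = - count_diff f g"
  using count_diff_trans[OF _ approx_fin_sym, of f g f] count_diff_trans[OF approx_fin_sym, of f g g] by simp

lemma delta_neq_infinity [simp]: "delta \<sigma> \<tau> \<noteq> \<infinity>"
  unfolding delta_def by (simp add: one_enat_def zero_enat_def del: not_infinity_eq)

lemma splits_approx_fin:
  assumes "splits k f f'"
  shows "approx_fin f f'"
proof -
  have inf: "\<And>\<tau>. (cnt \<tau> f \<noteq> \<infinity> \<and> cnt \<tau> f' \<noteq> \<infinity>) \<or> cnt \<tau> f' = cnt \<tau> f"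
    and "\<exists>F. finite F \<and> (\<forall>\<tau>. \<tau> \<notin> Per ` F \<longrightarrow> cnt \<tau> f' = cnt \<tau> f)"
  proof -
    consider (inf) "\<And>\<tau>. cnt \<tau> f' = cnt \<tau> f + delta (Per k) \<tau>"
      | (fin) b j where "\<And>\<tau>. cnt \<tau> f = b \<tau> + delta (Per (j + k)) \<tau>"
        "\<And>\<tau>. cnt \<tau> f' = b \<tau> + (delta (Per j) \<tau> + delta (Per k) \<tau>)"
      using assms unfolding splits_def by blast
    note cs = this
    show "(cnt \<tau> f \<noteq> \<infinity> \<and> cnt \<tau> f' \<noteq> \<infinity>) \<or> cnt \<tau> f' = cnt \<tau> f" for \<tau>
      using cs
    proof cases
      case inf then show ?thesis by (cases "cnt \<tau> f = \<infinity>") (simp_all add: plus_eq_infty_iff_enat)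
    next
      case fin
      then show ?thesis by (cases "b \<tau> = \<infinity>") (simp_all add: plus_eq_infty_iff_enat)
    qed
    show "\<exists>F. finite F \<and> (\<forall>\<tau>. \<tau> \<notin> Per ` F \<longrightarrow> cnt \<tau> f' = cnt \<tau> f)"
      using cs
    proof cases
      case inf then show ?thesis by (intro exI[of _ "{k}"]) (auto simp: delta_def)
    next
      case fin
      then show ?thesis by (intro exI[of _ "{k, j, j + k}"]) (auto simp: delta_def)
    qed
  qed
  then obtain F where F: "finite F" "\<And>\<tau>. \<tau> \<notin> Per ` F \<Longrightarrow> cnt \<tau> f' = cnt \<tau> f" by blast
  have "{n. 0 < n \<and> C n f \<noteq> C n f'} \<subseteq> F"
  proof
    fix n assume "n \<in> {n. 0 < n \<and> C n f \<noteq> C n f'}"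
    then have "cnt (Per n) f' \<noteq> cnt (Per n) f" unfolding C_eq_cnt by (metis (mono_tags) mem_Collect_eq)
    then have "Per n \<in> Per ` F" using F(2) by metis
    then show "n \<in> F" by blast
  qed
  then have "finite {n. 0 < n \<and> C n f \<noteq> C n f'}" using F(1) finite_subset by blast
  moreover have "cnt Open f = cnt Open f'" "cnt Fwd f = cnt Fwd f'" using F(2)[of Open] F(2)[of Fwd] by (metis imageE cycle_type.distinct)+
  moreover have "\<forall>n>0. C n f \<noteq> C n f' \<longrightarrow> C n f \<noteq> \<infinity> \<and> C n f' \<noteq> \<infinity>"
    using inf unfolding C_eq_cnt by metis
  ultimately show ?thesis unfolding approx_fin_iff by simp
qed

lemma the_enat_add: "a \<noteq> \<infinity> \<Longrightarrow> b \<noteq> \<infinity> \<Longrightarrow> the_enat (a + b) = the_enat a + the_enat b"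
  by (cases a; cases b) auto

lemma the_enat_delta: "the_enat (delta (Per k) (Per n)) = (if n = k then 1 else 0)"
  unfolding delta_def by (auto simp: one_enat_def zero_enat_def)

text \<open>A split adds one cycle in total. Finiteness matters here: an additional cycle would be
  invisible in an infinite count.\<close>

lemma splits_count_diff:
  assumes "splits k f f'" "fin_counts f"
  shows "count_diff f' f = 1"
proof -
  have k: "k > 0" using assms(1) unfolding splits_def by blast
  have fin: "cnt (Per n) f \<noteq> \<infinity>" if "n > 0" for n
    using assms(2) that unfolding fin_counts_def C_eq_cnt by auto
  consider (inf) "\<And>\<tau>. cnt \<tau> f' = cnt \<tau> f + delta (Per k) \<tau>"
    | (fin) b j where "j > 0" "\<And>\<tau>. cnt \<tau> f = b \<tau> + delta (Per (j + k)) \<tau>"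
      "\<And>\<tau>. cnt \<tau> f' = b \<tau> + (delta (Per j) \<tau> + delta (Per k) \<tau>)"
    using assms(1) unfolding splits_def by blast
  then show ?thesis
  proof cases
    case inf
    have "count_diff f' f = (\<Sum>n\<in>{k}. int (the_enat (C n f')) - int (the_enat (C n f)))"
      using k by (intro count_diff_superset) (auto simp: C_eq_cnt inf delta_def split: if_splits)
    also have "\<dots> = 1"
      using fin[OF k] unfolding C_eq_cnt inf by (simp add: the_enat_add the_enat_delta)
    finally show ?thesis .
  next
    case fin: (fin b j)
    define F where "F = {k, j, j + k}"
    have F: "finite F" "F \<subseteq> {0<..}" "k \<in> F" "j \<in> F" "j + k \<in> F" using k fin(1) unfolding F_def by auto
    have "count_diff f' f = (\<Sum>n\<in>F. int (the_enat (C n f')) - int (the_enat (C n f)))"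
      using F(1,2) by (intro count_diff_superset) (auto simp: C_eq_cnt fin delta_def F_def split: if_splits)
    also have "\<dots> = (\<Sum>n\<in>F. (if n = j then 1 else 0) + (if n = k then 1 else 0) - (if n = j + k then 1 else 0))"
    proof (rule sum.cong[OF refl])
      fix n assume "n \<in> F"
      then have "cnt (Per n) f \<noteq> \<infinity>" using F(2) assms(2) unfolding fin_counts_def C_eq_cnt by auto
      then have "b (Per n) \<noteq> \<infinity>" unfolding fin(2) by (simp add: plus_eq_infty_iff_enat)
      then have "the_enat (cnt (Per n) f') = the_enat (b (Per n)) + ((if n = j then 1 else 0) + (if n = k then 1 else 0))"
        "the_enat (cnt (Per n) f) = the_enat (b (Per n)) + (if n = j + k then 1 else 0)"
        unfolding fin(2,3) by (simp_all add: the_enat_add the_enat_delta plus_eq_infty_iff_enat)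
      then show "int (the_enat (C n f')) - int (the_enat (C n f)) =
          (if n = j then 1 else 0) + (if n = k then 1 else 0) - (if n = j + k then 1 else 0)"
        unfolding C_eq_cnt by simp
    qed
    also have "\<dots> = 1"
      unfolding sum_subtractf sum.distrib using F by simp
    finally show ?thesis .
  qed
qed

definition single_infinite :: "('a \<Rightarrow> 'a) \<Rightarrow> bool" where
  "single_infinite f \<longleftrightarrow> C_open f + C_fwd f = 1"

text \<open>A split or a merge changes the number of finite cycles by one, and the third kind of
  transposition requires two infinite cycles, which \<open>single_infinite\<close> excludes.\<close>

lemma comp_transpose_approx:
  assumes "inj f" "x \<noteq> y"
  shows "approx_fin f (f \<circ> transpose x y)"
    and "single_infinite f \<Longrightarrow> fin_counts f \<Longrightarrow> odd (count_diff f (f \<circ> transpose x y))"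
proof -
  let ?f = "f \<circ> transpose x y"
  have "approx_fin f ?f \<and> (single_infinite f \<longrightarrow> fin_counts f \<longrightarrow> odd (count_diff f ?f))"
  proof (cases rule: transpose_cases[OF assms])
    case (1 k)
    have a: "approx_fin f ?f" using splits_approx_fin[OF 1] .
    moreover have "odd (count_diff f ?f)" if "fin_counts f"
      using splits_count_diff[OF 1 that] count_diff_swap[OF a] by simp
    ultimately show ?thesis by blast
  next
    case (2 k)
    have a: "approx_fin f ?f" using approx_fin_sym[OF splits_approx_fin[OF 2]] .
    moreover have "odd (count_diff f ?f)" if "fin_counts f"
      using splits_count_diff[OF 2 fin_counts_approx[OF a that]] by simp
    ultimately show ?thesis by blast
  next
    case 3
    have "\<not> single_infinite f"
    proof
      assume "single_infinite f"
      then have "(2 :: enat) \<le> 1" using 3(2) unfolding single_infinite_def C_open_eq_cnt C_fwd_eq_cnt by simp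
      then show False by (simp add: numeral_eq_enat one_enat_def)
    qed
    then show ?thesis using approx_fin_if_cnt_eq[of f ?f] 3(1) by simp
  qed
  then show "approx_fin f ?f" "single_infinite f \<Longrightarrow> fin_counts f \<Longrightarrow> odd (count_diff f ?f)" by blast+
qed

lemma single_infinite_approx: "approx_fin f g \<Longrightarrow> single_infinite f \<longleftrightarrow> single_infinite g"
  unfolding single_infinite_def approx_fin_def by simp

lemma comp_swapidseq_approx:
  assumes "swapidseq n p" "inj f"
  shows "approx_fin f (f \<circ> p) \<and> (single_infinite f \<longrightarrow> fin_counts f \<longrightarrow> (even (count_diff f (f \<circ> p)) \<longleftrightarrow> even n))"
  using assms
proof (induction arbitrary: f rule: swapidseq.induct)
  case id
  then show ?case by (simp add: approx_fin_refl)
next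
  case (comp_Suc n p a b)
  let ?f = "f \<circ> transpose a b"
  note step = comp_transpose_approx[OF comp_Suc.prems comp_Suc.hyps(2)]
  note IH = comp_Suc.IH[OF inj_comp_transpose[OF comp_Suc.prems, of a b]]
  have eq: "f \<circ> (transpose a b \<circ> p) = ?f \<circ> p" by (simp add: comp_assoc)
  have a: "approx_fin f (?f \<circ> p)" using approx_fin_trans[OF step(1)] IH by blast
  have "even (count_diff f (?f \<circ> p)) \<longleftrightarrow> even (Suc n)" if s: "single_infinite f" "fin_counts f"
  proof -
    have "single_infinite ?f" "fin_counts ?f"
      using single_infinite_approx[OF step(1)] fin_counts_approx[OF step(1)] s by blast+
    then have "even (count_diff ?f (?f \<circ> p)) \<longleftrightarrow> even n" using IH by blast
    then show ?thesis using count_diff_trans[OF step(1), of "?f \<circ> p"] IH step(2)[OF s] by simp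
  qed
  then show ?case unfolding eq using a by blast
qed

lemma comp_permutation_approx:
  assumes "permutation p" "inj f"
  shows "approx_fin f (f \<circ> p)"
    and "single_infinite f \<Longrightarrow> fin_counts f \<Longrightarrow> even (count_diff f (f \<circ> p)) \<longleftrightarrow> evenperm p"
proof -
  obtain n where n: "swapidseq n p" using assms(1) unfolding permutation_def by blast
  have "evenperm p = even n" using evenperm_unique[OF n refl] .
  then show "approx_fin f (f \<circ> p)" "single_infinite f \<Longrightarrow> fin_counts f \<Longrightarrow> even (count_diff f (f \<circ> p)) \<longleftrightarrow> evenperm p"
    using comp_swapidseq_approx[OF n assms(2)] by simp_all
qed

section \<open>Realising changes of the cycle counts by finitary permutations\<close>

lemma cnt_nonzero:
  assumes "cnt \<tau> f \<noteq> 0"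
  shows "\<exists>x. ctype f (cyc f x) = \<tau>"
proof -
  have "{S. is_cycle f S \<and> ctype f S = \<tau>} \<noteq> {}"
  proof
    assume *: "{S. is_cycle f S \<and> ctype f S = \<tau>} = {}"
    show False using assms unfolding cnt_def * by simp
  qed
  then obtain S where S: "is_cycle f S" "ctype f S = \<tau>" by blast
  then obtain x where "S = cyc f x" unfolding is_cycle_iff by (elim exE)
  then show ?thesis using S(2) by (intro exI[of _ x]) simp
qed

lemma ctype_Per: "ctype f S = Per n \<Longrightarrow> finite S \<and> card S = n"
  and ctype_infinite: "ctype f S = Fwd \<or> ctype f S = Open \<Longrightarrow> infinite S"
  unfolding ctype_def by (auto split: if_splits)

lemma cnt_Per_0: "cnt (Per 0) f = 0"
proof (rule ccontr)
  assume "cnt (Per 0) f \<noteq> 0"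
  then obtain x where "ctype f (cyc f x) = Per 0" using cnt_nonzero by blast
  then have "cyc f x = {}" using ctype_Per[of f "cyc f x" 0] by auto
  then show False using cyc_refl[of x f] by simp
qed

lemma permutation_comp_transpose: "permutation p \<Longrightarrow> permutation (transpose x y \<circ> p)"
  by (rule permutation_compose[OF permutation_swap_id])

text \<open>Merging a finite cycle into a forward cycle by a transposition removes it without any other
  effect on the cycle counts.\<close>

lemma remove_cycles:
  assumes "inj f" "cnt Fwd f \<noteq> 0" "cnt (Per n) f = enat m"
  shows "\<exists>p. permutation p \<and> (\<forall>\<tau>. cnt \<tau> (f \<circ> p) = (if \<tau> = Per n then 0 else cnt \<tau> f))"
  using assms
proof (induction m arbitrary: f)
  case 0
  then have "\<forall>\<tau>. cnt \<tau> (f \<circ> id) = (if \<tau> = Per n then 0 else cnt \<tau> f)" by (simp add: zero_enat_def)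
  then show ?case using permutation_id by blast
next
  case (Suc m)
  obtain x where x: "ctype f (cyc f x) = Per n"
    using cnt_nonzero[of "Per n" f] Suc.prems(3) by (auto simp: zero_enat_def)
  obtain y where y: "ctype f (cyc f y) = Fwd" using cnt_nonzero[OF Suc.prems(2)] by blast
  let ?f = "f \<circ> transpose x y"
  have c: "cnt \<tau> f = cnt \<tau> ?f + delta (Per n) \<tau>" for \<tau>
    using cnt_merge[OF Suc.prems(1), of x y \<tau>] ctype_Per[OF x] ctype_infinite[OF disjI1[OF y]] by simp
  have "cnt (Per n) ?f + 1 = enat m + 1"
    using c[of "Per n"] Suc.prems(3) unfolding delta_def by (simp add: one_enat_def)
  then have "cnt (Per n) ?f = enat m" by (cases "cnt (Per n) ?f") (auto simp: one_enat_def)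
  moreover have "cnt Fwd ?f \<noteq> 0" using c[of Fwd] Suc.prems(2) unfolding delta_def by simp
  ultimately obtain p where p: "permutation p" "\<forall>\<tau>. cnt \<tau> (?f \<circ> p) = (if \<tau> = Per n then 0 else cnt \<tau> ?f)"
    using Suc.IH[OF inj_comp_transpose[OF Suc.prems(1)]] by blast
  have "f \<circ> (transpose x y \<circ> p) = ?f \<circ> p" by (simp add: comp_assoc)
  moreover have "cnt \<tau> ?f = cnt \<tau> f" if "\<tau> \<noteq> Per n" for \<tau> using c[of \<tau>] that unfolding delta_def by simp
  ultimately have "\<forall>\<tau>. cnt \<tau> (f \<circ> (transpose x y \<circ> p)) = (if \<tau> = Per n then 0 else cnt \<tau> f)" using p(2) by simp
  then show ?case using permutation_comp_transpose[OF p(1)] by blast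
qed

lemma inj_comp_permutation: "inj f \<Longrightarrow> permutation p \<Longrightarrow> inj (f \<circ> p)"
  by (rule inj_compose[OF _ bij_is_inj[OF permutation_bijective]])

lemma remove_all_cycles:
  assumes "finite K" "inj f" "cnt Fwd f \<noteq> 0" "\<forall>n\<in>K. cnt (Per n) f \<noteq> \<infinity>"
  shows "\<exists>p. permutation p \<and> (\<forall>\<tau>. cnt \<tau> (f \<circ> p) = (if \<tau> \<in> Per ` K then 0 else cnt \<tau> f))"
  using assms
proof (induction K arbitrary: f)
  case empty
  then have "\<forall>\<tau>. cnt \<tau> (f \<circ> id) = (if \<tau> \<in> Per ` {} then 0 else cnt \<tau> f)" by simp
  then show ?case using permutation_id by blast
next
  case (insert n K)
  obtain m where "cnt (Per n) f = enat m" using insert.prems(3) by auto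
  from remove_cycles[OF insert.prems(1,2) this]
  obtain p where p: "permutation p" "\<And>\<tau>. cnt \<tau> (f \<circ> p) = (if \<tau> = Per n then 0 else cnt \<tau> f)" by blast
  have "inj (f \<circ> p)" "cnt Fwd (f \<circ> p) \<noteq> 0" "\<forall>n\<in>K. cnt (Per n) (f \<circ> p) \<noteq> \<infinity>"
    using inj_comp_permutation[OF insert.prems(1) p(1)] p(2) insert.prems(2,3)
    by (auto simp del: not_infinity_eq)
  from insert.IH[OF this] obtain q where q: "permutation q"
    "\<And>\<tau>. cnt \<tau> (f \<circ> p \<circ> q) = (if \<tau> \<in> Per ` K then 0 else cnt \<tau> (f \<circ> p))" by blast
  have "\<forall>\<tau>. cnt \<tau> (f \<circ> (p \<circ> q)) = (if \<tau> \<in> Per ` insert n K then 0 else cnt \<tau> f)"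
    using q(2) p(2) by (auto simp: comp_assoc)
  then show ?case using permutation_compose[OF p(1) q(1)] by blast
qed

text \<open>Both maps have a forward cycle. At each of the finitely many lengths in \<open>K\<close>
  where the counts differ, both counts are finite, so all cycles of these lengths can be merged away
  on either side; the remaining counts agree.\<close>

lemma approx_fin_common:
  assumes inj: "inj f" "inj g" and appr: "approx_fin f g" and "cnt Fwd f \<noteq> 0"
  shows "\<exists>p q. permutation p \<and> permutation q \<and> (\<forall>\<tau>. cnt \<tau> (f \<circ> p) = cnt \<tau> (g \<circ> q))"
proof -
  define K where "K = {n. 0 < n \<and> C n f \<noteq> C n g}"
  have K: "finite K" "cnt Fwd g \<noteq> 0" "\<forall>n\<in>K. cnt (Per n) f \<noteq> \<infinity>" "\<forall>n\<in>K. cnt (Per n) g \<noteq> \<infinity>"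
    using appr assms(4) unfolding approx_fin_iff K_def C_eq_cnt by auto
  obtain p where p: "permutation p" "\<And>\<tau>. cnt \<tau> (f \<circ> p) = (if \<tau> \<in> Per ` K then 0 else cnt \<tau> f)"
    using remove_all_cycles[OF K(1) inj(1) assms(4) K(3)] by blast
  obtain q where q: "permutation q" "\<And>\<tau>. cnt \<tau> (g \<circ> q) = (if \<tau> \<in> Per ` K then 0 else cnt \<tau> g)"
    using remove_all_cycles[OF K(1) inj(2) K(2,4)] by blast
  have eq: "cnt \<tau> f = cnt \<tau> g" if "\<tau> \<notin> Per ` K" for \<tau>
  proof (cases \<tau>)
    case (Per n)
    show ?thesis
    \<comment> \<open>\<open>K\<close> contains positive lengths only; cycles of length 0 do not
      exist.\<close>
    proof (cases "n = 0")
      case True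
      then show ?thesis using Per by (simp add: cnt_Per_0)
    next
      case False
      then show ?thesis using that Per unfolding K_def C_eq_cnt by auto
    qed
  qed (use appr approx_fin_iff in auto)
  have c: "cnt \<tau> (f \<circ> p) = cnt \<tau> (g \<circ> q)" for \<tau> unfolding p(2) q(2) using eq[of \<tau>] by simp
  then show ?thesis using p(1) q(1) by blast
qed

lemma ecard_ge_2: "2 \<le> ecard A \<Longrightarrow> \<exists>a b. a \<in> A \<and> b \<in> A \<and> a \<noteq> b"
proof (rule ccontr)
  assume 2: "2 \<le> ecard A" and "\<nexists>a b. a \<in> A \<and> b \<in> A \<and> a \<noteq> b"
  then have "\<exists>a. A \<subseteq> {a}" by blast
  then obtain a where "A \<subseteq> {a}" by blast
  then have "finite A" "card A \<le> 1" using finite_subset card_mono[of "{a}" A] by auto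
  then show False using 2 unfolding ecard_def by (simp add: numeral_eq_enat)
qed

text \<open>Here parity gets lost. With infinitely many \<open>n\<close>-cycles, one more can be
  split off a forward cycle unnoticed; with two infinite cycles, their tails can be
  exchanged.\<close>

lemma transpose_keeping_counts:
  assumes inj: "inj f" and fwd: "cnt Fwd f \<noteq> 0" and "2 \<le> C_open f + C_fwd f \<or> (\<exists>n>0. C n f = \<infinity>)"
  shows "\<exists>x y. x \<noteq> y \<and> (\<forall>\<tau>. cnt \<tau> (f \<circ> transpose x y) = cnt \<tau> f)"
  using assms(3)
proof
  assume "\<exists>n>0. C n f = \<infinity>"
  then obtain n where n: "n > 0" "cnt (Per n) f = \<infinity>" unfolding C_eq_cnt by blast
  obtain x where "ctype f (cyc f x) = Fwd" using cnt_nonzero[OF fwd] by blast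
  then have inf: "infinite (cyc f x)" using ctype_infinite by blast
  define y where "y = (f ^^ n) x"
  have eq: "(f ^^ i) x = (f ^^ j) x \<Longrightarrow> i = j" for i j using cyc_infinite_iff[OF inj] inf by blast
  have "(f ^^ i) x \<noteq> y" if "i < n" for i using eq[of i n] that unfolding y_def by auto
  moreover have ne: "x \<noteq> y" using eq[of 0 n] n(1) unfolding y_def by auto
  ultimately have "cnt \<tau> (f \<circ> transpose x y) = cnt \<tau> f + delta (Per n) \<tau>" for \<tau>
    using cnt_split(1)[OF inj n(1) y_def _ _ inf] by blast
  then have "cnt \<tau> (f \<circ> transpose x y) = cnt \<tau> f" for \<tau> using n(2) by (cases "\<tau> = Per n") (auto simp: delta_def)
  then show ?thesis using ne by blast
next
  assume 2: "2 \<le> C_open f + C_fwd f"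
  have "C_open f + C_fwd f = ecard ({S. is_cycle f S \<and> ctype f S = Open} \<union> {S. is_cycle f S \<and> ctype f S = Fwd})"
    unfolding C_open_eq_cnt C_fwd_eq_cnt cnt_def by (rule ecard_Un_disjoint[symmetric]) auto
  then obtain S T where ST: "is_cycle f S" "is_cycle f T" "infinite S" "infinite T" "S \<noteq> T"
    using ecard_ge_2 2 ctype_infinite[of f] by (smt (verit) Un_iff mem_Collect_eq)
  obtain x y where xy: "S = cyc f x" "T = cyc f y" using ST(1,2) unfolding is_cycle_iff by blast
  have y: "y \<notin> cyc f x" using cyc_eq ST(5) xy by metis
  have ne: "x \<noteq> y" using ST(5) xy by blast
  \<comment> \<open>If the points shared a cycle of the composed map, applying the transposition
    again would split off a finite cycle, whereas both cycles of \<open>f\<close> are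
    infinite.\<close>
  have "y \<notin> cyc (f \<circ> transpose x y) x"
    using finite_cycle_comp_transpose[OF inj_comp_transpose[OF inj, of x y] ne] ST(3,4)
    unfolding comp_transpose_twice xy by argo
  then show ?thesis using cnt_swap(1)[OF inj y] ne by blast
qed

section \<open>Normal subgroups of the symmetric group\<close>

lemma inv_comp_eq: "bij p \<Longrightarrow> inv p \<circ> p = id" "bij p \<Longrightarrow> p \<circ> inv p = id"
  using inv_o_cancel bij_is_inj surj_iff bij_is_surj by blast+

lemma funpow_inverse:
  assumes "\<And>x. p (q x) = x"
  shows "(p ^^ (m + n)) ((q ^^ n) x) = (p ^^ m) x"
proof (induction n)
  case (Suc n)
  have "(p ^^ (m + Suc n)) ((q ^^ Suc n) x) = (p ^^ (m + n)) (p (q ((q ^^ n) x)))" by (simp add: funpow_swap1)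
  then show ?case using Suc assms by simp
qed simp

text \<open>Reflect every cycle in a base point.\<close>

lemma bij_conj_inv:
  assumes "bij (p :: 'a \<Rightarrow> 'a)"
  shows "\<exists>r. r \<circ> r = id \<and> r \<circ> p \<circ> r = inv p"
proof -
  define q where "q = inv p"
  have pq: "p (q x) = x" "q (p x) = x" for x
    unfolding q_def using assms by (simp_all add: bij_is_surj surj_f_inv_f bij_is_inj)
  have injs: "inj p" "inj q" using pq by (metis injI)+
  define b where "b z = (SOME y. y \<in> cyc p z)" for z
  have b: "b z \<in> cyc p z" for z unfolding b_def by (rule someI[of _ z]) simp
  have b_eq: "b z = b y" if "cyc p z = cyc p y" for z y unfolding b_def that ..
  have per: "(p ^^ i) x = (p ^^ j) x \<longleftrightarrow> (q ^^ i) x = (q ^^ j) x" for i j x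
  proof
    assume "(p ^^ i) x = (p ^^ j) x"
    then have "(q ^^ (j + i)) ((p ^^ i) x) = (q ^^ (i + j)) ((p ^^ j) x)" by (simp add: add.commute)
    then show "(q ^^ i) x = (q ^^ j) x" using funpow_inverse[of q p] pq(2) by metis
  next
    assume "(q ^^ i) x = (q ^^ j) x"
    then have "(p ^^ (j + i)) ((q ^^ i) x) = (p ^^ (i + j)) ((q ^^ j) x)" by (simp add: add.commute)
    then show "(p ^^ i) x = (p ^^ j) x" using funpow_inverse[of p q] pq(1) by metis
  qed
  \<comment> \<open>A power of \<open>p\<close> at the base point is paired with the same power of
    the inverse. This pairing is symmetric, which is what makes the reflection \<open>r\<close> an
    involution.\<close>
  have ms: "matched p q x x w z \<and> w \<in> cyc p x" if t: "matched p q x x z w" for x z w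
  proof -
    obtain m n where mn: "(p ^^ m) x = (p ^^ n) z" "(q ^^ m) x = (q ^^ n) w"
      using t unfolding matched_def by (elim exE conjE)
    have "(p ^^ n) x = (p ^^ (n + m)) ((q ^^ m) x)" using funpow_inverse[of p q n m x] pq(1) by simp
    also have "\<dots> = (p ^^ (m + n)) ((q ^^ n) w)" using mn(2) by (simp add: add.commute)
    also have "\<dots> = (p ^^ m) w" using funpow_inverse[of p q m n w] pq(1) by simp
    finally have 1: "(p ^^ n) x = (p ^^ m) w" .
    have "(q ^^ n) x = (q ^^ (n + m)) ((p ^^ m) x)" using funpow_inverse[of q p n m x] pq(2) by simp
    also have "\<dots> = (q ^^ (m + n)) ((p ^^ n) z)" using mn(1) by (simp add: add.commute)
    also have "\<dots> = (q ^^ m) z" using funpow_inverse[of q p m n z] pq(2) by simp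
    finally have 2: "(q ^^ n) x = (q ^^ m) z" .
    have "matched p q x x w z" unfolding matched_def using 1 2 by (intro exI conjI)
    then show ?thesis using cycI[OF 1] by (intro conjI)
  qed
  have surj_q: "cyc q x \<subseteq> range q" for x using pq(2) by (metis rangeI subsetI)
  have "\<exists>w. matched p q (b z) (b z) z w" for z
  proof -
    have "z \<in> cyc p (b z)" using b cyc_sym by metis
    from matched_total[OF disjI2[OF surj_q] this injs(1)] show ?thesis by blast
  qed
  then obtain r where r: "\<And>z. matched p q (b z) (b z) z (r z)" by metis
  have uniq: "w = r z" if "matched p q (b z) (b z) z w" for z w
    by (rule matched_unique[OF injs(2) per that r])
  have br: "b (r z) = b z" for z
  proof (rule b_eq)
    have "cyc p (r z) = cyc p (b z)" using ms[OF r[of z]] cyc_eq by metis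
    then show "cyc p (r z) = cyc p z" using cyc_eq[OF b[of z]] by simp
  qed
  have rr: "r (r z) = z" for z
    using uniq[of "r z" z] ms[OF r[of z]] unfolding br by simp
  have bp: "b (p z) = b z" for z
    by (rule b_eq, rule cyc_eq) (use funpow_in_cyc[of 1 p z] in simp)
  have rp: "r (p z) = q (r z)" for z
  proof -
    obtain m n where mn: "(p ^^ m) (b z) = (p ^^ n) z" "(q ^^ m) (b z) = (q ^^ n) (r z)"
      using r[of z] unfolding matched_def by (elim exE conjE)
    have "(p ^^ Suc m) (b z) = (p ^^ n) (p z)" using mn(1) by (simp add: funpow_swap1)
    moreover have "(q ^^ Suc m) (b z) = (q ^^ n) (q (r z))" using mn(2) by (simp add: funpow_swap1)
    ultimately have "matched p q (b z) (b z) (p z) (q (r z))" unfolding matched_def by (intro exI conjI)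
    then show ?thesis using uniq[of "p z" "q (r z)"] unfolding bp by simp
  qed
  have "r \<circ> r = id" using rr by (simp add: fun_eq_iff)
  moreover have "r \<circ> p \<circ> r = inv p" using rp rr unfolding q_def by (simp add: fun_eq_iff)
  ultimately show ?thesis by blast
qed

lemma involution_bij: "r \<circ> r = id \<Longrightarrow> bij r \<and> inv r = r"
  by (metis o_bij inv_unique_comp)

locale normal_perms =
  fixes G :: "('a \<Rightarrow> 'a) set"
  assumes cb: "countable (UNIV :: 'a set)" and infinite_UNIV: "infinite (UNIV :: 'a set)"
    and sub: "G \<subseteq> Sym" and idG: "id \<in> G" and comp: "f \<in> G \<Longrightarrow> g \<in> G \<Longrightarrow> f \<circ> g \<in> G"
    and norm: "normal_set G"
begin

lemma bijG: "f \<in> G \<Longrightarrow> bij f"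
  using sub unfolding Sym_def by blast

lemma conjG: "f \<in> G \<Longrightarrow> bij a \<Longrightarrow> inv a \<circ> f \<circ> a \<in> G"
  using norm unfolding normal_set_def by blast

lemma conjG': "f \<in> G \<Longrightarrow> bij a \<Longrightarrow> d \<circ> a = a \<circ> f \<Longrightarrow> d \<in> G"
proof -
  assume f: "f \<in> G" and a: "bij a" and d: "d \<circ> a = a \<circ> f"
  have "inv (inv a) \<circ> f \<circ> inv a \<in> G" by (rule conjG[OF f bij_imp_bij_inv[OF a]])
  then have "a \<circ> f \<circ> inv a \<in> G" by (simp add: inv_inv_eq[OF a])
  moreover have "a \<circ> f \<circ> inv a = d" unfolding d[symmetric] by (simp add: comp_assoc inv_comp_eq[OF a])
  ultimately show "d \<in> G" by simp
qed

lemma invG: assumes "f \<in> G" shows "inv f \<in> G"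
proof -
  obtain r where r: "r \<circ> r = id" "r \<circ> f \<circ> r = inv f" using bij_conj_inv[OF bijG[OF assms]] by blast
  then show ?thesis using conjG[OF assms, of r] involution_bij[OF r(1)] by simp
qed

lemma transpose_conj: "inj s \<Longrightarrow> s \<circ> transpose a b = transpose (s a) (s b) \<circ> s"
  by (auto simp: fun_eq_iff transpose_def inj_eq)

lemma ex_bij_3:
  fixes a b c x y z :: 'a
  assumes "x \<noteq> y" "x \<noteq> z" "y \<noteq> z" "a \<noteq> b" "a \<noteq> c" "b \<noteq> c"
  shows "\<exists>s. bij s \<and> s a = x \<and> s b = y \<and> s c = z"
proof -
  define s1 where "s1 = transpose a x"
  define s2 where "s2 = transpose (s1 b) y \<circ> s1"
  define s3 where "s3 = transpose (s2 c) z \<circ> s2"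
  have bj: "bij s1" "bij s2" "bij s3" unfolding s1_def s2_def s3_def by (simp_all add: bij_comp)
  have i: "s1 u = s1 v \<longleftrightarrow> u = v" "s2 u = s2 v \<longleftrightarrow> u = v" for u v
    using bj by (simp_all add: bij_is_inj inj_eq)
  have 1: "s1 a = x" unfolding s1_def by simp
  have "s1 b \<noteq> x" using i(1)[of a b] 1 assms by metis
  then have 2: "s2 a = x" "s2 b = y" unfolding s2_def using 1 assms by simp_all
  have "s2 c \<noteq> x" "s2 c \<noteq> y" using i(2)[of c a] i(2)[of c b] 2 assms by metis+
  then have "s3 a = x" "s3 b = y" "s3 c = z" unfolding s3_def using 2 assms by simp_all
  then show ?thesis using bj(3) by blast
qed

text \<open>Take \<open>z\<close> fixed by \<open>p\<close>, which exists because the support is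
  finite. The commutator of \<open>p\<close> with the transposition of \<open>x\<close> and
  \<open>z\<close> is the product of the transpositions of \<open>x, z\<close> and of
  \<open>p x, z\<close>, a 3-cycle; conjugation then yields every other one.\<close>

lemma three_cycles:
  assumes p: "p \<in> G" "finite {x. p x \<noteq> x}" "p \<noteq> id" and abc: "a \<noteq> b" "a \<noteq> c" "b \<noteq> c"
  shows "transpose a c \<circ> transpose b c \<in> G"
proof -
  obtain x where x: "p x \<noteq> x" using p(3) by (auto simp: fun_eq_iff)
  define y where "y = p x"
  have "finite ({x. p x \<noteq> x} \<union> {x, y})" using p(2) by simp
  then obtain z where z: "z \<notin> {x. p x \<noteq> x} \<union> {x, y}" using infinite_UNIV ex_new_if_finite by blast
  let ?t = "transpose x z"
  have bp: "bij p" using bijG[OF p(1)] .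
  have "inv ?t \<circ> p \<circ> ?t \<in> G" by (rule conjG[OF p(1) bij_transpose])
  then have "?t \<circ> p \<circ> ?t \<circ> inv p \<in> G" using comp[OF _ invG[OF p(1)]] by simp
  also have "?t \<circ> p \<circ> ?t \<circ> inv p = ?t \<circ> (p \<circ> ?t) \<circ> inv p" by (simp add: comp_assoc)
  also have "\<dots> = ?t \<circ> transpose y z"
    using z unfolding transpose_conj[OF bij_is_inj[OF bp]] y_def by (simp add: comp_assoc inv_comp_eq[OF bp])
  finally have s: "?t \<circ> transpose y z \<in> G" .
  obtain s where s': "bij s" "s a = x" "s b = y" "s c = z"
    using ex_bij_3[of x y z a b c] abc x z unfolding y_def by auto
  have "s \<circ> (transpose a c \<circ> transpose b c) = (transpose x z \<circ> s) \<circ> transpose b c"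
    using transpose_conj[OF bij_is_inj[OF s'(1)], of a c] s' by (simp add: comp_assoc[symmetric])
  also have "\<dots> = (transpose x z \<circ> transpose y z) \<circ> s"
    using transpose_conj[OF bij_is_inj[OF s'(1)], of b c] s' by (simp add: comp_assoc)
  finally have e: "s \<circ> (transpose a c \<circ> transpose b c) = (transpose x z \<circ> transpose y z) \<circ> s" .
  have "inv s \<circ> (transpose x z \<circ> transpose y z) \<circ> s \<in> G" by (rule conjG[OF s s'(1)])
  also have "inv s \<circ> (transpose x z \<circ> transpose y z) \<circ> s = inv s \<circ> (s \<circ> (transpose a c \<circ> transpose b c))"
    unfolding e by (simp add: comp_assoc)
  also have "\<dots> = transpose a c \<circ> transpose b c"
    unfolding comp_assoc[symmetric] inv_comp_eq(1)[OF s'(1)] by simp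
  finally show ?thesis .
qed

text \<open>Two transpositions with a common point give the identity or a 3-cycle. For disjoint
  ones, insert the transposition of \<open>b\<close> and \<open>c\<close> twice; this leaves two
  products with a common point.\<close>

lemma two_transpositions:
  assumes p: "p \<in> G" "finite {x. p x \<noteq> x}" "p \<noteq> id" and "a \<noteq> b" "c \<noteq> d"
  shows "transpose a b \<circ> transpose c d \<in> G"
proof -
  have share: "transpose u v \<circ> transpose v w \<in> G" if "u \<noteq> v" "v \<noteq> w" for u v w
  proof (cases "u = w")
    case True
    have "transpose u v \<circ> transpose v u = id" by (metis transpose_commute transpose_comp_involutory)
    then show ?thesis using idG True by metis
  next
    case False
    then show ?thesis using three_cycles[OF p, of u w v] that by (simp add: transpose_commute[of v w])
  qed
  show ?thesis
  proof (cases "a = c \<or> a = d \<or> b = c \<or> b = d")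
    case True
    then show ?thesis
      using share[of b a d] share[of b a c] share[of a b d] share[of a b c] assms(4,5)
      by (metis transpose_commute)
  next
    case False
    then have "transpose a b \<circ> transpose b c \<in> G" "transpose b c \<circ> transpose c d \<in> G"
      using share assms(4,5) by metis+
    then have "(transpose a b \<circ> transpose b c) \<circ> (transpose b c \<circ> transpose c d) \<in> G" by (rule comp)
    moreover have "(transpose a b \<circ> transpose b c) \<circ> (transpose b c \<circ> transpose c d) = transpose a b \<circ> transpose c d"
      by (simp add: fun_eq_iff)
    ultimately show ?thesis by simp
  qed
qed

lemma Alt_subset:
  assumes p: "p \<in> G" "finite {x. p x \<noteq> x}" "p \<noteq> id"
  shows "Alt \<subseteq> G"
proof
  \<comment> \<open>Transpositions are consumed in pairs; in the odd case one of them still waits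
    for a partner, hence the quantified transposition.\<close>
  have *: "(even n \<longrightarrow> q \<in> G) \<and> (odd n \<longrightarrow> (\<forall>a b. a \<noteq> b \<longrightarrow> transpose a b \<circ> q \<in> G))" if "swapidseq n q" for n q
    using that
  proof induction
    case id
    show ?case using idG even_zero by blast
  next
    case (comp_Suc n q a b)
    have "transpose c d \<circ> (transpose a b \<circ> q) \<in> G" if "q \<in> G" "c \<noteq> d" for c d
      using comp[OF two_transpositions[OF p that(2) comp_Suc.hyps(2)] that(1)] by (simp add: comp_assoc)
    then show ?case using comp_Suc.IH comp_Suc.hyps(2) even_Suc[of n] by blast
  qed
  fix q :: "'a \<Rightarrow> 'a" assume q: "q \<in> Alt"
  then have "permutation q" unfolding Alt_def permutation by simp
  then obtain n where n: "swapidseq n q" unfolding permutation_def by blast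
  moreover have "even n" using evenperm_unique[OF n refl] q unfolding Alt_def by simp
  ultimately show "q \<in> G" using * by blast
qed

text \<open>\<open>Alt\<close> has index two in \<open>Fin\<close>: a single odd member
  \<open>o'\<close> of \<open>G\<close> turns any odd finitary permutation into an even one.\<close>

lemma finitary_cases:
  assumes "G \<subseteq> Fin"
  shows "G \<in> {{id}, Alt, Fin}"
proof (cases "G = {id}")
  case False
  then obtain p where p: "p \<in> G" "p \<noteq> id" using idG by blast
  have fin: "finite {x. q x \<noteq> x}" "permutation q" if "q \<in> G" for q
    using assms that unfolding Fin_def permutation by blast+
  have A: "Alt \<subseteq> G" by (rule Alt_subset[OF p(1) fin(1)[OF p(1)] p(2)])
  show ?thesis
  proof (cases "G \<subseteq> Alt")
    case True then show ?thesis using A by blast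
  next
    case False
    then obtain o' where o': "o' \<in> G" "\<not> evenperm o'" using assms unfolding Alt_def Fin_def by blast
    have "q \<in> G" if "q \<in> Fin" for q
    proof (cases "evenperm q")
      case True then show ?thesis using that A unfolding Fin_def Alt_def by blast
    next
      case False
      have pq: "permutation q" using that unfolding Fin_def permutation by simp
      have po: "permutation (inv o')" by (rule permutation_inverse[OF fin(2)[OF o'(1)]])
      have "evenperm (inv o' \<circ> q)"
        using evenperm_comp[OF po pq] evenperm_inv[OF fin(2)[OF o'(1)]] False o'(2) by simp
      moreover have "permutation (inv o' \<circ> q)" by (rule permutation_compose[OF po pq])
      ultimately have "inv o' \<circ> q \<in> G" using A unfolding Alt_def permutation by blast
      then have "o' \<circ> (inv o' \<circ> q) \<in> G" using comp[OF o'(1)] by blast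
      then show ?thesis using inv_comp_eq(2)[OF bijG[OF o'(1)]] by (simp add: comp_assoc[symmetric])
    qed
    then show ?thesis using assms by blast
  qed
qed simp

section \<open>Permutations of infinite support\<close>

text \<open>These involutions form a single conjugacy class, with infinitely many cycles of each of
  the lengths 1 and 2. So one of them in \<open>G\<close> brings in all.\<close>

definition big_involution :: "('a \<Rightarrow> 'a) \<Rightarrow> bool" where
  "big_involution w \<longleftrightarrow> w \<circ> w = id \<and> infinite {x. w x \<noteq> x} \<and> infinite {x. w x = x}"

lemma big_involution_cnt:
  assumes "big_involution w"
  shows "cnt \<tau> w = (if \<tau> = Per 1 \<or> \<tau> = Per 2 then \<infinity> else 0)"
proof -
  have ww: "w (w x) = x" for x using assms unfolding big_involution_def by (metis comp_apply id_apply)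
  have inj: "inj w" using ww by (metis injI)
  have cyc: "cyc w x = {x, w x}" for x
    using cyc_periodic[OF inj, of 2 x] ww by (simp add: numeral_2_eq_2 lessThan_Suc insert_commute)
  have ct: "ctype w (cyc w x) = (if w x = x then Per 1 else Per 2)" for x
  proof (cases "w x = x")
    case False
    then have "x \<noteq> w x" by metis
    then show ?thesis using False unfolding ctype_def cyc by simp
  qed (simp add: ctype_def cyc)
  have inf: "cnt (Per n) w = \<infinity>" if "infinite {x. ctype w (cyc w x) = Per n}" for n
  proof -
    let ?A = "{S. is_cycle w S \<and> ctype w S = Per n}"
    have "{x. ctype w (cyc w x) = Per n} \<subseteq> \<Union> ?A"
    proof
      fix x assume "x \<in> {x. ctype w (cyc w x) = Per n}"
      then have "cyc w x \<in> ?A" by simp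
      then show "x \<in> \<Union> ?A" using cyc_refl by (rule UnionI)
    qed
    then have U: "infinite (\<Union> ?A)" using that finite_subset by blast
    have "finite S" if "S \<in> ?A" for S using ctype_Per[of w S n] that by simp
    then have "infinite ?A" using U finite_Union by metis
    then show ?thesis unfolding cnt_def ecard_def by simp
  qed
  have "{x. ctype w (cyc w x) = Per 1} = {x. w x = x}" "{x. ctype w (cyc w x) = Per 2} = {x. w x \<noteq> x}"
    unfolding ct by auto
  then have "cnt (Per 1) w = \<infinity>" "cnt (Per 2) w = \<infinity>"
    using inf assms unfolding big_involution_def by simp_all
  moreover have "cnt \<tau> w = 0" if "\<tau> \<noteq> Per 1" "\<tau> \<noteq> Per 2"
    using cnt_nonzero[of \<tau> w] that unfolding ct by metis
  ultimately show ?thesis by auto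
qed

lemma big_involution_conj:
  assumes "big_involution w" "w \<in> G" "big_involution w'"
  shows "w' \<in> G"
proof -
  have "inj w" "inj w'" using assms involution_bij bij_is_inj unfolding big_involution_def by blast+
  then obtain d where d: "bij d" "d \<circ> w = w' \<circ> d"
    using conjugate_if_cnt_eq[OF cb, of w w'] big_involution_cnt[OF assms(1)] big_involution_cnt[OF assms(3)] by auto
  show ?thesis by (rule conjG'[OF assms(2) d(1) d(2)[symmetric]])
qed

text \<open>Greedy choice: the earlier terms exclude finitely many points, while \<open>p\<close>
  moves infinitely many. An involution supported on the range of \<open>e\<close> and its conjugate
  by \<open>p\<close> then have disjoint supports.\<close>

lemma spread_sequence:
  assumes "inj p" "infinite {x. p x \<noteq> (x :: 'a)}"
  shows "\<exists>e :: nat \<Rightarrow> 'a. inj e \<and> (\<forall>i j. e i \<noteq> p (e j))"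
proof -
  have "\<exists>e :: nat \<Rightarrow> 'a. \<forall>n. p (e n) \<noteq> e n \<and> (\<forall>i<n. e n \<noteq> e i \<and> e n \<noteq> p (e i) \<and> p (e n) \<noteq> e i)"
  proof (rule dependent_wellorder_choice)
    fix n :: nat and e :: "nat \<Rightarrow> 'a"
    define B where "B = e ` {..<n} \<union> p ` e ` {..<n} \<union> p -` (e ` {..<n})"
    have "finite B" unfolding B_def using finite_vimageI[OF _ assms(1)] by simp
    then have "\<not> {x. p x \<noteq> x} \<subseteq> B" using assms(2) finite_subset by blast
    then obtain x where "p x \<noteq> x" "x \<notin> B" by blast
    then show "\<exists>x. p x \<noteq> x \<and> (\<forall>i<n. x \<noteq> e i \<and> x \<noteq> p (e i) \<and> p x \<noteq> e i)"
      unfolding B_def by (intro exI[of _ x]) auto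
  qed auto
  then obtain e :: "nat \<Rightarrow> 'a" where e: "\<And>n. p (e n) \<noteq> e n"
    "\<And>i n. i < n \<Longrightarrow> e n \<noteq> e i \<and> e n \<noteq> p (e i) \<and> p (e n) \<noteq> e i" by blast
  have "inj e" using e(2) by (intro injI) (metis linorder_neqE_nat)
  moreover have "e i \<noteq> p (e j)" for i j using e(1)[of i] e(2)[of i j] e(2)[of j i] by (metis linorder_neqE_nat)
  ultimately show ?thesis by blast
qed

text \<open>Along \<open>e\<close>, the terms \<open>3 * k\<close> and \<open>3 * k + 1\<close> are
  exchanged; leaving \<open>3 * k + 2\<close> in place provides infinitely many fixed points inside
  the range of \<open>e\<close>.\<close>

definition swap3 :: "(nat \<Rightarrow> 'a) \<Rightarrow> 'a \<Rightarrow> 'a" where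
  "swap3 e x = (if x \<in> range e then
     (let n = inv e x in e (if n mod 3 = 0 then n + 1 else if n mod 3 = 1 then n - 1 else n)) else x)"

lemma swap3:
  assumes "inj e"
  shows "swap3 e \<circ> swap3 e = id" "swap3 e (e (3 * n)) \<noteq> e (3 * n)" "swap3 e (e (3 * n + 2)) = e (3 * n + 2)"
    "x \<in> range e \<Longrightarrow> swap3 e x \<in> range e" "x \<notin> range e \<Longrightarrow> swap3 e x = x"
proof -
  let ?s = "\<lambda>n :: nat. if n mod 3 = 0 then n + 1 else if n mod 3 = 1 then n - 1 else n"
  have E: "swap3 e (e n) = e (?s n)" for n
    unfolding swap3_def Let_def using assms by (simp only: inv_f_f rangeI if_True)
  have "?s (?s n) = n" for n
  proof -
    define k where "k = n div 3"
    have "n = 3 * k \<or> n = Suc (3 * k) \<or> n = Suc (Suc (3 * k))" unfolding k_def by presburger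
    moreover have "Suc (3 * k) mod 3 = 1" "Suc (Suc (3 * k)) mod 3 = 2" by presburger+
    ultimately show ?thesis by (elim disjE) simp_all
  qed
  then have "swap3 e (swap3 e (e n)) = e n" for n unfolding E by simp
  moreover show N: "x \<notin> range e \<Longrightarrow> swap3 e x = x" for x unfolding swap3_def by simp
  ultimately show "swap3 e \<circ> swap3 e = id" by (auto simp: fun_eq_iff) (metis rangeE)
  show "swap3 e (e (3 * n)) \<noteq> e (3 * n)" unfolding E using assms by (simp add: inj_eq)
  show "swap3 e (e (3 * n + 2)) = e (3 * n + 2)"
  proof -
    have "(3 * n + 2) mod 3 = 2" by presburger
    then show ?thesis unfolding E by simp
  qed
  show "swap3 e x \<in> range e" if x: "x \<in> range e"
  proof -
    obtain n where "x = e n" using x by blast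
    then show ?thesis using E[of n] by (simp only: rangeI)
  qed
qed

lemma infinite_if_sequence:
  assumes "inj (e :: nat \<Rightarrow> 'a)" "k > 0" "\<And>n. e (k * n + l) \<in> A"
  shows "infinite A"
proof -
  have "inj (\<lambda>n. e (k * n + l))" using assms(2) by (intro injI) (simp add: inj_eq[OF assms(1)])
  then have "infinite (range (\<lambda>n. e (k * n + l)))" using finite_imageD by auto
  then show ?thesis using assms(3) finite_subset[of "range (\<lambda>n. e (k * n + l))" A] by blast
qed

lemma commuting_involutions:
  assumes "s \<circ> s = id" "t \<circ> t = id" "\<And>x. x \<in> A \<Longrightarrow> s x \<in> A" "\<And>x. x \<notin> A \<Longrightarrow> s x = x"
    "\<And>x. x \<in> A \<Longrightarrow> t x = x" "\<And>x. x \<notin> A \<Longrightarrow> t x \<notin> A"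
  shows "(s \<circ> t) \<circ> (s \<circ> t) = id"
proof
  fix x
  have "s (s x) = x" "t (t x) = x" using assms(1,2) by (metis comp_apply id_apply)+
  then show "((s \<circ> t) \<circ> (s \<circ> t)) x = id x" using assms(3-6)[of x] assms(4,6)[of "t x"] assms(5)[of "s x"]
    by (cases "x \<in> A") simp_all
qed

text \<open>The commutator of \<open>p\<close> with an involution on a sequence that
  \<open>p\<close> moves off itself is the product of that involution and its conjugate
  \<open>t'\<close>. Their supports are disjoint, so the product is again an involution, and it
  still fixes the terms \<open>e (3 * n + 2)\<close>.\<close>

lemma ex_big_involution:
  assumes p: "p \<in> G" "infinite {x. p x \<noteq> x}"
  shows "\<exists>w\<in>G. big_involution w"
proof -
  have bp: "bij p" using bijG[OF p(1)] .
  obtain e :: "nat \<Rightarrow> 'a" where e: "inj e" "\<And>i j. e i \<noteq> p (e j)" using spread_sequence[OF bij_is_inj[OF bp] p(2)] by blast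
  let ?t = "swap3 e"
  note t = swap3[OF e(1)]
  define t' where "t' = p \<circ> ?t \<circ> inv p"
  have pi: "inv p (p x) = x" "p (inv p x) = x" for x using bp by (simp_all add: bij_is_inj bij_is_surj surj_f_inv_f)
  have tt: "?t (?t x) = x" for x using t(1) by (metis comp_apply id_apply)
  have "t' \<circ> t' = id" unfolding t'_def by (simp add: fun_eq_iff pi tt)
  moreover have fix1: "t' x = x" if "x \<in> range e" for x
  proof -
    have "inv p x \<notin> range e" using that e(2) pi(2) by (metis rangeE)
    then show ?thesis unfolding t'_def using t(5) pi(2) by simp
  qed
  moreover have "t' x \<notin> range e" if "x \<notin> range e" for x
  proof
    assume "t' x \<in> range e"
    then have "t' (t' x) = t' x" by (rule fix1)
    then have "t' x = x" using \<open>t' \<circ> t' = id\<close> by (metis comp_apply id_apply)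
    then show False using \<open>t' x \<in> range e\<close> that by simp
  qed
  ultimately have "(?t \<circ> t') \<circ> (?t \<circ> t') = id" using t by (intro commuting_involutions[where A = "range e"]) auto
  moreover have "infinite {x. (?t \<circ> t') x \<noteq> x}"
    by (rule infinite_if_sequence[OF e(1), of 3 0]) (use t(2) fix1 in auto)
  moreover have "infinite {x. (?t \<circ> t') x = x}"
    by (rule infinite_if_sequence[OF e(1), of 3 2]) (use t(3) fix1 in auto)
  ultimately have "big_involution (?t \<circ> t')" unfolding big_involution_def by blast
  moreover have "?t \<circ> t' \<in> G"
  proof -
    have "inv ?t \<circ> p \<circ> ?t \<in> G" using conjG[OF p(1)] involution_bij[OF t(1)] by blast
    then have "?t \<circ> p \<circ> ?t \<circ> inv p \<in> G" using comp[OF _ invG[OF p(1)]] involution_bij[OF t(1)] by simp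
    then show ?thesis unfolding t'_def by (simp add: comp_assoc)
  qed
  ultimately show ?thesis by blast
qed

text \<open>If \<open>s\<close> has finite support, choose a big involution \<open>t\<close> on
  points fixed by \<open>s\<close>; then \<open>t\<close> and \<open>t \<circ> s\<close> are both
  big, and their product is \<open>s\<close>. If the support is infinite, \<open>s\<close> is cut
  into two big involutions with disjoint supports.\<close>

lemma involution_mem:
  assumes big: "\<And>w. big_involution w \<Longrightarrow> w \<in> G" and s: "s \<circ> s = id"
  shows "s \<in> G"
proof (cases "finite {x. s x \<noteq> x}")
  case True
  have ss: "s (s x) = x" for x using s by (metis comp_apply id_apply)
  have "infinite {x. s x = x}"
  proof
    assume "finite {x. s x = x}"
    then have "finite ({x. s x = x} \<union> {x. s x \<noteq> x})" using True by simp
    moreover have "{x. s x = x} \<union> {x. s x \<noteq> x} = UNIV" by blast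
    ultimately show False using infinite_UNIV by simp
  qed
  then obtain e :: "nat \<Rightarrow> 'a" where e: "inj e" "range e \<subseteq> {x. s x = x}" using infinite_countable_subset by blast
  let ?t = "swap3 e"
  note t = swap3[OF e(1)]
  have se: "s x = x" if "x \<in> range e" for x using e(2) that by blast
  have "(?t \<circ> s) \<circ> (?t \<circ> s) = id"
  proof (rule commuting_involutions[where A = "range e"])
    show "s x \<notin> range e" if "x \<notin> range e" for x using se[of "s x"] ss[of x] that by metis
  qed (use t s se in auto)
  moreover have "infinite {x. (?t \<circ> s) x \<noteq> x}"
    by (rule infinite_if_sequence[OF e(1), of 3 0]) (use t(2) se in auto)
  moreover have "infinite {x. (?t \<circ> s) x = x}"
    by (rule infinite_if_sequence[OF e(1), of 3 2]) (use t(3) se in auto)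
  ultimately have "?t \<circ> s \<in> G" using big unfolding big_involution_def by blast
  moreover have "infinite {x. ?t x \<noteq> x}" by (rule infinite_if_sequence[OF e(1), of 3 0]) (use t(2) in auto)
  moreover have "infinite {x. ?t x = x}" by (rule infinite_if_sequence[OF e(1), of 3 2]) (use t(3) in auto)
  ultimately have "?t \<circ> (?t \<circ> s) \<in> G" using big[of ?t] t(1) comp unfolding big_involution_def by blast
  then show ?thesis using t(1) by (simp add: comp_assoc[symmetric])
next
  case False
  have ss: "s (s x) = x" for x using s by (metis comp_apply id_apply)
  have "inj s" using ss by (metis injI)
  then obtain e :: "nat \<Rightarrow> 'a" where e: "inj e" "\<And>i j. e i \<noteq> s (e j)" using spread_sequence[OF _ False] by blast
  \<comment> \<open>The 2-cycles through the even terms go into \<open>A\<close>. The odd terms stay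
    outside by the choice of \<open>e\<close>, so infinitely many moved points remain on either
    side.\<close>
  define A where "A = (\<Union>k. {e (2 * k), s (e (2 * k))})"
  have sA: "s x \<in> A" if "x \<in> A" for x using that ss unfolding A_def by auto
  have sA': "s x \<notin> A" if "x \<notin> A" for x using that sA[of "s x"] ss by auto
  have odd: "e (2 * k + 1) \<notin> A" for k
  proof
    assume "e (2 * k + 1) \<in> A"
    then obtain j where "e (2 * k + 1) = e (2 * j)" using e(2) unfolding A_def by blast
    then have "2 * k + 1 = 2 * j" using e(1) by (simp add: inj_eq)
    then show False by presburger
  qed
  have even: "e (2 * k) \<in> A" for k unfolding A_def by blast
  have mv: "s (e k) \<noteq> e k" for k using e(2)[of k k] by simp
  define s1 where "s1 x = (if x \<in> A then s x else x)" for x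
  define s2 where "s2 x = (if x \<in> A then x else s x)" for x
  have "s1 \<circ> s1 = id" "s2 \<circ> s2 = id" using sA sA' ss by (simp_all add: fun_eq_iff s1_def s2_def)
  moreover have "infinite {x. s1 x \<noteq> x}" "infinite {x. s2 x = x}"
    by (rule infinite_if_sequence[OF e(1), of 2 0]; use even mv in \<open>simp add: s1_def s2_def\<close>)+
  moreover have "infinite {x. s2 x \<noteq> x}" "infinite {x. s1 x = x}"
    by (rule infinite_if_sequence[OF e(1), of 2 1]; use odd mv in \<open>simp add: s1_def s2_def\<close>)+
  ultimately have "s1 \<circ> s2 \<in> G" using big comp unfolding big_involution_def by blast
  moreover have "s1 \<circ> s2 = s" using sA' by (simp add: fun_eq_iff s1_def s2_def)
  ultimately show ?thesis by simp
qed

text \<open>With an involution \<open>r\<close> that conjugates \<open>q\<close> to its inverse,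
  \<open>q \<circ> r\<close> is an involution too, and \<open>q\<close> is the product of the
  two.\<close>

lemma all_perms:
  assumes p: "p \<in> G" "infinite {x. p x \<noteq> x}"
  shows "G = Sym"
proof -
  obtain w where w: "w \<in> G" "big_involution w" using ex_big_involution[OF p] by blast
  have big: "v \<in> G" if "big_involution v" for v by (rule big_involution_conj[OF w(2,1) that])
  have mem: "s \<in> G" if "s \<circ> s = id" for s by (rule involution_mem[OF big that])
  have "q \<in> G" if bq: "bij q" for q
  proof -
    obtain r where r: "r \<circ> r = id" "r \<circ> q \<circ> r = inv q" using bij_conj_inv[OF bq] by blast
    have "(q \<circ> r) \<circ> (q \<circ> r) = q \<circ> (r \<circ> q \<circ> r)" by (simp add: comp_assoc)
    also have "\<dots> = id" unfolding r(2) by (rule inv_comp_eq(2)[OF bq])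
    finally have "q \<circ> r \<in> G" by (rule mem)
    then have "(q \<circ> r) \<circ> r \<in> G" using comp mem[OF r(1)] by blast
    then show ?thesis using r(1) by (simp add: comp_assoc)
  qed
  then show ?thesis using sub unfolding Sym_def by blast
qed

theorem normal_perms_cases: "G \<in> {{id}, Alt, Fin, Sym}"
proof (cases "G \<subseteq> Fin")
  case True then show ?thesis using finitary_cases by blast
next
  case False
  then obtain p where "p \<in> G" "infinite {x. p x \<noteq> x}" using bijG unfolding Fin_def by blast
  then have "G = Sym" by (rule all_perms)
  then show ?thesis by blast
qed

end

section \<open>Normal submonoids\<close>

lemma generated_submonoid_iff: "x \<in> generated_submonoid S \<longleftrightarrow> (\<forall>T. S \<subseteq> T \<longrightarrow> add_submonoid T \<longrightarrow> x \<in> T)"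
  unfolding generated_submonoid_def by blast

lemma generated_submonoid_eqI:
  assumes "add_submonoid N" "S \<subseteq> N" "\<And>T x. S \<subseteq> T \<Longrightarrow> add_submonoid T \<Longrightarrow> x \<in> N \<Longrightarrow> x \<in> T"
  shows "generated_submonoid S = N"
  using assms unfolding generated_submonoid_def by blast

lemma Gn_subset: "add_submonoid N \<Longrightarrow> Gn N \<subseteq> N"
  unfolding Gn_def using generated_submonoid_eqI[of N N] by blast

text \<open>If every submonoid containing the rest of \<open>N\<close> contains \<open>d\<close>,
  then \<open>N - {d}\<close> is a generating set that avoids \<open>d\<close>.\<close>

lemma not_Gn:
  assumes "add_submonoid N" "\<And>T. N - {d} \<subseteq> T \<Longrightarrow> add_submonoid T \<Longrightarrow> d \<in> T"
  shows "d \<notin> Gn N"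
proof -
  have "generated_submonoid (N - {d}) = N"
    using assms by (intro generated_submonoid_eqI) blast+
  then show ?thesis unfolding Gn_def by blast
qed

lemma zero_not_Gn: "add_submonoid N \<Longrightarrow> 0 \<notin> Gn N"
  by (rule not_Gn) (auto simp: add_submonoid_def)

lemma sum_not_Gn:
  assumes "add_submonoid N" "x \<in> N" "y \<in> N" "x \<noteq> 0" "y \<noteq> 0"
  shows "x + y \<notin> Gn N"
proof (rule not_Gn[OF assms(1)])
  fix T assume "N - {x + y} \<subseteq> T" "add_submonoid T"
  moreover have "x \<noteq> x + y" "y \<noteq> x + y" using assms(4,5) by simp_all
  ultimately show "x + y \<in> T" using assms(2,3) unfolding add_submonoid_def by blast
qed

text \<open>If \<open>d\<close> were no sum of two nonzero elements, \<open>N - {d}\<close> would be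
  a submonoid, and a subset of \<open>N\<close> avoiding \<open>d\<close> could not generate
  \<open>d\<close>.\<close>

lemma not_Gn_decomp:
  assumes "add_submonoid N" "d \<in> N" "d \<noteq> 0" "d \<notin> Gn N"
  shows "\<exists>x\<in>N. \<exists>y\<in>N. x \<noteq> 0 \<and> y \<noteq> 0 \<and> d = x + y"
proof (rule ccontr)
  assume no: "\<not> ?thesis"
  obtain S where S: "S \<subseteq> N" "generated_submonoid S = N" "d \<notin> S" using assms(4) unfolding Gn_def by blast
  have "add_submonoid (N - {d})"
    using assms(1,3) no unfolding add_submonoid_def by (metis DiffE DiffI add_0 add_0_right insert_iff singletonD)
  moreover have "S \<subseteq> N - {d}" using S by blast
  ultimately have "d \<in> N - {d}" using S(2) assms(2) generated_submonoid_iff[of d S] by blast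
  then show False by blast
qed

section \<open>Defects and products\<close>

lemma ecard_image: "inj_on f A \<Longrightarrow> ecard (f ` A) = ecard A"
  using ecard_bij_betw[of f A "f ` A"] by (simp add: bij_betw_def)

text \<open>The composite misses the \<open>g\<close>-images of the points missed by
  \<open>f\<close> and, disjoint from these, the points missed by \<open>g\<close>.\<close>

lemma defect_comp:
  assumes "inj g"
  shows "defect (g \<circ> f) = defect f + defect g"
proof -
  have "- range (g \<circ> f) = g ` (- range f) \<union> - range g" using assms by (auto simp: inj_def)
  moreover have "g ` (- range f) \<inter> - range g = {}" by blast
  moreover have "inj_on g (- range f)" using assms inj_on_subset by blast
  ultimately show ?thesis unfolding defect_eq_ecard using ecard_Un_disjoint ecard_image by metis
qed

lemma defect_eq_0: "defect f = 0 \<longleftrightarrow> surj f"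
  unfolding defect_eq_ecard ecard_def by (auto simp: zero_enat_def)

lemma defect_bij: "bij (a :: 'a \<Rightarrow> 'a) \<Longrightarrow> defect a = 0"
  using defect_eq_0 bij_is_surj by blast

lemma defect_conj:
  fixes f a :: "'a \<Rightarrow> 'a"
  assumes "inj f" "bij a"
  shows "defect (inv a \<circ> f \<circ> a) = defect f"
proof -
  have b: "bij (inv a)" using assms(2) by (rule bij_imp_bij_inv)
  have "defect (inv a \<circ> f \<circ> a) = defect a + (defect f + defect (inv a))"
    using defect_comp[of "inv a \<circ> f" a] defect_comp[of "inv a" f] inj_compose[OF bij_is_inj[OF b] assms(1)] bij_is_inj[OF b] by simp
  then show ?thesis using defect_bij[OF assms(2)] defect_bij[OF b] by simp
qed

lemma inj_conj: "inj f \<Longrightarrow> bij a \<Longrightarrow> inj (inv a \<circ> f \<circ> a)"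
  by (intro inj_compose) (simp_all add: bij_is_inj bij_imp_bij_inv)

lemma bij_conj: "bij f \<Longrightarrow> bij a \<Longrightarrow> bij (inv a \<circ> f \<circ> a)"
  by (intro bij_comp) (simp_all add: bij_imp_bij_inv)

text \<open>On the range of \<open>f\<close> the permutation is forced; off the range, any bijection
  between the missed points will do.\<close>

lemma ex_bij_comp_eq:
  fixes f g :: "'a \<Rightarrow> 'a"
  assumes "countable (UNIV :: 'a set)" and inj: "inj f" "inj g" and "defect f = defect g"
  shows "\<exists>b. bij b \<and> g = b \<circ> f"
proof -
  have cA: "countable A" for A :: "'a set" by (rule countable_subset[OF subset_UNIV assms(1)])
  have "ecard (- range f) = ecard (- range g)" using assms(4) unfolding defect_eq_ecard .
  from ecard_eq_bij_betw[OF this cA cA] obtain c where c: "bij_betw c (- range f) (- range g)" by blast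
  define b where "b x = (if x \<in> range f then g (inv f x) else c x)" for x
  have bf: "b (f x) = g x" for x unfolding b_def using inj(1) by simp
  have bc: "b x = c x" if "x \<notin> range f" for x unfolding b_def using that by simp
  have "bij_betw b (range f) (range g)"
    unfolding bij_betw_def
  proof
    show "inj_on b (range f)" by (rule inj_onI) (use bf inj(2) in \<open>auto simp: inj_eq\<close>)
    show "b ` range f = range g" using bf by (simp add: image_image)
  qed
  moreover have "bij_betw b (- range f) (- range g)"
    using c bij_betw_cong[of "- range f" b c] bc by simp
  ultimately have "bij_betw b (range f \<union> - range f) (range g \<union> - range g)"
    by (rule bij_betw_combine) blast
  then have "bij b" by simp
  moreover have "g = b \<circ> f" using bf by (simp add: fun_eq_iff)
  ultimately show ?thesis by blast
qed

text \<open>Additivity of the defect lets the points missed by \<open>h\<close> be divided into a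
  copy of those missed by \<open>f\<close> and a copy of those missed by \<open>g\<close>, as
  \<open>factoring\<close> demands; the sum type keeps the two copies apart even if the originals
  overlap.\<close>

theorem product_of_conjugates:
  fixes f g h :: "'a \<Rightarrow> 'a"
  assumes cb: "countable (UNIV :: 'a set)" and inj: "inj f" "inj g" "inj h"
    and pos: "defect f \<noteq> 0" "defect g \<noteq> 0" and add: "defect h = defect f + defect g"
  shows "\<exists>p q. bij p \<and> bij q \<and> h = (inv q \<circ> g \<circ> q) \<circ> (inv p \<circ> f \<circ> p)"
proof -
  let ?A = "Inl ` (- range f) :: ('a + 'a) set" and ?B = "Inr ` (- range g) :: ('a + 'a) set"
  have cbl: "countable A" for A :: "'a set" by (rule countable_subset[OF subset_UNIV cb])
  have "ecard (?A \<union> ?B) = defect f + defect g"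
    unfolding defect_eq_ecard by (subst ecard_Un_disjoint) (auto simp: ecard_image)
  then have e: "ecard (?A \<union> ?B) = ecard (- range h)" using add unfolding defect_eq_ecard by simp
  have "countable (?A \<union> ?B)" using cbl by simp
  from ecard_eq_bij_betw[OF e this cbl] obtain c where c: "bij_betw c (?A \<union> ?B) (- range h)" by blast
  have cinj: "inj_on c (?A \<union> ?B)" and cim: "c ` (?A \<union> ?B) = - range h" using c unfolding bij_betw_def by blast+
  interpret factoring g "c \<circ> Inr" f h "c \<circ> Inl"
  proof
    show "inj f" "inj g" "inj h" by (fact inj)+
    show "inj_on (c \<circ> Inl) (- range f)" "inj_on (c \<circ> Inr) (- range g)"
      using cinj by (auto intro!: comp_inj_on inj_on_subset[OF cinj])
    show "(c \<circ> Inl) ` (- range f) \<inter> (c \<circ> Inr) ` (- range g) = {}"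
      using inj_on_image_Int[OF cinj, of ?A ?B] by (simp add: image_comp[symmetric]) blast
    show "(c \<circ> Inl) ` (- range f) \<union> (c \<circ> Inr) ` (- range g) = - range h"
      using cim by (simp add: image_Un image_comp)
    show "range f \<noteq> UNIV" "range g \<noteq> UNIV" using pos defect_eq_0 by blast+
  qed
  show ?thesis by (rule conjugates_exist[OF cb])
qed

text \<open>Conjugates of transpositions are transpositions, so the number of factors is preserved
  and with it the parity.\<close>

lemma swapidseq_conj:
  assumes "swapidseq n p" "bij a"
  shows "swapidseq n (inv a \<circ> p \<circ> a)"
  using assms(1)
proof induction
  case id
  have "inv a \<circ> (\<lambda>x. x) \<circ> a = id" using inv_comp_eq(1)[OF assms(2)] by (simp add: fun_eq_iff)
  then have "inv a \<circ> id \<circ> a = id" using inv_comp_eq(1)[OF assms(2)] by simp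
  then show ?case using swapidseq.id by metis
next
  case (comp_Suc n p x y)
  have i: "inj (inv a)" using assms(2) by (simp add: bij_is_inj bij_imp_bij_inv)
  have "inv a \<circ> (transpose x y \<circ> p) \<circ> a = (inv a \<circ> transpose x y) \<circ> (p \<circ> a)" by (simp only: comp_assoc)
  also have "inv a \<circ> transpose x y = transpose (inv a x) (inv a y) \<circ> inv a"
    using i by (auto simp: fun_eq_iff transpose_def inj_eq)
  finally have "inv a \<circ> (transpose x y \<circ> p) \<circ> a = transpose (inv a x) (inv a y) \<circ> (inv a \<circ> p \<circ> a)"
    by (simp only: comp_assoc)
  moreover have "inv a x \<noteq> inv a y" using i comp_Suc.hyps(2) by (simp add: inj_eq)
  ultimately show ?case using swapidseq.comp_Suc[OF comp_Suc.IH] by metis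
qed

lemma Fin_iff: "p \<in> Fin \<longleftrightarrow> permutation p"
  unfolding Fin_def permutation by simp

lemma Alt_iff: "p \<in> Alt \<longleftrightarrow> permutation p \<and> evenperm p"
  unfolding Alt_def permutation by auto

lemma permutation_conj:
  assumes "permutation p" "bij a"
  shows "permutation (inv a \<circ> p \<circ> a)" "evenperm (inv a \<circ> p \<circ> a) = evenperm p"
proof -
  obtain n where n: "swapidseq n p" using assms(1) unfolding permutation_def by blast
  note c = swapidseq_conj[OF n assms(2)]
  show "permutation (inv a \<circ> p \<circ> a)" using c unfolding permutation_def by blast
  show "evenperm (inv a \<circ> p \<circ> a) = evenperm p"
    using evenperm_unique[OF n refl] evenperm_unique[OF c refl] by simp
qed

lemma perm_set_closed:
  fixes P :: "('a \<Rightarrow> 'a) set"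
  assumes "P \<in> {{id}, Alt, Fin, Sym}"
  shows "id \<in> P" "f \<in> P \<Longrightarrow> g \<in> P \<Longrightarrow> f \<circ> g \<in> P" "f \<in> P \<Longrightarrow> bij a \<Longrightarrow> inv a \<circ> f \<circ> a \<in> P"
proof -
  consider "P = {id}" | "P = Alt" | "P = Fin" | "P = Sym" using assms by blast
  then have "id \<in> P \<and> (\<forall>f\<in>P. \<forall>g\<in>P. f \<circ> g \<in> P) \<and> (\<forall>f\<in>P. \<forall>a. bij a \<longrightarrow> inv a \<circ> f \<circ> a \<in> P)"
  proof cases
    case 1
    then show ?thesis using inv_comp_eq(1) by auto
  next
    case 2
    have "f \<circ> g \<in> Alt" if "f \<in> Alt" "g \<in> Alt" for f g :: "'a \<Rightarrow> 'a"
      using that evenperm_comp[of f g] permutation_compose[of f g] unfolding Alt_iff by simp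
    moreover have "id \<in> Alt" unfolding Alt_iff by (simp add: evenperm_id permutation_id del: id_apply)
    moreover have "inv a \<circ> f \<circ> a \<in> Alt" if "f \<in> Alt" "bij a" for f a :: "'a \<Rightarrow> 'a"
      using that permutation_conj[of f a] unfolding Alt_iff by simp
    ultimately show ?thesis unfolding 2 by blast
  next
    case 3
    have "f \<circ> g \<in> Fin" if "f \<in> Fin" "g \<in> Fin" for f g :: "'a \<Rightarrow> 'a"
      using that permutation_compose[of f g] unfolding Fin_iff by simp
    moreover have "inv a \<circ> f \<circ> a \<in> Fin" if "f \<in> Fin" "bij a" for f a :: "'a \<Rightarrow> 'a"
      using that permutation_conj(1)[of f a] unfolding Fin_iff by simp
    moreover have "id \<in> Fin" unfolding Fin_iff by (rule permutation_id)
    ultimately show ?thesis unfolding 3 by blast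
  next
    case 4
    have "f \<circ> g \<in> Sym" if "f \<in> Sym" "g \<in> Sym" for f g :: "'a \<Rightarrow> 'a"
      using that bij_comp[of g f] unfolding Sym_def by simp
    moreover have "inv a \<circ> f \<circ> a \<in> Sym" if "f \<in> Sym" "bij a" for f a :: "'a \<Rightarrow> 'a"
      using that bij_conj[of f a] unfolding Sym_def by simp
    moreover have "id \<in> Sym" unfolding Sym_def by simp
    ultimately show ?thesis unfolding 4 by blast
  qed
  then show "id \<in> P" "f \<in> P \<Longrightarrow> g \<in> P \<Longrightarrow> f \<circ> g \<in> P" "f \<in> P \<Longrightarrow> bij a \<Longrightarrow> inv a \<circ> f \<circ> a \<in> P" by blast+
qed

lemma C_infinite_approx: "approx_fin f g \<Longrightarrow> n > 0 \<Longrightarrow> C n f = \<infinity> \<longleftrightarrow> C n g = \<infinity>"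
  unfolding approx_fin_def by metis

text \<open>The two situations in which a transposition can keep all counts, see
  \<open>transpose_keeping_counts\<close>.\<close>

definition many_cycles :: "('a \<Rightarrow> 'a) \<Rightarrow> bool" where
  "many_cycles f \<longleftrightarrow> 2 \<le> C_open f + C_fwd f \<or> (\<exists>n>0. C n f = \<infinity>)"

lemma many_cycles_approx: "approx_fin f g \<Longrightarrow> many_cycles f \<longleftrightarrow> many_cycles g"
  unfolding many_cycles_def using C_infinite_approx[of f g] by (auto simp: approx_fin_def)

text \<open>One forward cycle is present, so having fewer than two infinite cycles means having
  exactly one. On maps with a forward cycle the two classes in the condition for \<open>Alt\<close>
  are therefore complementary.\<close>

lemma not_many_cycles:
  assumes "C_fwd f \<noteq> 0"
  shows "\<not> many_cycles f \<longleftrightarrow> single_infinite f \<and> fin_counts f"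
proof -
  have "\<not> 2 \<le> C_open f + C_fwd f \<longleftrightarrow> C_open f + C_fwd f = 1"
    using assms by (cases "C_open f"; cases "C_fwd f") (auto simp: numeral_eq_enat one_enat_def zero_enat_def)
  moreover have "(\<not> (\<exists>n>0. C n f = \<infinity>)) \<longleftrightarrow> fin_counts f" unfolding fin_counts_def by (metis enat_ord_simps(4))
  ultimately show ?thesis unfolding many_cycles_def single_infinite_def by blast
qed

section \<open>The structure of a given normal submonoid\<close>

locale normal_monoid =
  fixes M :: "('a \<Rightarrow> 'a) set"
  assumes cb: "countable (UNIV :: 'a set)" and infU: "infinite (UNIV :: 'a set)" and nm: "normal_submonoid M"
begin

lemma injM: "f \<in> M \<Longrightarrow> inj f"
  using nm unfolding normal_submonoid_def submonoid_def Inj_def by blast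

lemma compM: "f \<in> M \<Longrightarrow> g \<in> M \<Longrightarrow> g \<circ> f \<in> M"
  using nm unfolding normal_submonoid_def submonoid_def by blast

lemma conjM: "f \<in> M \<Longrightarrow> bij a \<Longrightarrow> inv a \<circ> f \<circ> a \<in> M"
  using nm unfolding normal_submonoid_def normal_set_def by blast

lemma conj_eqM:
  assumes "f \<in> M" "bij d" "d \<circ> f = g \<circ> d"
  shows "g \<in> M"
proof -
  have "inv (inv d) \<circ> f \<circ> inv d \<in> M" by (rule conjM[OF assms(1) bij_imp_bij_inv[OF assms(2)]])
  then have "d \<circ> f \<circ> inv d \<in> M" by (simp add: inv_inv_eq[OF assms(2)])
  then show ?thesis unfolding assms(3) by (simp add: comp_assoc inv_comp_eq[OF assms(2)])
qed

lemma idM: "id \<in> M"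
  using nm unfolding normal_submonoid_def submonoid_def by blast

lemma group_part: "M \<inter> Sym \<in> {{id}, Alt, Fin, Sym}"
proof -
  interpret normal_perms "M \<inter> Sym"
  proof
    show "f \<circ> g \<in> M \<inter> Sym" if "f \<in> M \<inter> Sym" "g \<in> M \<inter> Sym" for f g
      using that compM[of g f] bij_comp[of g f] unfolding Sym_def by blast
    show "normal_set (M \<inter> Sym)" unfolding normal_set_def Sym_def using conjM bij_conj by blast
    show "id \<in> M \<inter> Sym" using idM unfolding Sym_def by simp
  qed (use cb infU in blast)+
  show ?thesis by (rule normal_perms_cases)
qed

lemma sum_defect_mem:
  assumes "f \<in> M" "g \<in> M" "defect f \<noteq> 0" "defect g \<noteq> 0" "inj h" "defect h = defect f + defect g"
  shows "h \<in> M"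
proof -
  obtain p q where "bij p" "bij q" "h = (inv q \<circ> g \<circ> q) \<circ> (inv p \<circ> f \<circ> p)"
    using product_of_conjugates[OF cb injM[OF assms(1)] injM[OF assms(2)] assms(5,3,4,6)] by blast
  then show ?thesis using compM conjM assms(1,2) by simp
qed

text \<open>Equal counts make \<open>f \<circ> p\<close> and \<open>g \<circ> q\<close> conjugate by
  some \<open>d\<close>. If \<open>p\<close> and \<open>q\<close> are even, this leads from
  \<open>f\<close> to \<open>g\<close> inside \<open>M\<close>. If both are odd, a transposition on
  one side and its conjugate by \<open>d\<close> on the other make both even without disturbing the
  conjugacy.\<close>

lemma same_count_mem:
  assumes f: "f \<in> M" and g: "inj g" and A: "Alt \<subseteq> M" and p: "permutation p" and q: "permutation q"
    and ev: "evenperm p = evenperm q" and c: "\<And>\<tau>. cnt \<tau> (f \<circ> p) = cnt \<tau> (g \<circ> q)"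
  shows "g \<in> M"
proof -
  have even: "g \<in> M" if p: "permutation p" "evenperm p" and q: "permutation q" "evenperm q"
    and d: "bij d" "d \<circ> (f \<circ> p) = (g \<circ> q) \<circ> d" for p q d
  proof -
    have "p \<in> Alt" using p unfolding Alt_iff by blast
    then have "p \<in> M" using A by blast
    then have "f \<circ> p \<in> M" using compM f by blast
    then have gq: "g \<circ> q \<in> M" using conj_eqM d by blast
    have "inv q \<in> Alt" using permutation_inverse[OF q(1)] evenperm_inv[OF q(1)] q(2) unfolding Alt_iff by simp
    then have "inv q \<in> M" using A by blast
    then have "(g \<circ> q) \<circ> inv q \<in> M" using compM gq by blast
    then show ?thesis using inv_comp_eq(2)[OF permutation_bijective[OF q(1)]] by (simp add: comp_assoc)
  qed
  obtain d where d: "bij d" "d \<circ> (f \<circ> p) = (g \<circ> q) \<circ> d"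
    using conjugate_if_cnt_eq[OF cb inj_comp_permutation[OF injM[OF f] p] inj_comp_permutation[OF g q] c] by blast
  show ?thesis
  proof (cases "evenperm p")
    case True
    then show ?thesis using even[OF p _ q _ d] ev by blast
  next
    case False
    obtain x y :: 'a where xy: "x \<noteq> y" using infU by (metis ex_new_if_finite finite.emptyI finite.insertI insertI1)
    let ?c = "transpose x y" and ?c' = "transpose (d x) (d y)"
    have dc: "d \<circ> ?c = ?c' \<circ> d" using bij_is_inj[OF d(1)] by (auto simp: fun_eq_iff transpose_def inj_eq)
    have "d x \<noteq> d y" using xy bij_is_inj[OF d(1)] by (simp add: inj_eq)
    then have 1: "permutation (p \<circ> ?c)" "evenperm (p \<circ> ?c)" "permutation (q \<circ> ?c')" "evenperm (q \<circ> ?c')"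
      using p q ev False xy by (simp_all add: permutation_compose permutation_swap_id evenperm_comp evenperm_swap)
    have "d \<circ> (f \<circ> (p \<circ> ?c)) = (d \<circ> (f \<circ> p)) \<circ> ?c" by (simp only: comp_assoc)
    also have "\<dots> = (g \<circ> q) \<circ> (?c' \<circ> d)" unfolding d(2) dc[symmetric] by (simp only: comp_assoc)
    also have "\<dots> = (g \<circ> (q \<circ> ?c')) \<circ> d" by (simp only: comp_assoc)
    finally show ?thesis using even[OF 1 d(1)] by blast
  qed
qed

lemma Fin_closed:
  assumes f: "f \<in> M" and g: "inj g" and "approx_fin f g" "cnt Fwd f \<noteq> 0" and F: "Fin \<subseteq> M"
  shows "g \<in> M"
proof -
  obtain p q where p: "permutation p" and q: "permutation q" and c: "\<And>\<tau>. cnt \<tau> (f \<circ> p) = cnt \<tau> (g \<circ> q)"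
    using approx_fin_common[OF injM[OF f] g assms(3,4)] by blast
  have "p \<in> M" "inv q \<in> M" using F p permutation_inverse[OF q] Fin_iff by blast+
  obtain d where d: "bij d" "d \<circ> (f \<circ> p) = (g \<circ> q) \<circ> d"
    using conjugate_if_cnt_eq[OF cb inj_comp_permutation[OF injM[OF f] p] inj_comp_permutation[OF g q] c] by blast
  have "g \<circ> q \<in> M" using conj_eqM[OF compM[OF \<open>p \<in> M\<close> f] d] .
  then have "(g \<circ> q) \<circ> inv q \<in> M" using compM \<open>inv q \<in> M\<close> by blast
  then show ?thesis using inv_comp_eq(2)[OF permutation_bijective[OF q]] by (simp add: comp_assoc)
qed

text \<open>Merging away the differing cycles uses permutations \<open>p\<close> and
  \<open>q\<close> of uncontrolled parity. If their parities differ and \<open>f\<close> has many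
  cycles, a transposition that keeps all counts repairs \<open>p\<close>. In the other case the
  parities must agree: they can be read off from \<open>count_diff\<close>, which is additive, is
  even between \<open>f\<close> and \<open>g\<close>, and vanishes between
  \<open>f \<circ> p\<close> and \<open>g \<circ> q\<close>.\<close>

lemma Alt_closed:
  assumes f: "f \<in> M" and g: "inj g" and a: "approx_fin f g" and w: "cnt Fwd f \<noteq> 0" and A: "Alt \<subseteq> M"
    and cs: "many_cycles f \<or> single_infinite f \<and> fin_counts f \<and> even (count_diff f g)"
  shows "g \<in> M"
proof -
  obtain p q where p: "permutation p" and q: "permutation q" and c: "\<And>\<tau>. cnt \<tau> (f \<circ> p) = cnt \<tau> (g \<circ> q)"
    using approx_fin_common[OF injM[OF f] g a w] by blast
  have ap: "approx_fin f (f \<circ> p)" by (rule comp_permutation_approx(1)[OF p injM[OF f]])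
  have aq: "approx_fin g (g \<circ> q)" by (rule comp_permutation_approx(1)[OF q g])
  show ?thesis
  proof (cases "evenperm p = evenperm q")
    case True
    then show ?thesis by (rule same_count_mem[OF f g A p q _ c])
  next
    case False
    show ?thesis
    proof (cases "many_cycles f")
      case True
      then have "many_cycles (f \<circ> p)" using many_cycles_approx[OF ap] by blast
      moreover have "cnt Fwd (f \<circ> p) \<noteq> 0" using ap w unfolding approx_fin_iff by simp
      ultimately obtain x y where xy: "x \<noteq> y" "\<And>\<tau>. cnt \<tau> (f \<circ> p \<circ> transpose x y) = cnt \<tau> (f \<circ> p)"
        using transpose_keeping_counts[OF inj_comp_permutation[OF injM[OF f] p]] unfolding many_cycles_def by blast
      have "permutation (p \<circ> transpose x y)" "evenperm (p \<circ> transpose x y) = evenperm q"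
        using p q False xy(1) by (auto simp: permutation_compose permutation_swap_id evenperm_comp evenperm_swap)
      moreover have "cnt \<tau> (f \<circ> (p \<circ> transpose x y)) = cnt \<tau> (g \<circ> q)" for \<tau>
        using xy(2)[of \<tau>] c[of \<tau>] by (simp only: comp_assoc)
      ultimately show ?thesis using same_count_mem[OF f g A _ q] by blast
    next
      case n: False
      then have s: "single_infinite f" "fin_counts f" "even (count_diff f g)" using cs by blast+
      have s': "single_infinite g" "fin_counts g"
        using s single_infinite_approx[OF a] fin_counts_approx[OF a] by blast+
      have apq: "approx_fin (f \<circ> p) (g \<circ> q)" by (rule approx_fin_if_cnt_eq[OF c])
      have "count_diff (f \<circ> p) (g \<circ> q) = 0" unfolding count_diff_def C_eq_cnt c by simp
      then have "count_diff f (g \<circ> q) = count_diff f (f \<circ> p)" using count_diff_trans[OF ap apq] by simp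
      moreover have "count_diff f (g \<circ> q) = count_diff f g + count_diff g (g \<circ> q)" by (rule count_diff_trans[OF a aq])
      ultimately have "even (count_diff f (f \<circ> p)) \<longleftrightarrow> even (count_diff g (g \<circ> q))" using s(3) by (metis even_add)
      then have "evenperm p = evenperm q"
        using comp_permutation_approx(2)[OF p injM[OF f] s(1,2)] comp_permutation_approx(2)[OF q g s'] by simp
      then show ?thesis using False by blast
    qed
  qed
qed

lemma Sym_closed:
  assumes "f \<in> M" "inj g" "defect f = defect g" "Sym \<subseteq> M"
  shows "g \<in> M"
proof -
  obtain b where "bij b" "g = b \<circ> f" using ex_bij_comp_eq[OF cb injM[OF assms(1)] assms(2,3)] by blast
  then show ?thesis using compM[OF assms(1)] assms(4) unfolding Sym_def by blast
qed

text \<open>Infinity is its own double, so products of two conjugates of a single map of infinite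
  defect already give all maps of infinite defect.\<close>

lemma inf_part: "M \<inter> Inj_inf \<in> {{}, Inj_inf}"
proof (cases "M \<inter> Inj_inf = {}")
  case False
  then obtain f where f: "f \<in> M" "defect f = \<infinity>" unfolding Inj_inf_def by blast
  have "h \<in> M" if "h \<in> Inj_inf" for h
    using sum_defect_mem[OF f(1) f(1), of h] f(2) that unfolding Inj_inf_def by (simp add: zero_enat_def)
  then show ?thesis by blast
qed simp

lemma decomposition: "M = (M \<inter> Sym) \<union> (M \<inter> Inj_fin) \<union> (M \<inter> Inj_inf)"
proof -
  have "f \<in> Sym \<union> Inj_fin \<union> Inj_inf" if "f \<in> M" for f
  proof (cases "defect f")
    case (enat n)
    show ?thesis
    proof (cases "n = 0")
      case True
      then have "surj f" using enat defect_eq_0[of f] by (simp add: zero_enat_def)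
      then show ?thesis using injM[OF that] unfolding Sym_def bij_def by blast
    next
      case False
      then show ?thesis using enat injM[OF that] unfolding Inj_fin_def by (simp add: one_enat_def)
    qed
  next
    case infinity
    then show ?thesis using injM[OF that] unfolding Inj_inf_def by blast
  qed
  then show ?thesis by blast
qed

definition N :: "nat set" where "N = {n. \<exists>f\<in>M. defect f = enat n}"

definition B :: "('a \<Rightarrow> 'a) set" where "B = {f \<in> M. defect f \<in> enat ` Gn N}"

lemma N_submonoid: "add_submonoid N"
  unfolding add_submonoid_def
proof (intro conjI ballI)
  show "0 \<in> N" unfolding N_def using idM defect_bij[of id] by (auto simp: zero_enat_def)
  fix x y assume "x \<in> N" "y \<in> N"
  then obtain f g where fg: "f \<in> M" "g \<in> M" "defect f = enat x" "defect g = enat y" unfolding N_def by blast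
  then have "defect (g \<circ> f) = enat (x + y)" using defect_comp[OF injM[OF fg(2)]] by simp
  then show "x + y \<in> N" unfolding N_def using compM fg by blast
qed

lemma B_defect: "f \<in> B \<Longrightarrow> C_fwd f \<noteq> 0" "f \<in> B \<Longrightarrow> cnt Fwd f \<noteq> 0"
proof -
  assume f: "f \<in> B"
  then have "defect f \<noteq> 0" unfolding B_def using zero_not_Gn[OF N_submonoid] by (auto simp: zero_enat_def)
  then show "C_fwd f \<noteq> 0" using defect_eq_C_fwd[OF injM] f unfolding B_def by simp
  then show "cnt Fwd f \<noteq> 0" unfolding C_fwd_eq_cnt .
qed

text \<open>\<open>approx_fin\<close> preserves the number of forward cycles, which is the defect,
  so membership in \<open>M\<close> is all that has to be checked.\<close>

lemma B_approx:
  assumes "f \<in> B" "inj g" "approx_fin f g" "g \<in> M"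
  shows "g \<in> B"
proof -
  have "f \<in> M" using assms(1) unfolding B_def by blast
  then have "defect f = defect g"
    using defect_eq_C_fwd[OF injM] defect_eq_C_fwd[OF assms(2)] assms(3) unfolding approx_fin_def by simp
  then show ?thesis using assms(1,4) unfolding B_def by simp
qed

lemma fin_part: "M \<inter> Inj_fin = B \<union> {f \<in> Inj. defect f \<in> enat ` (N - (Gn N \<union> {0}))}"
proof
  show "M \<inter> Inj_fin \<subseteq> B \<union> {f \<in> Inj. defect f \<in> enat ` (N - (Gn N \<union> {0}))}"
  proof
    fix f assume f: "f \<in> M \<inter> Inj_fin"
    then obtain n where n: "defect f = enat n" "n \<noteq> 0"
      unfolding Inj_fin_def by (cases "defect f") (auto simp: one_enat_def)
    then have "n \<in> N" using f unfolding N_def by blast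
    then show "f \<in> B \<union> {f \<in> Inj. defect f \<in> enat ` (N - (Gn N \<union> {0}))}"
      using f n injM[of f] unfolding B_def Inj_def by blast
  qed
  have "f \<in> M \<inter> Inj_fin" if f: "f \<in> B" for f
  proof -
    have "f \<in> M" using f unfolding B_def by blast
    moreover obtain n where "defect f = enat n" "n \<in> Gn N" using f unfolding B_def by blast
    moreover have "n \<noteq> 0" using calculation(3) zero_not_Gn[OF N_submonoid] by metis
    ultimately show ?thesis using injM[of f] unfolding Inj_fin_def by (simp add: one_enat_def)
  qed
  moreover have "f \<in> M \<inter> Inj_fin" if f: "inj f" "defect f = enat n" "n \<in> N - (Gn N \<union> {0})" for f n
  proof -
    have "n \<in> N" "n \<noteq> 0" "n \<notin> Gn N" using f(3) by simp_all
    from not_Gn_decomp[OF N_submonoid this]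
    obtain x y where xy: "x \<in> N" "y \<in> N" "x \<noteq> 0" "y \<noteq> 0" "n = x + y" by blast
    then obtain a b where "a \<in> M" "b \<in> M" "defect a = enat x" "defect b = enat y" unfolding N_def by blast
    then have "f \<in> M" using sum_defect_mem[of a b f] f xy by (simp add: zero_enat_def)
    then show ?thesis using f unfolding Inj_fin_def by (simp add: one_enat_def)
  qed
  ultimately show "B \<union> {f \<in> Inj. defect f \<in> enat ` (N - (Gn N \<union> {0}))} \<subseteq> M \<inter> Inj_fin"
    unfolding Inj_def by blast
qed

lemma B_props: "B \<subseteq> Inj" "normal_set B" "defect ` B = enat ` Gn N"
proof -
  show "B \<subseteq> Inj" using injM unfolding B_def Inj_def by blast
  show "normal_set B"
    unfolding normal_set_def
  proof (intro ballI allI impI)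
    fix f a :: "'a \<Rightarrow> 'a" assume f: "f \<in> B" and a: "bij a"
    have fM: "f \<in> M" using f unfolding B_def by blast
    show "inv a \<circ> f \<circ> a \<in> B"
      using f conjM[OF fM a] defect_conj[OF injM[OF fM] a] unfolding B_def by simp
  qed
  have "enat n \<in> defect ` B" if n: "n \<in> Gn N" for n
  proof -
    have "n \<in> N" using n Gn_subset[OF N_submonoid] by blast
    then obtain f where "f \<in> M" "defect f = enat n" unfolding N_def by blast
    then show ?thesis using n unfolding B_def by force
  qed
  then show "defect ` B = enat ` Gn N" unfolding B_def by blast
qed

lemma rel_closedI:
  assumes "\<And>f g. R f g \<Longrightarrow> R g f" "\<And>f g. inj g \<Longrightarrow> R f g \<Longrightarrow> f \<in> S \<Longrightarrow> g \<in> S"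
  shows "rel_closed R S"
  using assms unfolding rel_closed_def by blast

lemma B_closed_Alt:
  assumes "M \<inter> Sym = Alt"
  shows "rel_closed approx_fin {f \<in> B. many_cycles f}"
    "rel_closed approx_even {f \<in> B. single_infinite f \<and> fin_counts f}"
proof -
  have A: "Alt \<subseteq> M" using assms by blast
  have BM: "f \<in> M" if "f \<in> B" for f using that unfolding B_def by blast
  show "rel_closed approx_fin {f \<in> B. many_cycles f}"
  proof (rule rel_closedI[OF approx_fin_sym])
    fix f g :: "'a \<Rightarrow> 'a"
    assume g: "inj g" and a: "approx_fin f g" and f: "f \<in> {f \<in> B. many_cycles f}"
    have "g \<in> M" using Alt_closed[OF BM g a B_defect(2) A] f by blast
    then show "g \<in> {f \<in> B. many_cycles f}" using B_approx[OF _ g a] many_cycles_approx[OF a] f by blast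
  qed
  show "rel_closed approx_even {f \<in> B. single_infinite f \<and> fin_counts f}"
  proof (rule rel_closedI)
    show "approx_even g f" if "approx_even f g" for f g :: "'a \<Rightarrow> 'a"
      using that approx_fin_sym[of f g] count_diff_swap[of f g] unfolding approx_even_iff by simp
    fix f g :: "'a \<Rightarrow> 'a"
    assume g: "inj g" and e: "approx_even f g" and f: "f \<in> {f \<in> B. single_infinite f \<and> fin_counts f}"
    have a: "approx_fin f g" "even (count_diff f g)" using e unfolding approx_even_iff by blast+
    have "g \<in> M" using Alt_closed[OF BM g a(1) B_defect(2) A] f a(2) by blast
    then show "g \<in> {f \<in> B. single_infinite f \<and> fin_counts f}"
      using B_approx[OF _ g a(1)] single_infinite_approx[OF a(1)] fin_counts_approx[OF a(1)] f by blast
  qed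
qed

lemma B_closed_Fin:
  assumes "M \<inter> Sym = Fin"
  shows "rel_closed approx_fin B"
proof (rule rel_closedI[OF approx_fin_sym])
  fix f g :: "'a \<Rightarrow> 'a"
  assume g: "inj g" and a: "approx_fin f g" and f: "f \<in> B"
  have "g \<in> M" using Fin_closed[OF _ g a B_defect(2)[OF f]] f assms unfolding B_def by blast
  then show "g \<in> B" by (rule B_approx[OF f g a])
qed

lemma B_Sym:
  assumes "M \<inter> Sym = Sym"
  shows "B = {f \<in> Inj. defect f \<in> enat ` Gn N}"
proof
  show "B \<subseteq> {f \<in> Inj. defect f \<in> enat ` Gn N}" using B_props(1) unfolding B_def by blast
  show "{f \<in> Inj. defect f \<in> enat ` Gn N} \<subseteq> B"
  proof
    fix g :: "'a \<Rightarrow> 'a" assume g: "g \<in> {f \<in> Inj. defect f \<in> enat ` Gn N}"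
    then have "defect g \<in> defect ` B" using B_props(3) by simp
    then obtain f where "f \<in> M" "defect f = defect g" unfolding B_def by auto
    then have "g \<in> M" using Sym_closed[of f g] g assms unfolding Inj_def by blast
    then show "g \<in> B" using g unfolding B_def by blast
  qed
qed

end

section \<open>The converse\<close>

text \<open>The conditions on \<open>B\<close> serve the products of a permutation with a map of
  finite nonzero defect. Elsewhere closure is automatic: infinite defect absorbs, the permutations
  form a monoid, and two nonzero elements of \<open>N\<close> add up to an element outside
  \<open>Gn N\<close>, where all injections are present.\<close>

lemma normal_submonoid_if_components:
  fixes M :: "('a \<Rightarrow> 'a) set"
  assumes dec: "M = (M \<inter> Sym) \<union> (M \<inter> Inj_fin) \<union> (M \<inter> Inj_inf)"
    and P: "M \<inter> Sym \<in> {{id}, Alt, Fin, Sym}" and N: "add_submonoid N" and B: "B \<subseteq> Inj" "normal_set B" "defect ` B = enat ` Gn N"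
    and fin: "M \<inter> Inj_fin = B \<union> {f \<in> Inj. defect f \<in> enat ` (N - (Gn N \<union> {0}))}"
    and Alt: "M \<inter> Sym = Alt \<longrightarrow> rel_closed approx_fin {f \<in> B. many_cycles f} \<and>
      rel_closed approx_even {f \<in> B. single_infinite f \<and> fin_counts f}"
    and Fin: "M \<inter> Sym = Fin \<longrightarrow> rel_closed approx_fin B"
    and Sym: "M \<inter> Sym = Sym \<longrightarrow> B = {f \<in> Inj. defect f \<in> enat ` Gn N}"
    and inf: "M \<inter> Inj_inf \<in> {{}, Inj_inf}"
  shows "normal_submonoid M"
proof -
  note PC = perm_set_closed[OF P]
  have cases: "f \<in> M \<inter> Sym \<or> f \<in> M \<inter> Inj_fin \<or> f \<in> M \<inter> Inj_inf" if "f \<in> M" for f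
    using dec that by blast
  have injM: "inj f" if "f \<in> M" for f
    using cases[OF that] unfolding Sym_def Inj_fin_def Inj_inf_def using bij_is_inj by blast
  have infM: "h \<in> M" if "f \<in> M" "defect f = \<infinity>" "inj h" "defect h = \<infinity>" for f h
    using inf that injM[OF that(1)] unfolding Inj_inf_def by blast
  have dN: "\<exists>n\<in>N. n \<noteq> 0 \<and> defect f = enat n" if "f \<in> M \<inter> Inj_fin" for f
  proof -
    have "f \<in> B \<or> defect f \<in> enat ` (N - (Gn N \<union> {0}))" using that fin by blast
    then have "defect f \<in> enat ` (N - {0})"
      using B(3) Gn_subset[OF N] zero_not_Gn[OF N] by blast
    then show ?thesis by blast
  qed
  have conj: "inv a \<circ> f \<circ> a \<in> M" if f: "f \<in> M" and a: "bij a" for f a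
  proof -
    note d = defect_conj[OF injM[OF f] a] and i = inj_conj[OF injM[OF f] a]
    consider "f \<in> M \<inter> Sym" | "f \<in> M \<inter> Inj_fin" | "f \<in> M \<inter> Inj_inf" using cases[OF f] by blast
    then show ?thesis
    proof cases
      case 1 then show ?thesis using PC(3)[OF _ a] by blast
    next
      case 2
      then have "f \<in> B \<or> defect f \<in> enat ` (N - (Gn N \<union> {0}))" using fin by blast
      then have "inv a \<circ> f \<circ> a \<in> B \<union> {f \<in> Inj. defect f \<in> enat ` (N - (Gn N \<union> {0}))}"
        using B(2) a d i unfolding normal_set_def Inj_def by auto
      then show ?thesis using fin by blast
    next
      case 3
      then have "defect f = \<infinity>" unfolding Inj_inf_def by blast
      then show ?thesis using infM[OF f _ i] d by simp
    qed
  qed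
  have right: "f \<circ> a \<in> M" if f: "f \<in> M \<inter> Inj_fin" and a: "a \<in> M \<inter> Sym" for f a
  proof -
    have ba: "bij a" using a unfolding Sym_def by blast
    have fi: "inj f" using f injM by blast
    have i: "inj (f \<circ> a)" by (rule inj_compose[OF fi bij_is_inj[OF ba]])
    have d: "defect (f \<circ> a) = defect f" using defect_comp[OF fi, of a] defect_bij[OF ba] by simp
    show ?thesis
    proof (cases "f \<in> B")
      case False
      then have "f \<circ> a \<in> {f \<in> Inj. defect f \<in> enat ` (N - (Gn N \<union> {0}))}" using f fin d i unfolding Inj_def by auto
      then show ?thesis using fin by blast
    next
      case True
      consider "M \<inter> Sym = {id}" | "M \<inter> Sym = Alt" | "M \<inter> Sym = Fin" | "M \<inter> Sym = Sym" using P by blast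
      then have "f \<circ> a \<in> B"
      proof cases
        case 1
        then have "a = id" using a by blast
        then show ?thesis using True by simp
      next
        case 2
        then have "a \<in> Alt" using a by blast
        then have pa: "permutation a" "evenperm a" unfolding Alt_iff by blast+
        have ap: "approx_fin f (f \<circ> a)" by (rule comp_permutation_approx(1)[OF pa(1) fi])
        show ?thesis
        proof (cases "many_cycles f")
          case m: True
          then have "f \<in> {f \<in> B. many_cycles f}" using True by blast
          then have "f \<circ> a \<in> {f \<in> B. many_cycles f}"
            using mp[OF Alt 2] fi i ap unfolding rel_closed_def by blast
          then show ?thesis by blast
        next
          case m: False
          \<comment> \<open>A nonzero defect means a forward cycle, so \<open>f\<close> falls into
            the complementary class, where \<open>approx_even\<close> governs.\<close>
          have "defect f \<noteq> 0" using dN[OF f] by (auto simp: zero_enat_def)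
          then have s: "single_infinite f" "fin_counts f"
            using not_many_cycles[of f] m defect_eq_C_fwd[OF fi] by simp_all
          then have "f \<in> {f \<in> B. single_infinite f \<and> fin_counts f}" using True by blast
          moreover have "approx_even f (f \<circ> a)"
            unfolding approx_even_iff using ap comp_permutation_approx(2)[OF pa(1) fi s] pa(2) by blast
          ultimately have "f \<circ> a \<in> {f \<in> B. single_infinite f \<and> fin_counts f}"
            using mp[OF Alt 2] fi i unfolding rel_closed_def by blast
          then show ?thesis by blast
        qed
      next
        case 3
        then have "a \<in> Fin" using a by blast
        then have "permutation a" unfolding Fin_iff .
        then show ?thesis
          using mp[OF Fin 3] comp_permutation_approx(1)[OF _ fi] fi i True unfolding rel_closed_def by blast
      next
        case 4
        then have "defect f \<in> enat ` Gn N" using mp[OF Sym 4] True by blast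
        then show ?thesis using mp[OF Sym 4] d i unfolding Inj_def by simp
      qed
      then show ?thesis using fin by blast
    qed
  qed
  \<comment> \<open>\<open>a \<circ> f\<close> is a conjugate of \<open>f \<circ> a\<close>, so
    multiplication on the other side needs no further study of cycles.\<close>
  have left: "a \<circ> f \<in> M" if f: "f \<in> M \<inter> Inj_fin" and a: "a \<in> M \<inter> Sym" for f a
  proof -
    have ba: "bij a" using a unfolding Sym_def by blast
    have "inv (inv a) \<circ> (f \<circ> a) \<circ> inv a \<in> M" by (rule conj[OF right[OF f a] bij_imp_bij_inv[OF ba]])
    moreover have "inv (inv a) \<circ> (f \<circ> a) \<circ> inv a = a \<circ> f"
      unfolding inv_inv_eq[OF ba] comp_assoc inv_comp_eq(2)[OF ba] by simp
    ultimately show ?thesis by simp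
  qed
  have comp: "g \<circ> f \<in> M" if f: "f \<in> M" and g: "g \<in> M" for f g
  proof -
    have d: "defect (g \<circ> f) = defect f + defect g" by (rule defect_comp[OF injM[OF g]])
    have i: "inj (g \<circ> f)" by (rule inj_compose[OF injM[OF g] injM[OF f]])
    consider "defect f = \<infinity>" | "defect g = \<infinity>" | "f \<in> M \<inter> Sym" "g \<in> M \<inter> Sym" | "f \<in> M \<inter> Sym" "g \<in> M \<inter> Inj_fin"
      | "f \<in> M \<inter> Inj_fin" "g \<in> M \<inter> Sym" | "f \<in> M \<inter> Inj_fin" "g \<in> M \<inter> Inj_fin"
    proof -
      have "u \<in> M \<inter> Sym \<or> u \<in> M \<inter> Inj_fin \<or> defect u = \<infinity>" if "u \<in> M" for u
        using cases[OF that] by (auto simp: Inj_inf_def)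
      from this[OF f] this[OF g] that show thesis by argo
    qed
    then show ?thesis
    proof cases
      case 1 then show ?thesis using infM[OF f _ i] d by simp
    next
      case 2 then show ?thesis using infM[OF g _ i] d by simp
    next
      case 3 then show ?thesis using PC(2) by blast
    next
      case 4 then show ?thesis using right by blast
    next
      case 5 then show ?thesis using left by blast
    next
      case 6
      obtain x y where xy: "x \<in> N" "x \<noteq> 0" "defect f = enat x" "y \<in> N" "y \<noteq> 0" "defect g = enat y"
        using dN[OF 6(1)] dN[OF 6(2)] by blast
      have "x + y \<in> N - (Gn N \<union> {0})"
        using N sum_not_Gn[OF N xy(1,4,2,5)] xy unfolding add_submonoid_def by simp
      moreover have "defect (g \<circ> f) = enat (x + y)" using d xy by simp
      ultimately have "g \<circ> f \<in> {f \<in> Inj. defect f \<in> enat ` (N - (Gn N \<union> {0}))}" using i unfolding Inj_def by blast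
      then show ?thesis using fin by blast
    qed
  qed
  show ?thesis
    unfolding normal_submonoid_def submonoid_def normal_set_def Inj_def
    using injM comp conj PC(1) by blast
qed

theorem mainTheorem1:
  fixes M :: "('a \<Rightarrow> 'a) set"
  assumes "countable (UNIV :: 'a set)" and "infinite (UNIV :: 'a set)"
  shows "normal_submonoid M \<longleftrightarrow>
    (M = (M \<inter> Sym) \<union> (M \<inter> Inj_fin) \<union> (M \<inter> Inj_inf) \<and>
     M \<inter> Sym \<in> {{id}, Alt, Fin, Sym} \<and>
     (\<exists>N B. add_submonoid N \<and> B \<subseteq> Inj \<and> normal_set B \<and>
        defect ` B = enat ` Gn N \<and>
        M \<inter> Inj_fin = B \<union> {f \<in> Inj. defect f \<in> enat ` (N - (Gn N \<union> {0}))} \<and>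
        (M \<inter> Sym = Alt \<longrightarrow>
           rel_closed approx_fin
             {f \<in> B. 2 \<le> C_open f + C_fwd f \<or> (\<exists>n>0. C n f = \<infinity>)} \<and>
           rel_closed approx_even
             {f \<in> B. C_open f + C_fwd f = 1 \<and> (\<forall>n>0. C n f < \<infinity>)}) \<and>
        (M \<inter> Sym = Fin \<longrightarrow> rel_closed approx_fin B) \<and>
        (M \<inter> Sym = Sym \<longrightarrow> B = {f \<in> Inj. defect f \<in> enat ` Gn N})) \<and>
     M \<inter> Inj_inf \<in> {{}, Inj_inf})"
  unfolding many_cycles_def[symmetric] single_infinite_def[symmetric] fin_counts_def[symmetric]
proof (rule iffI, goal_cases)
  case 1
  then interpret normal_monoid M using assms by unfold_locales
  \<comment> \<open>The witnesses are the set of finite defects occurring in \<open>M\<close> and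
    the members of \<open>M\<close> whose defect lies in its minimal generating set.\<close>
  show ?case
    by (intro conjI impI exI[of _ N] exI[of _ B])
      (fact decomposition group_part N_submonoid B_props fin_part inf_part
        | erule B_closed_Alt B_closed_Fin B_Sym)+
next
  case 2
  then show ?case by (elim conjE exE) (rule normal_submonoid_if_components)
qed

end
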